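(* Consider a sequence of instances of the data model below indexed by $n\to\infty$ (with $d,\Sigma,w^*$ allowed to depend on $n$, $\sigma$ fixed), and let $\hat w$ be the minimal $\ell_2$ norm interpolator. Suppose there is a sequence of covariance splittings $\Sigma=\Sigma_1\oplus\Sigma_2$ with $\Sigma_2\neq0$ such that, with $H\sim N(0,I_d)$: (1) $\operatorname{rank}(\Sigma_1)/n\to0$; (2) $n/R(\Sigma_2)\to0$; (3) $\|w^*\|_2\,\mathbb{E}\|\Sigma_2^{1/2}H\|_2/\sqrt n\to0$. Then $L(\hat w)\to\sigma^2$ in probability.
   Context: Data model: $d \ge n$; $\Sigma \in \mathbb{R}^{d\times d}$ positive semidefinite; $w^* \in \mathbb{R}^d$ arbitrary; $\sigma\ge0$. $X \in \mathbb{R}^{n\times d}$ has i.i.d. rows $X_i\sim N(0,\Sigma)$, $\xi\sim N(0,\sigma^2I_n)$ independent of $X$, $Y=Xw^*+\xi$. $L(w)=\sigma^2+\|w-w^*\|_\Sigma^2$, $\|x\|_A^2:=\langle x,Ax\rangle$. $\hat w\in\arg\min\{\|w\|_2:Xw=Y\}$. Covariance splitting: $\Sigma=\Sigma_1\oplus\Sigma_2$ means $\Sigma=\Sigma_1+\Sigma_2$, both positive semidefinite, with orthogonal column spaces. $R(A)=\operatorname{Tr}(A)^2/\operatorname{Tr}(A^2)$. *)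

theory Defs
  imports "HOL-Probability.Probability"
begin

text \<open>Vectors of dimension k: functions nat => real (only indices < k matter).
  Matrices of size m x k: functions nat => nat => real (only indices < m, < k matter).\<close>

definition sqnorm :: "nat \<Rightarrow> (nat \<Rightarrow> real) \<Rightarrow> real" where
  "sqnorm k v = (\<Sum>i<k. (v i)\<^sup>2)"

definition mvec :: "nat \<Rightarrow> (nat \<Rightarrow> nat \<Rightarrow> real) \<Rightarrow> (nat \<Rightarrow> real) \<Rightarrow> (nat \<Rightarrow> real)" where
  "mvec k A v = (\<lambda>i. \<Sum>j<k. A i j * v j)"

definition inner_k :: "nat \<Rightarrow> (nat \<Rightarrow> real) \<Rightarrow> (nat \<Rightarrow> real) \<Rightarrow> real" where
  "inner_k k u v = (\<Sum>i<k. u i * v i)"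

definition qform :: "nat \<Rightarrow> (nat \<Rightarrow> nat \<Rightarrow> real) \<Rightarrow> (nat \<Rightarrow> real) \<Rightarrow> real" where
  "qform d A x = inner_k d x (mvec d A x)"

definition sym_mat :: "nat \<Rightarrow> (nat \<Rightarrow> nat \<Rightarrow> real) \<Rightarrow> bool" where
  "sym_mat d A \<longleftrightarrow> (\<forall>i<d. \<forall>j<d. A i j = A j i)"

definition psd :: "nat \<Rightarrow> (nat \<Rightarrow> nat \<Rightarrow> real) \<Rightarrow> bool" where
  "psd d A \<longleftrightarrow> sym_mat d A \<and> (\<forall>x. qform d A x \<ge> 0)"

definition is_sq :: "nat \<Rightarrow> (nat \<Rightarrow> nat \<Rightarrow> real) \<Rightarrow> bool" where
  "is_sq d A \<longleftrightarrow> (\<forall>i j. (i \<ge> d \<or> j \<ge> d) \<longrightarrow> A i j = 0)"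

definition mmul :: "nat \<Rightarrow> (nat \<Rightarrow> nat \<Rightarrow> real) \<Rightarrow> (nat \<Rightarrow> nat \<Rightarrow> real) \<Rightarrow> (nat \<Rightarrow> nat \<Rightarrow> real)" where
  "mmul k A B = (\<lambda>i j. \<Sum>l<k. A i l * B l j)"

definition psd_sqrt :: "nat \<Rightarrow> (nat \<Rightarrow> nat \<Rightarrow> real) \<Rightarrow> (nat \<Rightarrow> nat \<Rightarrow> real)" where
  "psd_sqrt d A = (THE S. is_sq d S \<and> psd d S \<and> (\<forall>i<d. \<forall>j<d. mmul d S S i j = A i j))"

definition trace :: "nat \<Rightarrow> (nat \<Rightarrow> nat \<Rightarrow> real) \<Rightarrow> real" where
  "trace d A = (\<Sum>i<d. A i i)"

definition eff_rank :: "nat \<Rightarrow> (nat \<Rightarrow> nat \<Rightarrow> real) \<Rightarrow> real" where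
  "eff_rank d A = (trace d A)\<^sup>2 / trace d (mmul d A A)"

definition cols_indep :: "nat \<Rightarrow> (nat \<Rightarrow> nat \<Rightarrow> real) \<Rightarrow> nat set \<Rightarrow> bool" where
  "cols_indep d A J \<longleftrightarrow>
     (\<forall>c. (\<forall>i<d. (\<Sum>j\<in>J. c j * A i j) = 0) \<longrightarrow> (\<forall>j\<in>J. c j = 0))"

definition mrank :: "nat \<Rightarrow> (nat \<Rightarrow> nat \<Rightarrow> real) \<Rightarrow> nat" where
  "mrank d A = Max {card J | J. J \<subseteq> {..<d} \<and> cols_indep d A J}"

definition cov_split :: "nat \<Rightarrow> (nat \<Rightarrow> nat \<Rightarrow> real) \<Rightarrow> (nat \<Rightarrow> nat \<Rightarrow> real) \<Rightarrow> (nat \<Rightarrow> nat \<Rightarrow> real) \<Rightarrow> bool" where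
  "cov_split d \<Sigma> \<Sigma>1 \<Sigma>2 \<longleftrightarrow>
     psd d \<Sigma>1 \<and> psd d \<Sigma>2 \<and>
     (\<forall>i<d. \<forall>j<d. \<Sigma> i j = \<Sigma>1 i j + \<Sigma>2 i j) \<and>
     (\<forall>u v. inner_k d (mvec d \<Sigma>1 u) (mvec d \<Sigma>2 v) = 0)"

text \<open>Minimal l2-norm interpolator of \<open>X w = Y\<close> (X is n x d); vectors are taken
  supported on {..<d} so that the minimiser is unique when it exists.\<close>
definition interp_set :: "nat \<Rightarrow> nat \<Rightarrow> (nat \<Rightarrow> nat \<Rightarrow> real) \<Rightarrow> (nat \<Rightarrow> real) \<Rightarrow> (nat \<Rightarrow> real) set" where
  "interp_set n d X Y = {w. (\<forall>j\<ge>d. w j = 0) \<and> (\<forall>i<n. mvec d X w i = Y i)}"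

definition min_norm_interp :: "nat \<Rightarrow> nat \<Rightarrow> (nat \<Rightarrow> nat \<Rightarrow> real) \<Rightarrow> (nat \<Rightarrow> real) \<Rightarrow> (nat \<Rightarrow> real)" where
  "min_norm_interp n d X Y =
     (THE w. w \<in> interp_set n d X Y \<and> (\<forall>v\<in>interp_set n d X Y. sqnorm d w \<le> sqnorm d v))"

definition test_loss :: "nat \<Rightarrow> real \<Rightarrow> (nat \<Rightarrow> nat \<Rightarrow> real) \<Rightarrow> (nat \<Rightarrow> real) \<Rightarrow> (nat \<Rightarrow> real) \<Rightarrow> real" where
  "test_loss d \<sigma> \<Sigma> wstar w = \<sigma>\<^sup>2 + qform d \<Sigma> (\<lambda>i. w i - wstar i)"

definition sample_space :: "nat \<Rightarrow> nat \<Rightarrow> ((nat \<times> nat \<Rightarrow> real) \<times> (nat \<Rightarrow> real)) measure" where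
  "sample_space n d =
     (PiM ({..<n} \<times> {..<d}) (\<lambda>_. std_normal_distribution)) \<Otimes>\<^sub>M
     (PiM {..<n} (\<lambda>_. std_normal_distribution))"

text \<open>Data: rows \<open>X_i = \<Sigma>^{1/2} g_i \<sim> N(0,\<Sigma>)\<close> i.i.d., noise \<open>\<xi> = \<sigma> z \<sim> N(0, \<sigma>^2 I_n)\<close>,
  \<open>Y = X w* + \<xi>\<close>.\<close>
definition design :: "nat \<Rightarrow> (nat \<Rightarrow> nat \<Rightarrow> real) \<Rightarrow> (nat \<times> nat \<Rightarrow> real) \<Rightarrow> (nat \<Rightarrow> nat \<Rightarrow> real)" where
  "design d \<Sigma> G = (\<lambda>i j. \<Sum>k<d. psd_sqrt d \<Sigma> j k * G (i, k))"

definition response :: "nat \<Rightarrow> real \<Rightarrow> (nat \<Rightarrow> nat \<Rightarrow> real) \<Rightarrow> (nat \<Rightarrow> real)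
    \<Rightarrow> (nat \<times> nat \<Rightarrow> real) \<times> (nat \<Rightarrow> real) \<Rightarrow> (nat \<Rightarrow> real)" where
  "response d \<sigma> \<Sigma> wstar \<omega> = (\<lambda>i. mvec d (design d \<Sigma> (fst \<omega>)) wstar i + \<sigma> * snd \<omega> i)"

definition mni_loss :: "nat \<Rightarrow> nat \<Rightarrow> real \<Rightarrow> (nat \<Rightarrow> nat \<Rightarrow> real) \<Rightarrow> (nat \<Rightarrow> real)
    \<Rightarrow> (nat \<times> nat \<Rightarrow> real) \<times> (nat \<Rightarrow> real) \<Rightarrow> real" where
  "mni_loss n d \<sigma> \<Sigma> wstar \<omega> =
     test_loss d \<sigma> \<Sigma> wstar
       (min_norm_interp n d (design d \<Sigma> (fst \<omega>)) (response d \<sigma> \<Sigma> wstar \<omega>))"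

definition exp_norm_sqrtH :: "nat \<Rightarrow> (nat \<Rightarrow> nat \<Rightarrow> real) \<Rightarrow> real" where
  "exp_norm_sqrtH d A =
     integral\<^sup>L (PiM {..<d} (\<lambda>_. std_normal_distribution))
       (\<lambda>h. sqrt (sqnorm d (mvec d (psd_sqrt d A) h)))"

end

theory Submission
  imports Defs
begin

text \<open>Write \<open>\<Sigma> = S\<^sup>2\<close>, \<open>T = tr \<Sigma>2\<close>, \<open>k = rank \<Sigma>1\<close>, \<open>x\<^sub>i\<close> for the rows of \<open>X\<close>, \<open>Q\<close> for the projection onto the null
  space of \<open>X\<close> and \<open>Q\<^sub>i\<close> for the projection onto the complement of all rows but the \<open>i\<close>th. The interpolator is
  \<open>w* - Q w* + \<Sum>\<^sub>i \<xi>\<^sub>i Q\<^sub>i x\<^sub>i / D\<^sub>i\<close> with \<open>D\<^sub>i = \<langle>x\<^sub>i, Q\<^sub>i x\<^sub>i\<rangle>\<close>, so only second moments conditional on the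
  other rows are needed once the null spaces are under control.

  (1) A PAC-Bayes argument with a Gaussian prior adapted to the splitting shows that, with high probability, every \<open>u\<close>
  orthogonal to all rows but one satisfies \<open>|S u|\<^sup>2 \<le> C (T / n) |u|\<^sup>2\<close>. This bounds the bias by
  \<open>C T |w*|\<^sup>2 / n\<close>, which vanishes since \<open>E |\<Sigma>2\<^sup>1\<^sup>/\<^sup>2 H| \<ge> sqrt (T / 3)\<close>, and it bounds the Frobenius norm:
  \<open>|S Q\<^sub>i S|\<^sup>2 \<le> 4 k (C T / n)\<^sup>2 + 2 |\<Sigma>2|\<^sup>2\<close>, which is \<open>o(T\<^sup>2 / n)\<close>.

  (2) Given the other rows, \<open>D\<^sub>i\<close> is a Gaussian quadratic form with mean at least
  \<open>T - sqrt (n |\<Sigma>2|\<^sup>2) \<ge> T / 2\<close> and variance \<open>2 |S Q\<^sub>i S|\<^sup>2\<close>; as this is \<open>o(T\<^sup>2 / n)\<close>,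
  Chebyshev's inequality and a union bound give \<open>D\<^sub>i \<ge> T / 4\<close> for all \<open>i\<close> simultaneously.

  (3) The expected loss of the noise part is then at most \<open>16 \<sigma>\<^sup>2 \<Sum>\<^sub>i |S Q\<^sub>i S|\<^sup>2 / T\<^sup>2 = o(1)\<close>.\<close>

section \<open>Vectors, matrices and positive semidefinite forms\<close>

text \<open>The obstacle is the union bound over the n rows. Each \<open>D G i\<close> is controlled
  only through its variance, so it must fail with probability o(1/n); for fixed \<eta>, conditions
  (1) and (2) make n \<open>Fmax\<close> / T^2 tend to 0. The null space bound rests on an
  exponentially reliable event for each i and on one event shared by all i, the size of
  \<open>rowmat d G L\<close>, which costs 400 \<eta>. That cost does not vanish with n: \<eta> is
  fixed from the target probability before n grows, at the price of a factor 1/\<eta> in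
  \<open>\<kappa>\<close>. The eigenvalues of \<Sigma>1 are arbitrary, so the prior is flat on its
  column space and only the rank enters. Conditioning takes the form of integrating against a fresh
  copy of row i. This needs events that ignore row i: the event \<open>typical\<close> looks at all
  rows, so it is weakened to \<open>good\<close>, which looks only at the others. No spectral
  decomposition occurs. Roots come from the binomial series and projections from Gram-Schmidt, whose
  explicit formula also gives measurability in the data.\<close>

lemma inner_k_commute: "inner_k d u v = inner_k d v u"
  by (simp add: inner_k_def mult.commute)

lemma inner_k_self: "inner_k d u u = sqnorm d u"
  by (simp add: inner_k_def sqnorm_def power2_eq_square)

lemma inner_k_add_right: "inner_k d u (\<lambda>i. v i + w i) = inner_k d u v + inner_k d u w"
  by (simp add: inner_k_def ring_distribs sum.distrib)

lemma inner_k_diff_right: "inner_k d u (\<lambda>i. v i - w i) = inner_k d u v - inner_k d u w"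
  by (simp add: inner_k_def ring_distribs sum_subtractf)

lemma inner_k_scale_right: "inner_k d u (\<lambda>i. c * v i) = c * inner_k d u v"
  by (simp add: inner_k_def sum_distrib_left mult.left_commute)

lemma inner_k_add_left: "inner_k d (\<lambda>i. v i + w i) u = inner_k d v u + inner_k d w u"
  by (simp add: inner_k_def ring_distribs sum.distrib)

lemma inner_k_diff_left: "inner_k d (\<lambda>i. v i - w i) u = inner_k d v u - inner_k d w u"
  by (simp add: inner_k_def ring_distribs sum_subtractf)

lemma inner_k_scale_left: "inner_k d (\<lambda>i. c * v i) u = c * inner_k d v u"
  by (simp add: inner_k_def sum_distrib_left mult.assoc)

lemmas inner_k_linear = inner_k_add_right inner_k_diff_right inner_k_scale_right
  inner_k_add_left inner_k_diff_left inner_k_scale_left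

lemma inner_k_zero [simp]: "inner_k d (\<lambda>_. 0) v = 0" "inner_k d u (\<lambda>_. 0) = 0"
  by (simp_all add: inner_k_def)

lemma inner_k_cong:
  "(\<And>i. i < d \<Longrightarrow> u i = u' i) \<Longrightarrow> (\<And>i. i < d \<Longrightarrow> v i = v' i) \<Longrightarrow> inner_k d u v = inner_k d u' v'"
  by (simp add: inner_k_def)

lemma sqnorm_nonneg [simp]: "0 \<le> sqnorm d v"
  by (simp add: sqnorm_def sum_nonneg)

lemma sqnorm_eq_0_iff: "sqnorm d v = 0 \<longleftrightarrow> (\<forall>i<d. v i = 0)"
  by (auto simp: sqnorm_def sum_nonneg_eq_0_iff)

lemma sqnorm_scale: "sqnorm d (\<lambda>i. c * v i) = c\<^sup>2 * sqnorm d v"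
  by (simp add: sqnorm_def sum_distrib_left power_mult_distrib)

lemma sqnorm_add: "sqnorm d (\<lambda>i. u i + v i) = sqnorm d u + 2 * inner_k d u v + sqnorm d v"
  by (simp add: sqnorm_def inner_k_def power2_sum sum.distrib sum_distrib_left mult.assoc)

lemma sqnorm_diff: "sqnorm d (\<lambda>i. u i - v i) = sqnorm d u - 2 * inner_k d u v + sqnorm d v"
  by (simp add: sqnorm_def inner_k_def power2_diff sum.distrib sum_subtractf sum_distrib_left mult.assoc)

lemma sqnorm_add_le: "sqnorm d (\<lambda>i. u i + v i) \<le> 2 * sqnorm d u + 2 * sqnorm d v"
  using sqnorm_nonneg[of d "\<lambda>i. u i - v i"] unfolding sqnorm_add sqnorm_diff by linarith

lemma Cauchy_Schwarz_inner_k: "(inner_k d u v)\<^sup>2 \<le> sqnorm d u * sqnorm d v"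
  unfolding inner_k_def sqnorm_def by (rule Cauchy_Schwarz_ineq_sum)

lemma abs_le_sqnorm: "i < d \<Longrightarrow> (v i)\<^sup>2 \<le> sqnorm d v"
  unfolding sqnorm_def by (rule member_le_sum) auto

definition unitv :: "nat \<Rightarrow> nat \<Rightarrow> real" where
  "unitv a = (\<lambda>i. if i = a then 1 else 0)"

definition idm :: "nat \<Rightarrow> nat \<Rightarrow> nat \<Rightarrow> real" where
  "idm d = (\<lambda>i j. if i = j \<and> i < d then 1 else 0)"

lemma inner_k_unitv: "a < d \<Longrightarrow> inner_k d (unitv a) v = v a" "a < d \<Longrightarrow> inner_k d v (unitv a) = v a"
  by (simp_all add: inner_k_def unitv_def if_distrib if_distribR cong: if_cong)

lemma sqnorm_unitv: "a < d \<Longrightarrow> sqnorm d (unitv a) = 1"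
  by (simp add: sqnorm_def unitv_def if_distrib if_distribR cong: if_cong)

lemma mvec_unitv: "a < k \<Longrightarrow> mvec k A (unitv a) i = A i a"
  by (simp add: mvec_def unitv_def if_distrib if_distribR cong: if_cong)

lemma mvec_cong: "(\<And>j. j < k \<Longrightarrow> u j = v j) \<Longrightarrow> mvec k A u = mvec k A v"
  by (simp add: mvec_def)

lemma mvec_mat_cong: "(\<And>j. j < k \<Longrightarrow> A i j = B i j) \<Longrightarrow> mvec k A u i = mvec k B u i"
  by (simp add: mvec_def)

lemma mvec_add: "mvec k A (\<lambda>i. u i + v i) = (\<lambda>i. mvec k A u i + mvec k A v i)"
  by (simp add: mvec_def ring_distribs sum.distrib)

lemma mvec_diff: "mvec k A (\<lambda>i. u i - v i) = (\<lambda>i. mvec k A u i - mvec k A v i)"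
  by (simp add: mvec_def ring_distribs sum_subtractf)

lemma mvec_scale: "mvec k A (\<lambda>i. c * u i) = (\<lambda>i. c * mvec k A u i)"
  by (simp add: mvec_def sum_distrib_left mult.left_commute)

lemma mvec_zero [simp]: "mvec k A (\<lambda>i. 0) = (\<lambda>i. 0)"
  by (simp add: mvec_def)

lemma mvec_sum: "finite I \<Longrightarrow> mvec k A (\<lambda>i. \<Sum>l\<in>I. u l i) = (\<lambda>i. \<Sum>l\<in>I. mvec k A (u l) i)"
  by (induction I rule: finite_induct) (simp_all add: mvec_add)

lemmas mvec_linear = mvec_add mvec_diff mvec_scale

lemma mvec_mmul: "mvec k (mmul l A B) v = mvec l A (mvec k B v)"
  by (rule ext) (simp add: mvec_def mmul_def sum_distrib_left sum_distrib_right mult.assoc, rule sum.swap)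

lemma mmul_assoc: "mmul k (mmul l A B) C = mmul l A (mmul k B C)"
  by (intro ext) (simp add: mmul_def sum_distrib_left sum_distrib_right mult.assoc, rule sum.swap)

lemma idm_mvec: "mvec d (idm d) v = (\<lambda>i. if i < d then v i else 0)"
  by (rule ext) (simp add: mvec_def idm_def if_distrib if_distribR cong: if_cong)

lemma idm_mmul: "is_sq d A \<Longrightarrow> mmul d (idm d) A = A"
proof (intro ext)
  fix i j assume *: "is_sq d A"
  have "mmul d (idm d) A i j = (\<Sum>l<d. if l = i then A l j else 0)"
    unfolding mmul_def idm_def by (rule sum.cong) auto
  then show "mmul d (idm d) A i j = A i j"
    using * by (auto simp: is_sq_def)
qed

lemma mmul_idm: "is_sq d A \<Longrightarrow> mmul d A (idm d) = A"
proof (intro ext)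
  fix i j assume *: "is_sq d A"
  have "mmul d A (idm d) i j = (\<Sum>l<d. if l = j then A i l else 0)"
    unfolding mmul_def idm_def by (rule sum.cong) auto
  then show "mmul d A (idm d) i j = A i j"
    using * by (auto simp: is_sq_def)
qed

lemma is_sq_mmul: "is_sq d A \<Longrightarrow> is_sq d B \<Longrightarrow> is_sq d (mmul d A B)"
  by (auto simp: is_sq_def mmul_def)

lemma is_sq_idm: "is_sq d (idm d)"
  by (auto simp: is_sq_def idm_def)

lemma is_sq_mvec: "is_sq d A \<Longrightarrow> i \<ge> d \<Longrightarrow> mvec d A v i = 0"
  by (simp add: is_sq_def mvec_def)

lemma inner_k_mvec_sym:
  assumes "sym_mat d A"
  shows "inner_k d u (mvec d A v) = inner_k d (mvec d A u) v"
proof -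
  have "inner_k d u (mvec d A v) = (\<Sum>i<d. \<Sum>j<d. u i * A i j * v j)"
    by (simp add: inner_k_def mvec_def sum_distrib_left mult.assoc)
  also have "\<dots> = (\<Sum>j<d. \<Sum>i<d. u i * A i j * v j)"
    by (rule sum.swap)
  also have "\<dots> = (\<Sum>j<d. \<Sum>i<d. A j i * u i * v j)"
    using assms by (intro sum.cong refl) (simp add: sym_mat_def mult.commute)
  also have "\<dots> = inner_k d (mvec d A u) v"
    by (simp add: inner_k_def mvec_def sum_distrib_right)
  finally show ?thesis .
qed

lemma psd_sym: "psd d A \<Longrightarrow> sym_mat d A"
  by (simp add: psd_def)

lemma psd_nonneg: "psd d A \<Longrightarrow> 0 \<le> inner_k d x (mvec d A x)"
  by (simp add: psd_def qform_def)

text \<open>The degenerate case c = 0 has to be included because the forms in question may be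
  singular.\<close>

lemma nonneg_quadratic_discriminant:
  fixes a b c :: real
  assumes "\<And>t. 0 \<le> a + 2 * t * b + t\<^sup>2 * c"
  shows "b\<^sup>2 \<le> a * c"
proof (cases "c = 0")
  case True
  have "b = 0"
  proof (rule ccontr)
    assume "b \<noteq> 0"
    with assms[of "-(a + 1) / (2 * b)"] True show False by (simp add: field_simps)
  qed
  then show ?thesis using True by simp
next
  case False
  have "c > 0"
  proof (rule ccontr)
    assume "\<not> c > 0"
    with False have "c < 0" by simp
    \<comment> \<open>For c < 0 this t is large enough that t^2 c outweighs a + 2 t b, so the
      polynomial becomes negative.\<close>
    define t where "t = (\<bar>a\<bar> + 2 * \<bar>b\<bar> + 1) / - c + 1"
    have t: "t \<ge> 1" "t * (- c) \<ge> \<bar>a\<bar> + 2 * \<bar>b\<bar> + 1"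
      using \<open>c < 0\<close> by (auto simp: t_def field_simps)
    have "t\<^sup>2 * c = - (t * (t * (- c)))" by (simp add: power2_eq_square)
    also have "\<dots> \<le> - (t * (\<bar>a\<bar> + 2 * \<bar>b\<bar> + 1))"
      using t by (intro le_imp_neg_le mult_left_mono) auto
    finally have "a + 2 * t * b + t\<^sup>2 * c \<le> a + 2 * t * b - t * \<bar>a\<bar> - 2 * t * \<bar>b\<bar> - t"
      by (simp add: algebra_simps)
    moreover have "t * \<bar>a\<bar> \<ge> a" using t(1) by (smt (verit) mult_right_mono abs_ge_self abs_ge_zero mult_cancel_right1)
    moreover have "t * b \<le> t * \<bar>b\<bar>" using t(1) by (intro mult_left_mono) auto
    ultimately show False using assms[of t] t(1) by linarith
  qed
  with assms[of "- b / c"] show ?thesis by (simp add: field_simps power2_eq_square)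
qed

lemma psd_Cauchy_Schwarz:
  assumes "psd d A"
  shows "(inner_k d u (mvec d A v))\<^sup>2 \<le> inner_k d u (mvec d A u) * inner_k d v (mvec d A v)"
proof (rule nonneg_quadratic_discriminant)
  fix t
  have "0 \<le> inner_k d (\<lambda>i. u i + t * v i) (mvec d A (\<lambda>i. u i + t * v i))"
    using assms by (rule psd_nonneg)
  also have "\<dots> = inner_k d u (mvec d A u) + t * inner_k d u (mvec d A v)
      + t * inner_k d v (mvec d A u) + t\<^sup>2 * inner_k d v (mvec d A v)"
    by (simp add: mvec_linear inner_k_linear algebra_simps power2_eq_square)
  also have "inner_k d v (mvec d A u) = inner_k d u (mvec d A v)"
    by (metis assms inner_k_commute inner_k_mvec_sym psd_sym)
  finally show "0 \<le> inner_k d u (mvec d A u) + 2 * t * inner_k d u (mvec d A v) + t\<^sup>2 * inner_k d v (mvec d A v)"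
    by simp
qed

text \<open>Cauchy-Schwarz for the form of A against the unit vector i bounds the square of entry i
  of A v by A i i times the form at v.\<close>

lemma psd_kernel:
  assumes "psd d A" "inner_k d v (mvec d A v) = 0" "i < d"
  shows "mvec d A v i = 0"
  using psd_Cauchy_Schwarz[OF assms(1), of "unitv i" v] assms by (simp add: inner_k_unitv)

lemma psd_entry: "psd d A \<Longrightarrow> i < d \<Longrightarrow> j < d \<Longrightarrow> (A i j)\<^sup>2 \<le> A i i * A j j"
  using psd_Cauchy_Schwarz[of d A "unitv i" "unitv j"] by (simp add: inner_k_unitv mvec_unitv)

lemma psd_diag: "psd d A \<Longrightarrow> i < d \<Longrightarrow> 0 \<le> A i i"
  using psd_nonneg[of d A "unitv i"] by (simp add: inner_k_unitv mvec_unitv)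

section \<open>The squared Frobenius norm\<close>

definition fro :: "nat \<Rightarrow> nat \<Rightarrow> (nat \<Rightarrow> nat \<Rightarrow> real) \<Rightarrow> real" where
  "fro m k A = (\<Sum>i<m. \<Sum>j<k. (A i j)\<^sup>2)"

lemma fro_nonneg [simp]: "0 \<le> fro m k A"
  by (simp add: fro_def sum_nonneg)

lemma fro_columns: "fro m k A = (\<Sum>a<k. sqnorm m (mvec k A (unitv a)))"
  unfolding fro_def sqnorm_def by (subst sum.swap) (simp add: mvec_unitv)

lemma fro_cong: "(\<And>i j. i < m \<Longrightarrow> j < k \<Longrightarrow> A i j = B i j) \<Longrightarrow> fro m k A = fro m k B"
  by (simp add: fro_def)

lemma fro_transpose: "fro m k A = fro k m (\<lambda>i j. A j i)"
  unfolding fro_def by (rule sum.swap)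

text \<open>Turns the denominator of \<open>eff_rank\<close> into a Frobenius norm.\<close>

lemma trace_mmul_sym: "sym_mat d A \<Longrightarrow> trace d (mmul d A A) = fro d d A"
  unfolding trace_def mmul_def fro_def sym_mat_def power2_eq_square
  by (intro sum.cong refl) auto

lemma sqnorm_mvec_le_fro: "sqnorm m (mvec k A v) \<le> fro m k A * sqnorm k v"
proof -
  have "sqnorm m (mvec k A v) = (\<Sum>i<m. (inner_k k (A i) v)\<^sup>2)"
    by (simp add: sqnorm_def mvec_def inner_k_def)
  also have "\<dots> \<le> (\<Sum>i<m. sqnorm k (A i) * sqnorm k v)"
    by (intro sum_mono Cauchy_Schwarz_inner_k)
  also have "\<dots> = fro m k A * sqnorm k v"
    by (simp add: fro_def sqnorm_def sum_distrib_right)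
  finally show ?thesis .
qed

section \<open>The positive semidefinite square root\<close>

primrec mpow :: "nat \<Rightarrow> (nat \<Rightarrow> nat \<Rightarrow> real) \<Rightarrow> nat \<Rightarrow> nat \<Rightarrow> nat \<Rightarrow> real" where
  "mpow d B 0 = idm d"
| "mpow d B (Suc j) = mmul d B (mpow d B j)"

lemma is_sq_mpow: "is_sq d B \<Longrightarrow> is_sq d (mpow d B j)"
  by (induction j) (auto intro: is_sq_mmul is_sq_idm)

lemma mpow_add: "is_sq d B \<Longrightarrow> mpow d B (i + j) = mmul d (mpow d B i) (mpow d B j)"
  by (induction i) (simp_all add: mmul_assoc idm_mmul is_sq_mpow)

lemma sym_mat_iff_inner:
  "sym_mat d A \<longleftrightarrow> (\<forall>u v. inner_k d u (mvec d A v) = inner_k d (mvec d A u) v)"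
proof
  assume *: "\<forall>u v. inner_k d u (mvec d A v) = inner_k d (mvec d A u) v"
  show "sym_mat d A"
    unfolding sym_mat_def
  proof (intro allI impI)
    fix i j assume "i < d" "j < d"
    then show "A i j = A j i"
      using *[rule_format, of "unitv i" "unitv j"] by (simp add: inner_k_unitv mvec_unitv)
  qed
qed (auto simp: inner_k_mvec_sym)

lemma mvec_mpow_Suc: "mvec d (mpow d B (Suc j)) v = mvec d B (mvec d (mpow d B j) v)"
  by (simp add: mvec_mmul)

lemma mvec_mpow_Suc_right:
  assumes "is_sq d B" shows "mvec d (mpow d B (Suc j)) v = mvec d (mpow d B j) (mvec d B v)"
proof -
  have "mpow d B (Suc j) = mmul d (mpow d B j) (mpow d B 1)"
    using mpow_add[OF assms, of j 1] by simp
  then show ?thesis using assms by (simp add: mvec_mmul mmul_idm)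
qed

lemma sym_mat_mpow:
  assumes "is_sq d B" "sym_mat d B" shows "sym_mat d (mpow d B j)"
proof (induction j)
  case 0 then show ?case by (simp add: sym_mat_def idm_def)
next
  case (Suc j)
  show ?case unfolding sym_mat_iff_inner
  proof (intro allI)
    fix u v
    have "inner_k d u (mvec d (mpow d B (Suc j)) v) = inner_k d (mvec d (mpow d B j) (mvec d B u)) v"
      unfolding mvec_mpow_Suc using Suc assms(2) by (simp add: inner_k_mvec_sym)
    then show "inner_k d u (mvec d (mpow d B (Suc j)) v) = inner_k d (mvec d (mpow d B (Suc j)) u) v"
      by (simp only: mvec_mpow_Suc_right[OF assms(1)])
  qed
qed

text \<open>Cauchy-Schwarz for the form of B at the vectors B x and x gives |B x|^4 \<le> |B x|^2
  |x|^2.\<close>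

lemma psd_contraction:
  assumes B: "psd d B" and le: "\<And>x. inner_k d x (mvec d B x) \<le> sqnorm d x"
  shows "sqnorm d (mvec d B x) \<le> sqnorm d x"
proof (cases "sqnorm d (mvec d B x) = 0")
  case False
  have "(sqnorm d (mvec d B x))\<^sup>2 = (inner_k d (mvec d B x) (mvec d B x))\<^sup>2"
    by (simp add: inner_k_self)
  also have "\<dots> \<le> inner_k d (mvec d B x) (mvec d B (mvec d B x)) * inner_k d x (mvec d B x)"
    by (rule psd_Cauchy_Schwarz[OF B])
  also have "\<dots> \<le> sqnorm d (mvec d B x) * sqnorm d x"
    by (intro mult_mono le psd_nonneg[OF B]) auto
  finally show ?thesis
    using False by (simp add: power2_eq_square mult_le_cancel_left order.strict_iff_order)
qed simp

text \<open>An even power is the square of a symmetric matrix, and an odd power is B placed between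
  two copies of one; both have a nonnegative form. The upper bounds iterate the contraction.\<close>

lemma mpow_bounds:
  assumes sq: "is_sq d B" and B: "psd d B" and le: "\<And>x. inner_k d x (mvec d B x) \<le> sqnorm d x"
  shows "0 \<le> inner_k d x (mvec d (mpow d B j) x)"
    and "inner_k d x (mvec d (mpow d B j) x) \<le> sqnorm d x"
    and "sqnorm d (mvec d (mpow d B j) x) \<le> sqnorm d x"
proof -
  have c: "sqnorm d (mvec d (mpow d B j) x) \<le> sqnorm d x" for j
  proof (induction j)
    case 0 show ?case by (simp add: idm_mvec sqnorm_def)
  next
    case (Suc j)
    then show ?case unfolding mvec_mpow_Suc
      using psd_contraction[OF B le] order_trans by blast
  qed
  show "sqnorm d (mvec d (mpow d B j) x) \<le> sqnorm d x" by (rule c)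
  have sym: "sym_mat d (mpow d B i)" for i using sq B by (intro sym_mat_mpow psd_sym)
  show "0 \<le> inner_k d x (mvec d (mpow d B j) x)"
  proof (cases "even j")
    case True
    then obtain i where "j = i + i" by (metis evenE mult_2)
    then show ?thesis
      by (simp add: mpow_add[OF sq] mvec_mmul inner_k_mvec_sym[OF sym] inner_k_self)
  next
    case False
    then obtain i where "j = i + Suc i" by (metis oddE add_Suc_right mult_2 Suc_eq_plus1)
    then show ?thesis
      using psd_nonneg[OF B, of "mvec d (mpow d B i) x"]
      by (simp only: mpow_add[OF sq] mvec_mmul mvec_mpow_Suc inner_k_mvec_sym[OF sym])
  qed
  have "(inner_k d x (mvec d (mpow d B j) x))\<^sup>2 \<le> sqnorm d x * sqnorm d (mvec d (mpow d B j) x)"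
    by (rule Cauchy_Schwarz_inner_k)
  also have "\<dots> \<le> (sqnorm d x)\<^sup>2" using c[of j] by (simp add: power2_eq_square mult_left_mono)
  finally show "inner_k d x (mvec d (mpow d B j) x) \<le> sqnorm d x"
    by (rule power2_le_imp_le) simp
qed

text \<open>A bound uniform in j lets a series in the powers converge absolutely, entry by entry, as
  soon as its coefficients are summable.\<close>

lemma mpow_entry_le:
  assumes sq: "is_sq d B" and B: "psd d B" and le: "\<And>x. inner_k d x (mvec d B x) \<le> sqnorm d x"
  shows "\<bar>mpow d B j a b\<bar> \<le> 1"
proof (cases "a < d \<and> b < d")
  case True
  have "(mpow d B j a b)\<^sup>2 = (mvec d (mpow d B j) (unitv b) a)\<^sup>2" using True by (simp add: mvec_unitv)
  also have "\<dots> \<le> sqnorm d (mvec d (mpow d B j) (unitv b))" using True by (intro abs_le_sqnorm) auto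
  also have "\<dots> \<le> sqnorm d (unitv b)" by (rule mpow_bounds[OF assms])
  also have "\<dots> = 1" using True by (simp add: sqnorm_unitv)
  finally show ?thesis by (simp add: abs_square_le_1)
next
  case False
  then show ?thesis using is_sq_mpow[OF sq, of j] by (auto simp: is_sq_def)
qed

section \<open>The power series of sqrt (1 - x)\<close>

definition sqrt_coeff :: "nat \<Rightarrow> real" where
  "sqrt_coeff j = (-1) ^ j * ((1/2) gchoose j)"

lemma sqrt_coeff_0 [simp]: "sqrt_coeff 0 = 1"
  by (simp add: sqrt_coeff_def)

text \<open>The first coefficient is -1/2, and from then on consecutive coefficients have the
  positive ratio (i + 1/2) / (i + 2).\<close>

lemma sqrt_coeff_nonpos:
  assumes "0 < j" shows "sqrt_coeff j \<le> 0"
proof -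
  have rec: "sqrt_coeff (Suc (Suc i)) = sqrt_coeff (Suc i) * ((real i + 1/2) / (real i + 2))" for i
  proof -
    have "(real (Suc (Suc i))) * ((1/2::real) gchoose (Suc (Suc i))) = (1/2 - real (Suc i)) * ((1/2) gchoose (Suc i))"
      using gbinomial_absorb_comp[of "1/2::real" "Suc i"] gbinomial_absorption[of "Suc i" "1/2::real"]
      by (simp add: gbinomial_absorption gbinomial_absorb_comp)
    then have "((1/2::real) gchoose (Suc (Suc i))) = (1/2 - real (Suc i)) * ((1/2) gchoose (Suc i)) / real (Suc (Suc i))"
      by (simp add: field_simps del: of_nat_Suc)
    then have eq: "((1/2::real) gchoose (Suc (Suc i))) = - ((real i + 1/2) / (real i + 2)) * ((1/2) gchoose (Suc i))"
      by (simp add: field_simps)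
    show ?thesis unfolding sqrt_coeff_def eq by simp
  qed
  have "sqrt_coeff (Suc i) \<le> 0" for i
  proof (induction i)
    case 0 show ?case by (simp add: sqrt_coeff_def)
  next
    case (Suc i) then show ?case unfolding rec by (intro mult_nonpos_nonneg) auto
  qed
  then show ?thesis using assms gr0_implies_Suc by blast
qed

text \<open>An alternating partial sum of binomial coefficients collapses to a single one, here (N -
  1/2 choose N), whose factors are all nonnegative. Both summability and positivity of the matrix
  root depend on this sign.\<close>

lemma sqrt_coeff_partial_sums: "0 \<le> (\<Sum>j\<le>N. sqrt_coeff j)"
proof -
  have "(\<Sum>j\<le>N. sqrt_coeff j) = (\<Sum>j\<le>N. ((1/2) gchoose j) * (-1)^j)"
    by (simp add: sqrt_coeff_def mult.commute)
  also have "\<dots> = (-1)^N * ((1/2 - 1) gchoose N)" by (rule gbinomial_sum_lower_neg)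
  also have "\<dots> = (1/2 + real N - 1 gchoose N)"
  proof -
    have "(1/2 - 1 gchoose N) = (-1)^N * (1/2 + real N - 1 gchoose N)"
      using gbinomial_minus[of "1/2::real" N] by simp
    moreover have "(-1)^N * ((-1)^N * x) = x" for x :: real
      by (cases "even N") auto
    ultimately show ?thesis by metis
  qed
  also have "\<dots> \<ge> 0"
    by (simp add: gbinomial_prod_rev) (intro divide_nonneg_nonneg prod_nonneg; simp add: of_nat_diff)
  finally show ?thesis .
qed

text \<open>Only the coefficient at 0 is positive, so the sum of the absolute values is 2 minus a
  nonnegative partial sum.\<close>

lemma sqrt_coeff_summable: "summable (\<lambda>j. \<bar>sqrt_coeff j\<bar>)"
proof (rule summableI_nonneg_bounded)
  fix N
  have "(\<Sum>j<N. \<bar>sqrt_coeff j\<bar>) \<le> (\<Sum>j\<le>N. \<bar>sqrt_coeff j\<bar>)" by (intro sum_mono2) auto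
  also have "\<dots> = (\<Sum>j\<le>N. 2 * (if j = 0 then 1 else 0) - sqrt_coeff j)"
    by (intro sum.cong refl) (use sqrt_coeff_nonpos in \<open>auto simp: abs_of_nonpos\<close>)
  also have "\<dots> = 2 - (\<Sum>j\<le>N. sqrt_coeff j)" by (simp add: sum_subtractf sum.delta flip: sum_distrib_left)
  also have "\<dots> \<le> 2" using sqrt_coeff_partial_sums[of N] by simp
  finally show "(\<Sum>j<N. \<bar>sqrt_coeff j\<bar>) \<le> 2" .
qed auto

text \<open>Vandermonde's identity: the Cauchy square of the series is 1 - x.\<close>

lemma sqrt_coeff_conv: "(\<Sum>i\<le>m. sqrt_coeff i * sqrt_coeff (m - i)) = (if m = 0 then 1 else if m = 1 then -1 else 0)"
proof -
  have "(\<Sum>i\<le>m. sqrt_coeff i * sqrt_coeff (m - i)) = (\<Sum>i\<le>m. (-1)^m * (((1/2) gchoose i) * ((1/2) gchoose (m - i))))"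
    by (intro sum.cong refl) (auto simp: sqrt_coeff_def mult_ac simp flip: power_add)
  also have "\<dots> = (-1)^m * (\<Sum>i\<in>{0..m}. ((1/2) gchoose i) * ((1/2) gchoose (m - i)))"
    by (simp add: sum_distrib_left atMost_atLeast0)
  also have "\<dots> = (-1)^m * ((1/2 + 1/2) gchoose m)" by (simp add: gbinomial_Vandermonde)
  also have "\<dots> = (-1)^m * real (1 choose m)" by (simp add: binomial_gbinomial)
  also have "\<dots> = (if m = 0 then 1 else if m = 1 then -1 else 0)"
    by (cases m) (auto simp: binomial_eq_0)
  finally show ?thesis .
qed

definition series_root :: "nat \<Rightarrow> (nat \<Rightarrow> nat \<Rightarrow> real) \<Rightarrow> nat \<Rightarrow> nat \<Rightarrow> real" where
  "series_root d B = (\<lambda>a b. \<Sum>j. sqrt_coeff j * mpow d B j a b)"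

context
  fixes d :: nat and B :: "nat \<Rightarrow> nat \<Rightarrow> real"
  assumes sq: "is_sq d B" and B: "psd d B" and le: "\<And>x. inner_k d x (mvec d B x) \<le> sqnorm d x"
begin

lemma series_root_abs_summable: "summable (\<lambda>j. \<bar>sqrt_coeff j * mpow d B j a b\<bar>)"
  by (rule summable_comparison_test'[OF sqrt_coeff_summable, of 0])
    (use mpow_entry_le[OF sq B le] in \<open>auto simp: abs_mult intro!: mult_left_le\<close>)

lemma series_root_sums: "(\<lambda>j. sqrt_coeff j * mpow d B j a b) sums series_root d B a b"
  unfolding series_root_def
  by (rule summable_sums[OF summable_rabs_cancel[OF series_root_abs_summable]])

lemma is_sq_series_root: "is_sq d (series_root d B)"
  using is_sq_mpow[OF sq] by (simp add: is_sq_def series_root_def)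

lemma sym_series_root: "sym_mat d (series_root d B)"
  using sym_mat_mpow[OF sq psd_sym[OF B]] by (simp add: sym_mat_def series_root_def)

lemma qform_series_root_sums:
  "(\<lambda>j. sqrt_coeff j * inner_k d x (mvec d (mpow d B j) x)) sums inner_k d x (mvec d (series_root d B) x)"
proof -
  have *: "inner_k d x (mvec d M x) = (\<Sum>a<d. \<Sum>b<d. x a * x b * M a b)" for M
    by (simp add: inner_k_def mvec_def sum_distrib_left mult_ac)
  have "(\<lambda>j. \<Sum>a<d. \<Sum>b<d. x a * x b * (sqrt_coeff j * mpow d B j a b)) sums inner_k d x (mvec d (series_root d B) x)"
    unfolding * by (intro sums_sum sums_mult series_root_sums)
  then show ?thesis by (simp add: * sum_distrib_left mult_ac)
qed

text \<open>For j > 0 the coefficient is nonpositive and the form of the j-th power is at most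
  |x|^2. Each partial sum of the form is therefore at least |x|^2 times a partial sum of the
  coefficients, hence nonnegative.\<close>

lemma psd_series_root: "psd d (series_root d B)"
  unfolding psd_def qform_def
proof (intro conjI allI sym_series_root)
  fix x
  let ?s = "\<lambda>j. sqrt_coeff j * inner_k d x (mvec d (mpow d B j) x)"
  have "0 \<le> (\<Sum>j\<le>N. ?s j)" for N
  proof -
    have "0 \<le> (\<Sum>j\<le>N. sqrt_coeff j) * sqnorm d x" by (simp add: sqrt_coeff_partial_sums)
    also have "\<dots> = (\<Sum>j\<le>N. sqrt_coeff j * sqnorm d x)" by (simp add: sum_distrib_right)
    also have "\<dots> \<le> (\<Sum>j\<le>N. ?s j)"
    proof (intro sum_mono)
      fix j
      show "sqrt_coeff j * sqnorm d x \<le> ?s j"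
      proof (cases "j = 0")
        case True
        have "inner_k d x (\<lambda>i. if i < d then x i else 0) = sqnorm d x"
          by (simp add: inner_k_def sqnorm_def power2_eq_square)
        then show ?thesis using True by (simp add: idm_mvec)
      next
        case False
        then show ?thesis
          using sqrt_coeff_nonpos[of j] mpow_bounds(2)[OF sq B le, of x j]
          by (simp add: mult_left_mono_neg)
      qed
    qed
    finally show ?thesis .
  qed
  moreover have "(\<lambda>N. \<Sum>j\<le>N. ?s j) \<longlonglongrightarrow> inner_k d x (mvec d (series_root d B) x)"
    using qform_series_root_sums[of x] by (simp add: sums_def_le)
  ultimately show "0 \<le> inner_k d x (mvec d (series_root d B) x)"
    by (meson LIMSEQ_le_const)
qed

text \<open>Cauchy products of absolutely convergent entry series reduce the square to the
  convolution of the coefficients, of which only the terms at 0 and 1 survive.\<close>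

lemma series_root_square:
  assumes "a < d" "b < d"
  shows "mmul d (series_root d B) (series_root d B) a b = idm d a b - B a b"
proof -
  let ?f = "\<lambda>m. \<Sum>l<d. \<Sum>i\<le>m. (sqrt_coeff i * mpow d B i a l) * (sqrt_coeff (m - i) * mpow d B (m - i) l b)"
  have 1: "?f sums (\<Sum>l<d. series_root d B a l * series_root d B l b)"
    unfolding series_root_def
    by (intro sums_sum Cauchy_product_sums) (use series_root_abs_summable in auto)
  have 2: "?f m = (if m = 0 then 1 else if m = 1 then -1 else 0) * mpow d B m a b" for m
  proof -
    have "?f m = (\<Sum>i\<le>m. sqrt_coeff i * sqrt_coeff (m - i) * (\<Sum>l<d. mpow d B i a l * mpow d B (m - i) l b))"
      by (subst sum.swap) (simp add: sum_distrib_left mult_ac)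
    also have "\<dots> = (\<Sum>i\<le>m. sqrt_coeff i * sqrt_coeff (m - i) * mpow d B m a b)"
    proof (intro sum.cong refl)
      fix i assume "i \<in> {..m}"
      then have "mpow d B m = mmul d (mpow d B i) (mpow d B (m - i))"
        using mpow_add[OF sq, of i "m - i"] by simp
      then show "sqrt_coeff i * sqrt_coeff (m - i) * (\<Sum>l<d. mpow d B i a l * mpow d B (m - i) l b)
        = sqrt_coeff i * sqrt_coeff (m - i) * mpow d B m a b" by (simp add: mmul_def)
    qed
    finally show ?thesis unfolding sqrt_coeff_conv[symmetric] sum_distrib_right .
  qed
  let ?e = "\<lambda>m. (if m = 0 then 1 else if m = 1 then -1 else 0) * mpow d B m a b"
  have "?e sums mmul d (series_root d B) (series_root d B) a b"
    using 1 unfolding 2 mmul_def .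
  moreover have "?e sums (\<Sum>m\<in>{0,1}. ?e m)"
    by (rule sums_finite) auto
  moreover have "(\<Sum>m\<in>{0,1}. ?e m) = idm d a b - B a b"
    using sq by (simp add: mmul_idm)
  ultimately show ?thesis by (simp only: sums_unique2)
qed

end

section \<open>Existence and uniqueness of the positive semidefinite root\<close>

definition psd_root :: "nat \<Rightarrow> (nat \<Rightarrow> nat \<Rightarrow> real) \<Rightarrow> (nat \<Rightarrow> nat \<Rightarrow> real) \<Rightarrow> bool" where
  "psd_root d A S \<longleftrightarrow> is_sq d S \<and> psd d S \<and> (\<forall>i<d. \<forall>j<d. mmul d S S i j = A i j)"

lemma inner_k_mat_cong:
  assumes "\<And>i j. i < d \<Longrightarrow> j < d \<Longrightarrow> A i j = B i j"
  shows "inner_k d x (mvec d A y) = inner_k d x (mvec d B y)"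
  using assms by (intro inner_k_cong refl mvec_mat_cong) auto

text \<open>Scaling by a large c puts B = I - A / c between 0 and I, so the series at B is a root of
  A / c.\<close>

lemma psd_root_exists:
  assumes A: "psd d A" shows "\<exists>S. psd_root d A S"
proof -
  \<comment> \<open>The sum of the absolute entries dominates the quadratic form of A on unit
    vectors; adding 1 makes c positive even for A = 0.\<close>
  define c where "c = (\<Sum>i<d. \<Sum>j<d. \<bar>A i j\<bar>) + 1"
  have c: "c > 0" unfolding c_def by (intro add_nonneg_pos sum_nonneg) auto
  have Ale: "inner_k d x (mvec d A x) \<le> c * sqnorm d x" for x
  proof -
    have "inner_k d x (mvec d A x) = (\<Sum>i<d. \<Sum>j<d. A i j * (x i * x j))"
      by (simp add: inner_k_def mvec_def sum_distrib_left mult_ac)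
    also have "\<dots> \<le> (\<Sum>i<d. \<Sum>j<d. \<bar>A i j\<bar> * sqnorm d x)"
    proof (intro sum_mono)
      fix i j assume "i \<in> {..<d}" "j \<in> {..<d}"
      then have "\<bar>x i\<bar>\<^sup>2 \<le> sqnorm d x" "\<bar>x j\<bar>\<^sup>2 \<le> sqnorm d x" using abs_le_sqnorm by auto
      then have "\<bar>x i\<bar> * \<bar>x j\<bar> \<le> sqnorm d x"
        using sum_squares_bound[of "\<bar>x i\<bar>" "\<bar>x j\<bar>"] by simp
      then have "\<bar>A i j\<bar> * (\<bar>x i\<bar> * \<bar>x j\<bar>) \<le> \<bar>A i j\<bar> * sqnorm d x" by (intro mult_left_mono) auto
      moreover have "A i j * (x i * x j) \<le> \<bar>A i j\<bar> * (\<bar>x i\<bar> * \<bar>x j\<bar>)"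
        by (metis abs_ge_self abs_mult)
      ultimately show "A i j * (x i * x j) \<le> \<bar>A i j\<bar> * sqnorm d x" by linarith
    qed
    also have "\<dots> = (c - 1) * sqnorm d x" by (simp add: c_def sum_distrib_right)
    also have "\<dots> \<le> c * sqnorm d x" by (intro mult_right_mono) auto
    finally show ?thesis .
  qed
  \<comment> \<open>The cutoff is needed because A may take any values outside the index range,
    whereas the series requires \<open>is_sq\<close>.\<close>
  define B where "B = (\<lambda>i j. if i < d \<and> j < d then idm d i j - A i j / c else 0)"
  have sq: "is_sq d B" by (auto simp: is_sq_def B_def)
  have qB: "inner_k d x (mvec d B x) = sqnorm d x - inner_k d x (mvec d A x) / c" for x
  proof -
    have "inner_k d x (mvec d B x) = inner_k d x (mvec d (\<lambda>i j. idm d i j - A i j / c) x)"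
      by (rule inner_k_mat_cong) (auto simp: B_def)
    also have "mvec d (\<lambda>i j. idm d i j - A i j / c) x = (\<lambda>i. mvec d (idm d) x i - (1/c) * mvec d A x i)"
      by (rule ext) (simp add: mvec_def ring_distribs sum_subtractf sum_distrib_left)
    also have "inner_k d x \<dots> = inner_k d x (mvec d (idm d) x) - (1/c) * inner_k d x (mvec d A x)"
      by (simp only: inner_k_linear)
    also have "inner_k d x (mvec d (idm d) x) = sqnorm d x"
      by (simp add: idm_mvec inner_k_def sqnorm_def power2_eq_square)
    finally show ?thesis by simp
  qed
  have B: "psd d B"
    unfolding psd_def qform_def qB sym_mat_def
    using Ale c A by (auto simp: B_def idm_def psd_def sym_mat_def field_simps)
  have le: "inner_k d x (mvec d B x) \<le> sqnorm d x" for x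
    unfolding qB using psd_nonneg[OF A, of x] c by simp
  define S where "S = (\<lambda>i j. sqrt c * series_root d B i j)"
  have "mmul d S S i j = A i j" if "i < d" "j < d" for i j
  proof -
    have "mmul d S S i j = c * mmul d (series_root d B) (series_root d B) i j"
    proof -
      have "sqrt c * x * (sqrt c * y) = c * (x * y)" for x y :: real
        using c by (metis mult.assoc mult.left_commute real_sqrt_mult_self abs_of_pos)
      then show ?thesis unfolding S_def mmul_def sum_distrib_left by presburger
    qed
    also have "\<dots> = A i j" using series_root_square[OF sq B le that] that c by (simp add: B_def)
    finally show ?thesis .
  qed
  moreover have "is_sq d S" using is_sq_series_root[OF sq B le] by (simp add: S_def is_sq_def)
  moreover have "psd d S"
  proof -
    have "mvec d S x = (\<lambda>i. sqrt c * mvec d (series_root d B) x i)" for x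
      by (rule ext) (simp add: S_def mvec_def sum_distrib_left mult_ac)
    then show ?thesis
      using psd_series_root[OF sq B le] c
      by (simp add: psd_def qform_def inner_k_linear) (simp add: S_def sym_mat_def)
  qed
  ultimately show ?thesis unfolding psd_root_def by blast
qed

lemma psd_root_sqnorm:
  assumes "psd_root d A S" shows "sqnorm d (mvec d S x) = inner_k d x (mvec d A x)"
proof -
  have "sqnorm d (mvec d S x) = inner_k d x (mvec d (mmul d S S) x)"
    using assms by (simp add: psd_root_def mvec_mmul inner_k_mvec_sym psd_sym inner_k_self)
  also have "\<dots> = inner_k d x (mvec d A x)"
    using assms by (intro inner_k_mat_cong) (auto simp: psd_root_def)
  finally show ?thesis .
qed

text \<open>For two roots with difference \<open>D\<close>, \<open>(S + R) D = - D (S + R)\<close>, so the trace of \<open>D (S + R) D\<close>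
  vanishes; hence \<open>S D = R D = 0\<close> and \<open>D\<^sup>2 = 0\<close>.\<close>
lemma psd_root_unique:
  assumes S: "psd_root d A S" and R: "psd_root d A R"
  shows "S = R"
proof -
  define D where "D = (\<lambda>i j. S i j - R i j)"
  define P where "P = (\<lambda>i j. S i j + R i j)"
  have sym: "sym_mat d S" "sym_mat d R" using S R psd_sym by (auto simp: psd_root_def)
  have symD: "sym_mat d D" using sym by (simp add: sym_mat_def D_def)
  have mP: "mvec d P v = (\<lambda>i. mvec d S v i + mvec d R v i)" for v
    by (rule ext) (simp add: P_def mvec_def ring_distribs sum.distrib)
  have mD: "mvec d D v = (\<lambda>i. mvec d S v i - mvec d R v i)" for v
    by (rule ext) (simp add: D_def mvec_def ring_distribs sum_subtractf)
  have anti: "mmul d P D i j = - mmul d D P i j" if "i < d" "j < d" for i j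
  proof -
    have "mmul d P D i j + mmul d D P i j = 2 * (mmul d S S i j - mmul d R R i j)"
      by (simp add: mmul_def P_def D_def algebra_simps sum.distrib sum_subtractf sum_distrib_left)
    also have "\<dots> = 0" using S R that by (simp add: psd_root_def)
    finally show ?thesis by linarith
  qed
  have cyc: "trace d (mmul d X Y) = trace d (mmul d Y X)" for X Y
    unfolding trace_def mmul_def by (subst sum.swap) (simp add: mult.commute)
  have "trace d (mmul d D (mmul d P D)) = trace d (mmul d (mmul d P D) D)" by (rule cyc)
  also have "\<dots> = - trace d (mmul d (mmul d D P) D)"
  proof -
    have "mmul d (mmul d P D) D i i = - mmul d (mmul d D P) D i i" if "i < d" for i
      using anti[OF that] by (simp add: mmul_def[of d "mmul d P D"] mmul_def[of d "mmul d D P"] sum_negf)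
    then show ?thesis by (simp add: trace_def sum_negf)
  qed
  also have "mmul d (mmul d D P) D = mmul d D (mmul d P D)" by (rule mmul_assoc)
  finally have tr0: "trace d (mmul d D (mmul d P D)) = 0" by simp
  define q where "q = (\<lambda>a. inner_k d (mvec d D (unitv a)) (mvec d P (mvec d D (unitv a))))"
  have qa: "q a = inner_k d (mvec d D (unitv a)) (mvec d S (mvec d D (unitv a)))
      + inner_k d (mvec d D (unitv a)) (mvec d R (mvec d D (unitv a)))" for a
    by (simp add: q_def mP inner_k_linear)
  have "mmul d D (mmul d P D) a a = q a" if "a < d" for a
  proof -
    have "mmul d D (mmul d P D) a a = inner_k d (unitv a) (mvec d (mmul d D (mmul d P D)) (unitv a))"
      using that by (simp add: inner_k_unitv mvec_unitv)
    also have "\<dots> = q a"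
      by (simp add: q_def mvec_mmul inner_k_mvec_sym[OF symD])
    finally show ?thesis .
  qed
  then have "(\<Sum>a<d. q a) = 0" using tr0 by (simp add: trace_def)
  moreover have qS: "0 \<le> inner_k d v (mvec d S v)" "0 \<le> inner_k d v (mvec d R v)" for v
    using S R psd_nonneg by (auto simp: psd_root_def)
  ultimately have q0: "q a = 0" if "a < d" for a
    using that by (subst (asm) sum_nonneg_eq_0_iff) (auto simp: qa)
  have "D i a = 0" if "a < d" "i < d" for i a
  proof -
    let ?w = "mvec d D (unitv a)"
    have "mvec d S ?w i = 0" "mvec d R ?w i = 0" if "i < d" for i
      using q0[OF \<open>a < d\<close>] qS[of ?w] S R that
      by (auto simp: qa psd_root_def intro!: psd_kernel)
    then have "inner_k d (unitv a) (mvec d D ?w) = 0"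
      by (simp add: mD[of ?w] inner_k_def)
    then have "sqnorm d ?w = 0" by (simp add: inner_k_mvec_sym[OF symD] inner_k_self)
    then show ?thesis using that by (simp add: sqnorm_eq_0_iff mvec_unitv)
  qed
  then show ?thesis
    using S R by (intro ext) (metis D_def is_sq_def psd_root_def linorder_not_less right_minus_eq)
qed

lemma psd_sqrt_eqI: "psd_root d A S \<Longrightarrow> psd_sqrt d A = S"
  unfolding psd_sqrt_def psd_root_def[symmetric]
  by (rule the_equality) (auto dest: psd_root_unique)

section \<open>Projections and rank\<close>

definition is_proj :: "nat \<Rightarrow> (nat \<Rightarrow> nat \<Rightarrow> real) \<Rightarrow> bool" where
  "is_proj d Q \<longleftrightarrow> is_sq d Q \<and> sym_mat d Q \<and> (\<forall>v. mvec d Q (mvec d Q v) = mvec d Q v)"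

lemma is_proj_inner:
  assumes "is_proj d Q"
  shows "inner_k d (mvec d Q u) (mvec d Q v) = inner_k d u (mvec d Q v)"
    and "inner_k d u (mvec d Q v) = inner_k d (mvec d Q u) v"
  using assms by (auto simp: is_proj_def inner_k_mvec_sym)

lemma is_proj_sqnorm: "is_proj d Q \<Longrightarrow> sqnorm d (mvec d Q v) = inner_k d v (mvec d Q v)"
  unfolding inner_k_self[symmetric] by (rule is_proj_inner)

lemma is_proj_sqnorm_le: "is_proj d Q \<Longrightarrow> sqnorm d (mvec d Q v) \<le> sqnorm d v"
proof -
  assume Q: "is_proj d Q"
  have "(sqnorm d (mvec d Q v))\<^sup>2 \<le> sqnorm d v * sqnorm d (mvec d Q v)"
    using Cauchy_Schwarz_inner_k[of d v "mvec d Q v"] by (simp add: is_proj_sqnorm[OF Q])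
  then show ?thesis
    using sqnorm_nonneg[of d "mvec d Q v"] sqnorm_nonneg[of d v]
    by (metis mult.commute mult_right_le_imp_le order.strict_iff_order power2_eq_square)
qed

text \<open>\<open>offp d xs\<close> is the orthogonal projection onto the complement of the span of \<open>xs\<close>. A vector already
  in the span of its predecessors yields \<open>q = 0\<close>, and the division by zero is harmless.\<close>
primrec offp :: "nat \<Rightarrow> (nat \<Rightarrow> real) list \<Rightarrow> nat \<Rightarrow> nat \<Rightarrow> real" where
  "offp d [] = idm d"
| "offp d (x # xs) = (\<lambda>i j. offp d xs i j - mvec d (offp d xs) x i * mvec d (offp d xs) x j
      / inner_k d x (mvec d (offp d xs) x))"

lemma mvec_offp_Cons:
  "mvec d (offp d (x # xs)) v = (\<lambda>i. mvec d (offp d xs) v i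
     - (inner_k d (mvec d (offp d xs) x) v / inner_k d x (mvec d (offp d xs) x)) * mvec d (offp d xs) x i)"
proof
  fix i
  let ?q = "mvec d (offp d xs) x"
  have "mvec d (offp d (x # xs)) v i
      = mvec d (offp d xs) v i - (\<Sum>j<d. ?q i * ?q j / inner_k d x ?q * v j)"
    by (simp add: mvec_def[of d "\<lambda>i j. _ i j - _ i j"] left_diff_distrib sum_subtractf mvec_def[of d "offp d xs" v])
  also have "(\<Sum>j<d. ?q i * ?q j / inner_k d x ?q * v j) = (inner_k d ?q v / inner_k d x ?q) * ?q i"
    unfolding inner_k_def[of d ?q v] by (simp add: sum_divide_distrib sum_distrib_left sum_distrib_right mult_ac)
  finally show "mvec d (offp d (x # xs)) v i = mvec d (offp d xs) v i
     - (inner_k d ?q v / inner_k d x ?q) * ?q i" .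
qed

text \<open>The step subtracts the rank-one projection onto the residual q = Q x. As q lies in the
  range of Q and |q|^2 = <x, q>, the new map sends every vector to one orthogonal to q, so a second
  application changes nothing.\<close>

lemma offp_proj: "is_proj d (offp d xs)"
proof (induction xs)
  case Nil
  have "sym_mat d (idm d)" by (simp add: sym_mat_def idm_def)
  then show ?case by (auto simp: is_proj_def is_sq_idm idm_mvec)
next
  case (Cons x xs)
  let ?Q = "offp d xs" and ?Q' = "offp d (x # xs)"
  let ?q = "mvec d ?Q x"
  let ?D = "inner_k d x ?q"
  have sq: "is_sq d ?Q" and sym: "sym_mat d ?Q" and idem: "\<And>v. mvec d ?Q (mvec d ?Q v) = mvec d ?Q v"
    using Cons by (auto simp: is_proj_def)
  have "is_sq d ?Q'"
    unfolding is_sq_def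
  proof (intro allI impI)
    fix i j assume ij: "i \<ge> d \<or> j \<ge> d"
    then have "?q i = 0 \<or> ?q j = 0" using is_sq_mvec[OF sq] by auto
    moreover have "?Q i j = 0" using sq[unfolded is_sq_def] ij by blast
    ultimately show "?Q' i j = 0" by auto
  qed
  moreover have "sym_mat d ?Q'" using sym by (simp add: sym_mat_def mult.commute)
  moreover have "mvec d ?Q' (mvec d ?Q' v) = mvec d ?Q' v" for v
  proof -
    have qq: "inner_k d ?q ?q = ?D" using is_proj_inner[OF Cons] by simp
    have qQ: "inner_k d ?q (mvec d ?Q v) = inner_k d ?q v"
      using is_proj_inner[OF Cons] idem by metis
    let ?c = "inner_k d ?q v / ?D"
    have "inner_k d ?q (mvec d ?Q' v) = inner_k d ?q v - ?c * ?D"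
      unfolding mvec_offp_Cons by (simp only: inner_k_linear qq qQ)
    \<comment> \<open>When the denominator is 0 the quotient is 0 by convention; otherwise the
      numerator cancels.\<close>
    then have 0: "inner_k d ?q (mvec d ?Q' v) / ?D = 0" by (cases "?D = 0") auto
    have "mvec d ?Q' (mvec d ?Q' v) = mvec d ?Q (mvec d ?Q' v)"
      unfolding mvec_offp_Cons[of d x xs "mvec d ?Q' v"] 0 by simp
    also have "\<dots> = mvec d ?Q' v"
      unfolding mvec_offp_Cons by (simp only: mvec_linear idem)
    finally show ?thesis .
  qed
  ultimately show ?case by (simp add: is_proj_def)
qed

lemmas is_sq_offp = offp_proj[unfolded is_proj_def, THEN conjunct1]

lemma offp_kills: "x \<in> set xs \<Longrightarrow> mvec d (offp d xs) x = (\<lambda>_. 0)"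
proof (induction xs)
  case (Cons y xs)
  let ?q = "mvec d (offp d xs) y"
  show ?case
  proof (cases "x = y")
    case True
    show ?thesis
    proof (cases "inner_k d y ?q = 0")
      case True
      then have "sqnorm d ?q = 0" by (simp add: is_proj_sqnorm[OF offp_proj])
      then have "?q = (\<lambda>_. 0)"
        using is_sq_mvec[OF is_sq_offp] by (auto simp: sqnorm_eq_0_iff) (metis linorder_not_less)
      then show ?thesis unfolding \<open>x = y\<close> mvec_offp_Cons by simp
    next
      case False
      then show ?thesis unfolding \<open>x = y\<close> mvec_offp_Cons by (simp add: inner_k_commute[of d ?q])
    qed
  next
    case False
    with Cons have 0: "mvec d (offp d xs) x = (\<lambda>_. 0)" by simp
    then have "inner_k d ?q x = 0" using is_proj_inner(2)[OF offp_proj, of d y xs x] by simp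
    then show ?thesis unfolding mvec_offp_Cons by (simp add: 0)
  qed
qed simp

text \<open>The restriction to i < d is essential, since \<open>idm\<close> cuts vectors off at
  d.\<close>

lemma offp_fixes: "(\<And>x. x \<in> set xs \<Longrightarrow> inner_k d x v = 0) \<Longrightarrow> i < d \<Longrightarrow> mvec d (offp d xs) v i = v i"
proof (induction xs arbitrary: i)
  case Nil then show ?case by (simp add: idm_mvec)
next
  case (Cons y xs)
  have "inner_k d (mvec d (offp d xs) y) v = inner_k d y (mvec d (offp d xs) v)"
    using is_proj_inner(2)[OF offp_proj] by metis
  also have "\<dots> = inner_k d y v" using Cons by (intro inner_k_cong) auto
  finally show ?case unfolding mvec_offp_Cons using Cons by simp
qed

text \<open>Each added vector lowers the trace by |q|^2 / <x, q>, which is 1, or 0 for a vector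
  already in the span. The trace serves as the dimension of the range.\<close>

lemma trace_offp: "real d - real (length xs) \<le> trace d (offp d xs)"
proof (induction xs)
  case Nil then show ?case by (simp add: trace_def idm_def)
next
  case (Cons x xs)
  let ?q = "mvec d (offp d xs) x"
  have "trace d (offp d (x # xs)) = trace d (offp d xs) - sqnorm d ?q / inner_k d x ?q"
    by (simp add: trace_def sqnorm_def sum_subtractf power2_eq_square sum_divide_distrib)
  moreover have "sqnorm d ?q / inner_k d x ?q \<le> 1"
    by (simp add: is_proj_sqnorm[OF offp_proj] divide_le_eq_1)
  ultimately have "trace d (offp d xs) - 1 \<le> trace d (offp d (x # xs))" by linarith
  then show ?case using Cons unfolding list.size(4) by linarith
qed

section \<open>Complementary projections and column rank\<close>

definition comp_mat :: "nat \<Rightarrow> (nat \<Rightarrow> nat \<Rightarrow> real) \<Rightarrow> nat \<Rightarrow> nat \<Rightarrow> real" where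
  "comp_mat d Q = (\<lambda>i j. idm d i j - Q i j)"

lemma mvec_comp_mat: "i < d \<Longrightarrow> mvec d (comp_mat d Q) v i = v i - mvec d Q v i"
  using idm_mvec[of d v] by (simp add: mvec_def comp_mat_def ring_distribs sum_subtractf fun_eq_iff)

lemma fro_proj: "is_proj d Q \<Longrightarrow> fro d d Q = trace d Q"
proof -
  assume Q: "is_proj d Q"
  have "fro d d Q = (\<Sum>a<d. inner_k d (unitv a) (mvec d Q (unitv a)))"
    by (simp add: fro_columns is_proj_sqnorm[OF Q])
  also have "\<dots> = trace d Q" by (simp add: trace_def inner_k_unitv mvec_unitv)
  finally show ?thesis .
qed

lemma is_proj_comp_mat:
  assumes Q: "is_proj d Q" shows "is_proj d (comp_mat d Q)"
proof -
  have sq: "is_sq d (comp_mat d Q)" using Q by (auto simp: is_proj_def is_sq_def comp_mat_def idm_def)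
  have "mvec d (comp_mat d Q) (mvec d (comp_mat d Q) v) i = mvec d (comp_mat d Q) v i" for v i
  proof (cases "i < d")
    case True
    have "mvec d Q (mvec d (comp_mat d Q) v) = mvec d Q (\<lambda>i. v i - mvec d Q v i)"
      by (intro mvec_cong mvec_comp_mat)
    also have "\<dots> = (\<lambda>_. 0)" using Q by (simp add: mvec_linear is_proj_def)
    finally show ?thesis using True by (simp add: mvec_comp_mat)
  next
    case False then show ?thesis using is_sq_mvec[OF sq] by simp
  qed
  then show ?thesis using sq Q by (auto simp: is_proj_def sym_mat_def comp_mat_def idm_def)
qed

lemma trace_comp_offp: "trace d (comp_mat d (offp d xs)) \<le> length xs"
  using trace_offp[of d xs] by (simp add: comp_mat_def trace_def sum_subtractf) (simp add: idm_def)

text \<open>A largest independent set of columns spans all columns: adding one more creates a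
  dependence in which the new column must have a nonzero coefficient.\<close>

lemma mrank_witness:
  obtains J where "J \<subseteq> {..<d}" "card J = mrank d A"
    "\<And>b. b < d \<Longrightarrow> \<exists>c. \<forall>i<d. A i b = (\<Sum>j\<in>J. c j * A i j)"
proof -
  let ?C = "{card J | J. J \<subseteq> {..<d} \<and> cols_indep d A J}"
  have fin: "finite ?C" by (rule finite_subset[of _ "card ` Pow {..<d}"]) auto
  \<comment> \<open>The empty set of columns ensures that \<open>Max\<close> is taken over a
    nonempty set and is attained.\<close>
  have "card {} \<in> ?C" by (intro CollectI exI[of _ "{}"]) (auto simp: cols_indep_def)
  then have "Max ?C \<in> ?C" using fin by (intro Max_in) auto
  then obtain J where J: "J \<subseteq> {..<d}" "cols_indep d A J" "card J = mrank d A" by (auto simp: mrank_def)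
  have finJ: "finite J" using J(1) finite_subset by blast
  have "\<exists>c. \<forall>i<d. A i b = (\<Sum>j\<in>J. c j * A i j)" if b: "b < d" for b
  proof (cases "b \<in> J")
    case True
    have "\<forall>i<d. A i b = (\<Sum>j\<in>J. (if j = b then 1 else 0) * A i j)"
    proof (intro allI impI)
      fix i
      have "(\<Sum>j\<in>J. (if j = b then 1 else 0) * A i j) = (\<Sum>j\<in>J. if j = b then A i j else 0)"
        by (intro sum.cong) auto
      then show "A i b = (\<Sum>j\<in>J. (if j = b then 1 else 0) * A i j)" using True finJ by simp
    qed
    then show ?thesis by (intro exI[of _ "\<lambda>j. if j = b then 1 else 0"]) simp
  next
    case False
    have "\<not> cols_indep d A (insert b J)"
    proof
      assume "cols_indep d A (insert b J)"
      then have "card (insert b J) \<in> ?C" using J(1) b by blast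
      then have "card (insert b J) \<le> mrank d A" unfolding mrank_def using fin by (intro Max_ge)
      then show False using J(3) False finJ by simp
    qed
    then obtain c where c: "\<And>i. i < d \<Longrightarrow> (\<Sum>j\<in>insert b J. c j * A i j) = 0" "\<exists>j\<in>insert b J. c j \<noteq> 0"
      unfolding cols_indep_def by blast
    have c': "c b * A i b + (\<Sum>j\<in>J. c j * A i j) = 0" if "i < d" for i
      using c(1)[OF that] False finJ by simp
    have "c b \<noteq> 0"
    proof
      assume "c b = 0"
      then have "\<forall>j\<in>J. c j = 0" using J(2) c' unfolding cols_indep_def by simp
      then show False using c(2) \<open>c b = 0\<close> by auto
    qed
    then have "A i b = (\<Sum>j\<in>J. (- c j / c b) * A i j)" if "i < d" for i
    proof -
      have "(\<Sum>j\<in>J. (- c j / c b) * A i j) = - (\<Sum>j\<in>J. c j * A i j) / c b"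
        by (simp add: sum_divide_distrib sum_negf)
      also have "\<dots> = A i b" using c'[OF that] \<open>c b \<noteq> 0\<close> by (simp add: field_simps)
      finally show ?thesis by simp
    qed
    then show ?thesis by (intro exI[of _ "\<lambda>j. - c j / c b"]) auto
  qed
  then show thesis using that J by blast
qed

section \<open>Frobenius norms of products with a projection\<close>

lemma fro_mmul: "fro m k (mmul l A B) = (\<Sum>a<k. sqnorm m (mvec l A (mvec k B (unitv a))))"
  by (simp add: fro_columns mvec_mmul)

lemma fro_gram: "fro k k (mmul m (\<lambda>i j. A j i) A) = fro m m (mmul k A (\<lambda>i j. A j i))"
proof -
  have "fro k k (mmul m (\<lambda>i j. A j i) A) = (\<Sum>i<k. \<Sum>j<k. \<Sum>l<m. \<Sum>p<m. A l i * A l j * (A p i * A p j))"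
    by (simp add: fro_def mmul_def power2_eq_square sum_product)
  also have "\<dots> = (\<Sum>i<k. \<Sum>l<m. \<Sum>j<k. \<Sum>p<m. A l i * A l j * (A p i * A p j))"
    by (intro sum.cong refl sum.swap)
  also have "\<dots> = (\<Sum>l<m. \<Sum>i<k. \<Sum>j<k. \<Sum>p<m. A l i * A l j * (A p i * A p j))"
    by (rule sum.swap)
  also have "\<dots> = (\<Sum>l<m. \<Sum>i<k. \<Sum>p<m. \<Sum>j<k. A l i * A l j * (A p i * A p j))"
    by (intro sum.cong refl sum.swap)
  also have "\<dots> = (\<Sum>l<m. \<Sum>p<m. \<Sum>i<k. \<Sum>j<k. A l i * A l j * (A p i * A p j))"
    by (intro sum.cong refl sum.swap)
  also have "\<dots> = fro m m (mmul k A (\<lambda>i j. A j i))"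
    by (simp add: fro_def mmul_def power2_eq_square sum_product mult_ac)
  finally show ?thesis .
qed

lemma fro_proj_le: "is_proj d Q \<Longrightarrow> fro d k (mmul d Q A) \<le> fro d k A"
  unfolding fro_mmul fro_columns[of d k A] by (intro sum_mono is_proj_sqnorm_le)

lemma fro_mmul_transpose:
  assumes "sym_mat d A" "sym_mat d B" shows "fro d d (mmul d A B) = fro d d (mmul d B A)"
  by (subst fro_transpose, rule fro_cong)
    (use assms in \<open>auto simp: mmul_def mult.commute sym_mat_def intro!: sum.cong\<close>)

text \<open>The right side is the trace of Q A, which is linear in A; this makes the contributions
  of \<Sigma>1 and \<Sigma>2 add up exactly.\<close>

lemma fro_proj_root:
  assumes Q: "is_proj d Q" and S: "psd_root d A S"
  shows "fro d d (mmul d Q S) = (\<Sum>i<d. \<Sum>j<d. Q i j * A i j)"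
proof -
  have symS: "sym_mat d S" using S by (simp add: psd_root_def psd_sym)
  have "fro d d (mmul d Q S) = (\<Sum>a<d. \<Sum>i<d. \<Sum>j<d. S i a * Q i j * S j a)"
    by (simp add: fro_mmul is_proj_sqnorm[OF Q])
      (simp add: inner_k_def mvec_def[of d Q] mvec_unitv sum_distrib_left mult.assoc)
  also have "\<dots> = (\<Sum>i<d. \<Sum>a<d. \<Sum>j<d. S i a * Q i j * S j a)" by (rule sum.swap)
  also have "\<dots> = (\<Sum>i<d. \<Sum>j<d. \<Sum>a<d. S i a * Q i j * S j a)" by (intro sum.cong refl sum.swap)
  also have "\<dots> = (\<Sum>i<d. \<Sum>j<d. Q i j * A i j)"
  proof (intro sum.cong refl)
    fix i j assume "i \<in> {..<d}" "j \<in> {..<d}"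
    then have "A i j = (\<Sum>a<d. S i a * S a j)" using S by (auto simp: psd_root_def mmul_def)
    also have "\<dots> = (\<Sum>a<d. S i a * S j a)"
      using symS \<open>j \<in> _\<close> by (intro sum.cong refl) (auto simp: sym_mat_def)
    finally show "(\<Sum>a<d. S i a * Q i j * S j a) = Q i j * A i j"
      by (simp add: sum_distrib_left mult_ac)
  qed
  finally show ?thesis .
qed

lemma fro_psd_root: "psd_root d A S \<Longrightarrow> fro d d S = trace d A"
proof -
  assume S: "psd_root d A S"
  have "fro d d S = (\<Sum>a<d. inner_k d (unitv a) (mvec d A (unitv a)))"
    by (simp add: fro_columns psd_root_sqnorm[OF S])
  then show ?thesis by (simp add: trace_def inner_k_unitv mvec_unitv)
qed

text \<open>The lost trace is that of P A for the complementary projection P. By Cauchy-Schwarz for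
  entries it is at most |P| |A| in Frobenius norm, and |P|^2, the trace of P, is at most the number
  of vectors. The bound involves A only through its trace and Frobenius norm, the two quantities in
  \<open>eff_rank\<close>.\<close>

lemma fro_offp_root_ge:
  assumes S: "psd_root d A S"
  shows "trace d A - sqrt (real (length xs) * fro d d A) \<le> fro d d (mmul d (offp d xs) S)"
proof -
  let ?Q = "offp d xs" let ?P = "comp_mat d ?Q"
  have P: "is_proj d ?P" by (intro is_proj_comp_mat offp_proj)
  have "(\<Sum>i<d. \<Sum>j<d. ?P i j * A i j)\<^sup>2 \<le> fro d d ?P * fro d d A"
    unfolding fro_def sum.cartesian_product
    using Cauchy_Schwarz_ineq_sum[of "\<lambda>(i,j). ?P i j" "\<lambda>(i,j). A i j" "{..<d} \<times> {..<d}"]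
    by (simp add: case_prod_unfold)
  also have "\<dots> \<le> real (length xs) * fro d d A"
    by (intro mult_right_mono) (auto simp: fro_proj[OF P] trace_comp_offp)
  finally have "(\<Sum>i<d. \<Sum>j<d. ?P i j * A i j) \<le> sqrt (real (length xs) * fro d d A)"
    by (rule real_le_rsqrt)
  moreover have "(\<Sum>i<d. \<Sum>j<d. ?P i j * A i j) = trace d A - (\<Sum>i<d. \<Sum>j<d. ?Q i j * A i j)"
  proof -
    have "(\<Sum>j<d. idm d i j * A i j) = A i i" if "i < d" for i
    proof -
      have "(\<Sum>j<d. idm d i j * A i j) = (\<Sum>j<d. if j = i then A i j else 0)"
        using that by (intro sum.cong) (auto simp: idm_def)
      then show ?thesis using that by simp
    qed
    then have "(\<Sum>i<d. \<Sum>j<d. idm d i j * A i j) = trace d A" by (simp add: trace_def)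
    then show ?thesis by (simp add: comp_mat_def left_diff_distrib sum_subtractf)
  qed
  ultimately show ?thesis by (simp add: fro_proj_root[OF offp_proj S])
qed

section \<open>Roots of a covariance splitting\<close>

locale cov_roots =
  fixes d :: nat and \<Sigma> \<Sigma>1 \<Sigma>2 S1 S2 :: "nat \<Rightarrow> nat \<Rightarrow> real"
  assumes split: "cov_split d \<Sigma> \<Sigma>1 \<Sigma>2"
    and root1: "psd_root d \<Sigma>1 S1" and root2: "psd_root d \<Sigma>2 S2"
begin

definition S :: "nat \<Rightarrow> nat \<Rightarrow> real" where "S = (\<lambda>i j. S1 i j + S2 i j)"

lemma mvec_S: "mvec d S v = (\<lambda>i. mvec d S1 v i + mvec d S2 v i)"
  by (rule ext) (simp add: S_def mvec_def ring_distribs sum.distrib)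

lemma sq1: "is_sq d S1" and sq2: "is_sq d S2" and sym1: "sym_mat d S1" and sym2: "sym_mat d S2"
  using root1 root2 by (auto simp: psd_root_def psd_sym)

lemma symS: "sym_mat d S"
  using sym1 sym2 by (simp add: S_def sym_mat_def)

lemma zero_ext: "is_sq d A \<Longrightarrow> sqnorm d (mvec d A v) = 0 \<Longrightarrow> mvec d A v = (\<lambda>_. 0)"
  using is_sq_mvec[of d A] by (auto simp: sqnorm_eq_0_iff) (metis linorder_not_less)

lemma mvec_root_root: "i < d \<Longrightarrow> psd_root d A R \<Longrightarrow> mvec d R (mvec d R v) i = mvec d A v i"
  unfolding mvec_mmul[symmetric] by (rule mvec_mat_cong) (auto simp: psd_root_def)

text \<open>The splitting only gives orthogonality of the columns of S1^2 and S2^2. Testing it at u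
  = S2 S2 v yields S1 S2^2 = 0, and then |S2 S1 v|^2 = <v, S1 S2^2 S1 v> vanishes.\<close>

lemma S2_S1: "mvec d S2 (mvec d S1 v) = (\<lambda>_. 0)"
proof -
  have orth: "inner_k d (mvec d S1 (mvec d S1 u)) (mvec d S2 (mvec d S2 v)) = 0" for u v
  proof -
    have "inner_k d (mvec d S1 (mvec d S1 u)) (mvec d S2 (mvec d S2 v))
        = inner_k d (mvec d \<Sigma>1 u) (mvec d \<Sigma>2 v)"
      by (intro inner_k_cong mvec_root_root root1 root2)
    then show ?thesis using split by (simp add: cov_split_def)
  qed
  have 1: "mvec d S1 (mvec d S2 (mvec d S2 v)) = (\<lambda>_. 0)" for v
    using orth[of "mvec d S2 (mvec d S2 v)" v]
    by (intro zero_ext sq1) (metis inner_k_mvec_sym inner_k_self sym1)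
  have "sqnorm d (mvec d S2 (mvec d S1 v)) = inner_k d v (mvec d S1 (mvec d S2 (mvec d S2 (mvec d S1 v))))"
    by (metis inner_k_mvec_sym inner_k_self sym1 sym2)
  also have "\<dots> = 0" by (simp add: 1)
  finally show ?thesis by (intro zero_ext sq2)
qed

lemma inner_S1_S2: "inner_k d (mvec d S1 u) (mvec d S2 v) = 0"
  using inner_k_mvec_sym[OF sym2, of "mvec d S1 u" v] by (simp add: S2_S1)

lemma S1_S2: "mvec d S1 (mvec d S2 v) = (\<lambda>_. 0)"
proof (rule zero_ext[OF sq1])
  have "sqnorm d (mvec d S1 (mvec d S2 v)) = inner_k d (mvec d S1 (mvec d S1 (mvec d S2 v))) (mvec d S2 v)"
    by (metis inner_k_mvec_sym inner_k_self sym1)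
  then show "sqnorm d (mvec d S1 (mvec d S2 v)) = 0" by (simp add: inner_S1_S2)
qed

lemma sqnorm_S: "sqnorm d (mvec d S v) = sqnorm d (mvec d S1 v) + sqnorm d (mvec d S2 v)"
  by (simp add: mvec_S sqnorm_add inner_S1_S2)

text \<open>The mixed products vanish, so the square of the sum is the sum of the squares. By
  uniqueness, S is the root used in \<open>design\<close>.\<close>

lemma rootS: "psd_root d \<Sigma> S"
  unfolding psd_root_def
proof (intro conjI allI impI)
  show "is_sq d S" using sq1 sq2 by (simp add: is_sq_def S_def)
  show "psd d S"
    using root1 root2 symS psd_nonneg[of d S1] psd_nonneg[of d S2]
    by (auto simp: psd_def qform_def mvec_S inner_k_linear psd_root_def)
  fix i j assume ij: "i < d" "j < d"
  have "mmul d S S i j = mvec d S (mvec d S (unitv j)) i"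
    using ij by (simp add: mvec_unitv flip: mvec_mmul)
  also have "\<dots> = mvec d S1 (mvec d S1 (unitv j)) i + mvec d S2 (mvec d S2 (unitv j)) i"
    by (simp add: mvec_S mvec_linear S1_S2 S2_S1)
  also have "\<dots> = \<Sigma>1 i j + \<Sigma>2 i j"
    using ij by (simp add: mvec_root_root[OF _ root1] mvec_root_root[OF _ root2] mvec_unitv)
  also have "\<dots> = \<Sigma> i j" using split ij by (simp add: cov_split_def)
  finally show "mmul d S S i j = \<Sigma> i j" .
qed

text \<open>P projects onto the column space of \<Sigma>1, with complement Q built from
  \<open>mrank\<close> many spanning columns. From Q \<Sigma>1 = 0 follows |S1 Q v|^2 = <Q v,
  \<Sigma>1 Q v> = 0, and Q S1 = 0 by symmetry; Q fixes the range of S2, so S2 P = 0.\<close>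

lemma rank_projection:
  obtains P where "is_proj d P" "trace d P \<le> real (mrank d \<Sigma>1)"
    "\<And>v. mvec d P (mvec d S1 v) = mvec d S1 v" "\<And>v. mvec d S1 (mvec d P v) = mvec d S1 v"
    "\<And>v. mvec d S2 (mvec d P v) = (\<lambda>_. 0)"
proof -
  obtain J where J: "J \<subseteq> {..<d}" "card J = mrank d \<Sigma>1"
    and comb: "\<And>b. b < d \<Longrightarrow> \<exists>c. \<forall>i<d. \<Sigma>1 i b = (\<Sum>j\<in>J. c j * \<Sigma>1 i j)"
    using mrank_witness[of d \<Sigma>1] by metis
  have finJ: "finite J" using J(1) finite_subset by blast
  define xs where "xs = map (\<lambda>j i. \<Sigma>1 i j) (sorted_list_of_set J)"
  define Q where "Q = offp d xs"
  define P where "P = comp_mat d Q"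
  have Q: "is_proj d Q" unfolding Q_def by (rule offp_proj)
  have P: "is_proj d P" unfolding P_def by (intro is_proj_comp_mat Q)
  have tr: "trace d P \<le> real (mrank d \<Sigma>1)"
    using trace_comp_offp[of d xs] J(2) by (simp add: P_def Q_def xs_def)
  have colJ: "mvec d Q (\<lambda>i. \<Sigma>1 i j) = (\<lambda>_. 0)" if "j \<in> J" for j
    unfolding Q_def by (rule offp_kills) (use that finJ in \<open>auto simp: xs_def\<close>)
  have col: "mvec d Q (\<lambda>i. \<Sigma>1 i b) = (\<lambda>_. 0)" if "b < d" for b
  proof -
    from comb[OF that] obtain c where c: "\<And>i. i < d \<Longrightarrow> \<Sigma>1 i b = (\<Sum>j\<in>J. c j * \<Sigma>1 i j)" by blast
    have "mvec d Q (\<lambda>i. \<Sigma>1 i b) = mvec d Q (\<lambda>i. \<Sum>j\<in>J. c j * \<Sigma>1 i j)" by (intro mvec_cong c)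
    also have "\<dots> = (\<lambda>i. \<Sum>j\<in>J. c j * mvec d Q (\<lambda>i. \<Sigma>1 i j) i)"
      by (simp add: mvec_sum[OF finJ] mvec_scale)
    also have "\<dots> = (\<lambda>_. 0)" by (simp add: colJ)
    finally show ?thesis .
  qed
  have QS: "mvec d Q (mvec d \<Sigma>1 u) = (\<lambda>_. 0)" for u
  proof -
    have "mvec d \<Sigma>1 u = (\<lambda>i. \<Sum>b<d. u b * \<Sigma>1 i b)" by (rule ext) (simp add: mvec_def mult.commute)
    then have "mvec d Q (mvec d \<Sigma>1 u) = (\<lambda>i. \<Sum>b<d. u b * mvec d Q (\<lambda>i. \<Sigma>1 i b) i)"
      by (simp add: mvec_sum mvec_scale)
    then show ?thesis by (simp add: col)
  qed
  have S1Q: "mvec d S1 (mvec d Q v) = (\<lambda>_. 0)" for v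
  proof (rule zero_ext[OF sq1])
    have "sqnorm d (mvec d S1 (mvec d Q v)) = inner_k d (mvec d Q v) (mvec d \<Sigma>1 (mvec d Q v))"
      by (rule psd_root_sqnorm[OF root1])
    also have "\<dots> = inner_k d v (mvec d Q (mvec d \<Sigma>1 (mvec d Q v)))"
      using is_proj_inner(2)[OF Q] by metis
    finally show "sqnorm d (mvec d S1 (mvec d Q v)) = 0" by (simp add: QS)
  qed
  have QS1: "mvec d Q (mvec d S1 v) = (\<lambda>_. 0)" for v
  proof (rule zero_ext)
    show "is_sq d Q" using Q by (simp add: is_proj_def)
    have "sqnorm d (mvec d Q (mvec d S1 v)) = inner_k d v (mvec d S1 (mvec d Q (mvec d S1 v)))"
      by (simp add: is_proj_sqnorm[OF Q] inner_k_mvec_sym[OF sym1])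
    then show "sqnorm d (mvec d Q (mvec d S1 v)) = 0" by (simp add: S1Q)
  qed
  have QS2: "mvec d Q (mvec d S2 v) i = mvec d S2 v i" if "i < d" for v i
    unfolding Q_def
  proof (rule offp_fixes[OF _ that])
    fix x assume "x \<in> set xs"
    then obtain j where j: "j < d" "x = (\<lambda>i. \<Sigma>1 i j)" using J(1) finJ by (auto simp: xs_def)
    have "inner_k d x (mvec d S2 v) = inner_k d (mvec d S1 (mvec d S1 (unitv j))) (mvec d S2 v)"
      using j by (intro inner_k_cong) (auto simp: mvec_root_root[OF _ root1] mvec_unitv)
    then show "inner_k d x (mvec d S2 v) = 0" by (simp add: inner_S1_S2)
  qed
  have Pv: "mvec d R (mvec d P v) = (\<lambda>i. mvec d R v i - mvec d R (mvec d Q v) i)" for R v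
  proof -
    have "mvec d R (mvec d P v) = mvec d R (\<lambda>i. v i - mvec d Q v i)"
      unfolding P_def by (intro mvec_cong mvec_comp_mat)
    then show ?thesis by (simp add: mvec_linear)
  qed
  have sqP: "is_sq d P" using P by (simp add: is_proj_def)
  have "mvec d P (mvec d S1 v) i = mvec d S1 v i" for v i
    using is_sq_mvec[OF sqP] is_sq_mvec[OF sq1]
    by (cases "i < d") (simp_all add: P_def mvec_comp_mat QS1)
  moreover have "mvec d S1 (mvec d P v) = mvec d S1 v" for v by (simp add: Pv S1Q)
  moreover have "mvec d S2 (mvec d P v) = (\<lambda>_. 0)" for v
  proof (rule zero_ext[OF sq2])
    have "sqnorm d (mvec d S2 (mvec d P v)) = inner_k d (mvec d P v) (mvec d S2 (mvec d S2 (mvec d P v)))"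
      by (metis inner_k_mvec_sym inner_k_self sym2)
    also have "\<dots> = inner_k d v (mvec d P (mvec d S2 (mvec d S2 (mvec d P v))))"
      using is_proj_inner(2)[OF P] by metis
    also have "\<dots> = inner_k d v (\<lambda>_. 0)"
      by (intro inner_k_cong refl) (simp add: P_def mvec_comp_mat QS2)
    finally show "sqnorm d (mvec d S2 (mvec d P v)) = 0" by simp
  qed
  ultimately show thesis using that P tr by blast
qed

text \<open>Split the right factor S into S1 + S2. The block S Q S1 costs two operator bounds and
  the rank, that is k \<kappa>^2. The block S1 Q S2 is the transpose of S2 Q S1, a part of the first
  one. The block S2 Q S2 is at most \<Sigma>2 itself. The 4 is 2 + 2 from the first two
  blocks.\<close>

lemma fro_compressed_le:
  assumes Q: "is_proj d Q" and "0 \<le> \<kappa>"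
    and op: "\<And>u. sqnorm d (mvec d S (mvec d Q u)) \<le> \<kappa> * sqnorm d (mvec d Q u)"
  shows "fro d d (mmul d S (mmul d Q S)) \<le> 4 * real (mrank d \<Sigma>1) * \<kappa>\<^sup>2 + 2 * fro d d \<Sigma>2"
proof -
  obtain P where P: "is_proj d P" "trace d P \<le> real (mrank d \<Sigma>1)" "\<And>v. mvec d S1 (mvec d P v) = mvec d S1 v"
    using rank_projection by metis
  have symQ: "sym_mat d Q" using Q by (simp add: is_proj_def)
  \<comment> \<open>The transposed operator bound: for v = Q S1 y one has |v|^2 = <S1 v, y>, and |S1
    v| is controlled by \<open>op\<close> because v lies in the range of Q.\<close>
  have QS1: "sqnorm d (mvec d Q (mvec d S1 y)) \<le> \<kappa> * sqnorm d y" for y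
  proof -
    let ?v = "mvec d Q (mvec d S1 y)"
    have "(sqnorm d ?v)\<^sup>2 = (inner_k d (mvec d S1 ?v) y)\<^sup>2"
      by (simp add: is_proj_sqnorm[OF Q] inner_k_commute[of d "mvec d S1 y"] inner_k_mvec_sym[OF sym1])
    also have "\<dots> \<le> sqnorm d (mvec d S1 ?v) * sqnorm d y" by (rule Cauchy_Schwarz_inner_k)
    also have "\<dots> \<le> (\<kappa> * sqnorm d ?v) * sqnorm d y"
    proof (intro mult_right_mono)
      show "sqnorm d (mvec d S1 ?v) \<le> \<kappa> * sqnorm d ?v"
        using op[of "mvec d S1 y"] sqnorm_nonneg[of d "mvec d S2 ?v"] unfolding sqnorm_S by linarith
    qed auto
    finally have *: "sqnorm d ?v * sqnorm d ?v \<le> sqnorm d ?v * (\<kappa> * sqnorm d y)"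
      by (simp add: power2_eq_square mult_ac)
    show ?thesis
    proof (cases "sqnorm d ?v = 0")
      case False
      then have "sqnorm d ?v > 0" using sqnorm_nonneg[of d ?v] by linarith
      then show ?thesis using * by (rule mult_left_le_imp_le[rotated])
    qed (simp add: \<open>0 \<le> \<kappa>\<close>)
  qed
  \<comment> \<open>Writing S1 as S1 P turns an operator bound into a Frobenius bound that pays only
    the trace of P.\<close>
  have "fro d d (mmul d Q S1) = (\<Sum>a<d. sqnorm d (mvec d Q (mvec d S1 (mvec d P (unitv a)))))"
    by (simp add: fro_mmul P)
  also have "\<dots> \<le> (\<Sum>a<d. \<kappa> * sqnorm d (mvec d P (unitv a)))" by (intro sum_mono QS1)
  also have "\<dots> = \<kappa> * fro d d P" by (simp add: fro_columns sum_distrib_left)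
  also have "\<dots> \<le> \<kappa> * real (mrank d \<Sigma>1)" using P \<open>0 \<le> \<kappa>\<close> by (simp add: fro_proj mult_left_mono)
  finally have froQS1: "fro d d (mmul d Q S1) \<le> \<kappa> * real (mrank d \<Sigma>1)" .
  have "fro d d (mmul d S (mmul d Q S1)) \<le> (\<Sum>a<d. \<kappa> * sqnorm d (mvec d Q (mvec d S1 (unitv a))))"
    unfolding fro_mmul mvec_mmul by (intro sum_mono op)
  also have "\<dots> = \<kappa> * fro d d (mmul d Q S1)" by (simp add: fro_mmul sum_distrib_left)
  also have "\<dots> \<le> \<kappa> * (\<kappa> * real (mrank d \<Sigma>1))" by (intro mult_left_mono froQS1 \<open>0 \<le> \<kappa>\<close>)
  finally have SQS1: "fro d d (mmul d S (mmul d Q S1)) \<le> real (mrank d \<Sigma>1) * \<kappa>\<^sup>2"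
    by (simp add: power2_eq_square mult_ac)
  have "fro d d (mmul d S1 (mmul d Q S2)) = fro d d (mmul d S2 (mmul d Q S1))"
  proof (subst fro_transpose, rule fro_cong)
    fix i j assume ij: "i < d" "j < d"
    have "mmul d S1 (mmul d Q S2) j i = inner_k d (unitv j) (mvec d S1 (mvec d Q (mvec d S2 (unitv i))))"
      using ij by (simp add: inner_k_unitv mvec_unitv flip: mvec_mmul)
    also have "\<dots> = inner_k d (unitv i) (mvec d S2 (mvec d Q (mvec d S1 (unitv j))))"
      by (metis inner_k_commute inner_k_mvec_sym sym1 sym2 symQ)
    also have "\<dots> = mmul d S2 (mmul d Q S1) i j"
      using ij by (simp add: inner_k_unitv mvec_unitv flip: mvec_mmul)
    finally show "mmul d S1 (mmul d Q S2) j i = mmul d S2 (mmul d Q S1) i j" .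
  qed
  also have "\<dots> \<le> fro d d (mmul d S (mmul d Q S1))"
    unfolding fro_mmul by (intro sum_mono) (simp add: sqnorm_S)
  finally have S1QS2: "fro d d (mmul d S1 (mmul d Q S2)) \<le> real (mrank d \<Sigma>1) * \<kappa>\<^sup>2" using SQS1 by linarith
  have S2QS2: "fro d d (mmul d S2 (mmul d Q S2)) \<le> fro d d \<Sigma>2"
  proof -
    let ?A = "mmul d Q S2"
    have QQ: "mmul d Q Q i j = Q i j" if "j < d" for i j
      using Q that by (metis is_proj_def mvec_mmul mvec_unitv)
    have "fro d d (mmul d S2 ?A) = fro d d (mmul d (\<lambda>i j. ?A j i) ?A)"
    proof (rule fro_cong)
      fix i j assume ij: "i < d" "j < d"
      have "mmul d (\<lambda>i j. ?A j i) ?A i j = inner_k d (mvec d Q (mvec d S2 (unitv i))) (mvec d Q (mvec d S2 (unitv j)))"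
        unfolding mmul_def[of d "\<lambda>i j. ?A j i"] inner_k_def
        using ij by (intro sum.cong refl) (simp add: mvec_unitv flip: mvec_mmul)
      also have "\<dots> = inner_k d (unitv i) (mvec d S2 (mvec d Q (mvec d S2 (unitv j))))"
        by (simp add: is_proj_inner(1)[OF Q] inner_k_mvec_sym[OF sym2])
      also have "\<dots> = mmul d S2 ?A i j"
        using ij by (simp add: inner_k_unitv mvec_unitv flip: mvec_mmul)
      finally show "mmul d S2 ?A i j = mmul d (\<lambda>i j. ?A j i) ?A i j" by simp
    qed
    also have "\<dots> = fro d d (mmul d ?A (\<lambda>i j. ?A j i))" by (rule fro_gram)
    also have "\<dots> = fro d d (mmul d Q (mmul d \<Sigma>2 Q))"
    proof (rule fro_cong)
      fix i j assume ij: "i < d" "j < d"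
      have "mmul d ?A (\<lambda>i j. ?A j i) i j = mmul d ?A (mmul d S2 Q) i j"
        unfolding mmul_def[of d ?A] using ij symQ sym2
        by (intro sum.cong refl arg_cong2[where f = "(*)"])
          (auto simp: mmul_def sym_mat_def mult.commute intro!: sum.cong)
      also have "\<dots> = mmul d Q (mmul d (mmul d S2 S2) Q) i j"
        by (simp only: mmul_assoc)
      also have "\<dots> = mmul d Q (mmul d \<Sigma>2 Q) i j"
        using root2 by (simp add: mmul_def[of d Q] mmul_def[of d "mmul d S2 S2"] mmul_def[of d \<Sigma>2] psd_root_def)
      finally show "mmul d ?A (\<lambda>i j. ?A j i) i j = mmul d Q (mmul d \<Sigma>2 Q) i j" .
    qed
    also have "\<dots> \<le> fro d d (mmul d \<Sigma>2 Q)" by (rule fro_proj_le[OF Q])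
    also have "\<dots> = fro d d (mmul d Q \<Sigma>2)"
      using split by (intro fro_mmul_transpose symQ) (auto simp: cov_split_def psd_sym)
    also have "\<dots> \<le> fro d d \<Sigma>2" by (rule fro_proj_le[OF Q])
    finally show ?thesis .
  qed
  have "fro d d (mmul d S (mmul d Q S)) \<le> (\<Sum>a<d. 2 * sqnorm d (mvec d S (mvec d Q (mvec d S1 (unitv a))))
      + 2 * sqnorm d (mvec d S (mvec d Q (mvec d S2 (unitv a)))))"
    unfolding fro_mmul mvec_mmul
  proof (intro sum_mono)
    fix a
    have "mvec d S (mvec d Q (mvec d S (unitv a))) = (\<lambda>i. mvec d S (mvec d Q (mvec d S1 (unitv a))) i
        + mvec d S (mvec d Q (mvec d S2 (unitv a))) i)"
      unfolding mvec_S[of "unitv a"] by (simp only: mvec_linear)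
    then show "sqnorm d (mvec d S (mvec d Q (mvec d S (unitv a)))) \<le>
        2 * sqnorm d (mvec d S (mvec d Q (mvec d S1 (unitv a)))) + 2 * sqnorm d (mvec d S (mvec d Q (mvec d S2 (unitv a))))"
      by (simp only: sqnorm_add_le)
  qed
  \<comment> \<open>On the S2 columns the squared norm after S splits exactly into its S1 and S2
    parts, so no further factor 2 is lost.\<close>
  also have "\<dots> = 2 * fro d d (mmul d S (mmul d Q S1)) + 2 * fro d d (mmul d S1 (mmul d Q S2))
      + 2 * fro d d (mmul d S2 (mmul d Q S2))"
    unfolding fro_mmul mvec_mmul sqnorm_S[of "mvec d Q (mvec d S2 _)"]
    by (simp add: sum.distrib sum_distrib_left)
  finally show ?thesis using SQS1 S1QS2 S2QS2 by linarith
qed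

end

section \<open>The minimum norm interpolator\<close>

text \<open>Interpolators differ by null vectors of X, to which w is orthogonal, so Pythagoras makes
  w the strict minimiser. Uniqueness as functions uses that both vanish from d on.\<close>

lemma min_norm_interp_eqI:
  assumes w: "w \<in> interp_set n d X Y"
    and orth: "\<And>v. (\<And>i. i < n \<Longrightarrow> inner_k d (X i) v = 0) \<Longrightarrow> inner_k d w v = 0"
  shows "min_norm_interp n d X Y = w"
proof -
  have *: "sqnorm d v = sqnorm d w + sqnorm d (\<lambda>i. v i - w i)" if "v \<in> interp_set n d X Y" for v
  proof -
    have "inner_k d w (\<lambda>i. v i - w i) = 0"
      using that w by (intro orth) (auto simp: interp_set_def inner_k_linear mvec_def inner_k_def)
    then show ?thesis using sqnorm_add[of d w "\<lambda>i. v i - w i"] by simp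
  qed
  show ?thesis
    unfolding min_norm_interp_def
  proof (rule the_equality)
    show "w \<in> interp_set n d X Y \<and> (\<forall>v\<in>interp_set n d X Y. sqnorm d w \<le> sqnorm d v)"
    proof (intro conjI ballI w)
      fix v assume "v \<in> interp_set n d X Y"
      from *[OF this] show "sqnorm d w \<le> sqnorm d v"
        using sqnorm_nonneg[of d "\<lambda>i. v i - w i"] by linarith
    qed
    fix v assume v: "v \<in> interp_set n d X Y \<and> (\<forall>u\<in>interp_set n d X Y. sqnorm d v \<le> sqnorm d u)"
    then have "sqnorm d v \<le> sqnorm d w" "sqnorm d v = sqnorm d w + sqnorm d (\<lambda>i. v i - w i)"
      using w *[of v] by blast+
    then have "sqnorm d (\<lambda>i. v i - w i) = 0"
      using sqnorm_nonneg[of d "\<lambda>i. v i - w i"] by linarith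
    then show "v = w"
      using v w by (auto simp: sqnorm_eq_0_iff interp_set_def fun_eq_iff) (metis linorder_not_less)
  qed
qed

definition others :: "nat \<Rightarrow> nat \<Rightarrow> nat list" where
  "others n i = filter (\<lambda>l. l \<noteq> i) [0..<n]"

lemma set_others: "set (others n i) = {..<n} - {i}"
  by (auto simp: others_def)

lemma length_others_le: "length (others n i) \<le> n"
  unfolding others_def by (metis length_filter_le length_upt minus_nat.diff_0)

text \<open>The vectors \<open>p i\<close> form the basis dual to the rows within their span, written in leave-one-out form.\<close>
lemma min_norm_interp_leave_one_out:
  fixes X :: "nat \<Rightarrow> nat \<Rightarrow> real" and n d :: nat
  defines "Q \<equiv> offp d (map X [0..<n])"
  defines "Qi \<equiv> \<lambda>i. offp d (map X (others n i))"
  defines "p \<equiv> \<lambda>i j. mvec d (Qi i) (X i) j / inner_k d (X i) (mvec d (Qi i) (X i))"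
  assumes D: "\<And>i. i < n \<Longrightarrow> inner_k d (X i) (mvec d (Qi i) (X i)) \<noteq> 0"
    and Y: "\<And>i. i < n \<Longrightarrow> Y i = mvec d X w i + z i"
    and j: "j < d"
  shows "min_norm_interp n d X Y j = w j - mvec d Q w j + (\<Sum>i<n. z i * p i j)"
proof -
  \<comment> \<open>The cutoff at d is demanded by \<open>interp_set\<close>.\<close>
  define h where "h = (\<lambda>j. if j < d then w j - mvec d Q w j + (\<Sum>i<n. z i * p i j) else 0)"
  have inner_h: "inner_k d v h = inner_k d v w - inner_k d v (mvec d Q w) + (\<Sum>i<n. z i * inner_k d v (p i))" for v
  proof -
    have *: "inner_k d v (\<lambda>j. \<Sum>i<n. z i * p i j) = (\<Sum>i<n. z i * inner_k d v (p i))"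
      unfolding inner_k_def sum_distrib_left by (subst sum.swap) (simp add: mult_ac)
    have "inner_k d v h = inner_k d v (\<lambda>j. w j - mvec d Q w j + (\<Sum>i<n. z i * p i j))"
      by (intro inner_k_cong) (auto simp: h_def)
    then show ?thesis unfolding * inner_k_linear .
  qed
  have ip: "inner_k d v (p i) = inner_k d v (mvec d (Qi i) (X i)) / inner_k d (X i) (mvec d (Qi i) (X i))" for v i
    by (simp add: p_def inner_k_def sum_divide_distrib)
  have Q: "is_proj d Q" and Qi: "is_proj d (Qi i)" for i unfolding Q_def Qi_def by (rule offp_proj)+
  have "h \<in> interp_set n d X Y"
  proof -
    have "mvec d X h l = Y l" if l: "l < n" for l
    proof -
      have "mvec d Q (X l) = (\<lambda>_. 0)" unfolding Q_def by (rule offp_kills) (use l in auto)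
      then have 1: "inner_k d (X l) (mvec d Q w) = 0" using is_proj_inner(2)[OF Q, of "X l" w] by simp
      have 2: "inner_k d (X l) (p i) = (if i = l then 1 else 0)" if i: "i < n" for i
      proof (cases "i = l")
        case True then show ?thesis using D[OF i] by (simp add: ip)
      next
        case False
        then have "mvec d (Qi i) (X l) = (\<lambda>_. 0)"
          unfolding Qi_def using l by (intro offp_kills) (auto simp: set_others)
        then show ?thesis using False by (simp add: ip is_proj_inner(2)[OF Qi])
      qed
      have "mvec d X h l = inner_k d (X l) h" by (simp add: mvec_def inner_k_def)
      also have "\<dots> = inner_k d (X l) w + (\<Sum>i<n. z i * (if i = l then 1 else 0))"
        unfolding inner_h using 1 2 by simp
      also have "\<dots> = Y l" using l Y[OF l] by (simp add: mvec_def inner_k_def if_distrib cong: if_cong)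
      finally show ?thesis .
    qed
    then show ?thesis by (simp add: interp_set_def h_def)
  qed
  moreover have "inner_k d h v = 0" if v: "\<And>i. i < n \<Longrightarrow> inner_k d (X i) v = 0" for v
  proof -
    have "inner_k d v (mvec d Q w) = inner_k d (mvec d Q v) w" by (rule is_proj_inner(2)[OF Q])
    also have "\<dots> = inner_k d v w"
      unfolding Q_def by (intro inner_k_cong refl offp_fixes) (auto simp: v)
    finally have 1: "inner_k d v (mvec d Q w) = inner_k d v w" .
    have 2: "inner_k d v (p i) = 0" if i: "i < n" for i
    proof -
      have "inner_k d v (mvec d (Qi i) (X i)) = inner_k d (mvec d (Qi i) v) (X i)" by (rule is_proj_inner(2)[OF Qi])
      also have "\<dots> = inner_k d v (X i)"
        unfolding Qi_def by (intro inner_k_cong refl offp_fixes) (auto simp: v set_others)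
      also have "\<dots> = 0" using v[OF i] by (simp add: inner_k_commute)
      finally show ?thesis by (simp add: ip)
    qed
    have "inner_k d v h = 0" unfolding inner_h using 1 2 by simp
    then show ?thesis by (simp add: inner_k_commute)
  qed
  ultimately have "min_norm_interp n d X Y = h" by (rule min_norm_interp_eqI)
  then show ?thesis using j by (simp add: h_def)
qed

section \<open>Products of standard normal distributions\<close>

abbreviation gauss :: "'i set \<Rightarrow> ('i \<Rightarrow> real) measure" where
  "gauss I \<equiv> PiM I (\<lambda>_. std_normal_distribution)"

lemma prob_space_std_normal: "prob_space std_normal_distribution"
  using real_dist_normal_dist by (simp add: real_distribution_def)

interpretation SN: prob_space std_normal_distribution
  by (rule prob_space_std_normal)

interpretation PN: product_prob_space "\<lambda>_. std_normal_distribution" I for I :: "'i set"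
  by unfold_locales

lemma std_normal_UNIV [simp]: "measure std_normal_distribution UNIV = 1"
  using SN.prob_space by simp

lemma prob_space_gauss: "prob_space (gauss I)"
  by (intro prob_space_PiM prob_space_std_normal)

lemma emeasure_gauss_space [simp]: "emeasure (gauss I) (space (gauss I)) = 1"
  using prob_space.emeasure_space_1[OF prob_space_gauss] .

lemma gauss_coord_measurable: "i \<in> I \<Longrightarrow> (\<lambda>g. g i) \<in> borel_measurable (gauss I)"
  using measurable_component_singleton[of i I "\<lambda>_. std_normal_distribution"]
  by (simp add: measurable_def)

section \<open>One-dimensional Gaussian integrals\<close>

lemma nn_integral_std_normal:
  assumes [measurable]: "f \<in> borel_measurable borel"
  shows "(\<integral>\<^sup>+x. f x \<partial>std_normal_distribution) = (\<integral>\<^sup>+x. ennreal (std_normal_density x) * f x \<partial>lborel)"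
  by (subst nn_integral_density) auto

text \<open>The Cameron-Martin formula in dimension one.\<close>

lemma std_normal_shift:
  assumes [measurable]: "f \<in> borel_measurable borel"
  shows "(\<integral>\<^sup>+x. f x \<partial>std_normal_distribution)
    = (\<integral>\<^sup>+x. ennreal (exp (- a * x - a\<^sup>2 / 2)) * f (x + a) \<partial>std_normal_distribution)"
proof -
  have "(\<integral>\<^sup>+x. f x \<partial>std_normal_distribution)
      = (\<integral>\<^sup>+x. ennreal (std_normal_density (a + 1 * x)) * f (a + 1 * x) \<partial>lborel)"
    by (subst nn_integral_std_normal, simp, subst nn_integral_real_affine[where c = 1 and t = a]) auto
  also have "\<dots> = (\<integral>\<^sup>+x. ennreal (std_normal_density x) * (ennreal (exp (- a * x - a\<^sup>2 / 2)) * f (x + a)) \<partial>lborel)"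
  proof (rule nn_integral_cong)
    fix x
    have "- (a + 1 * x)\<^sup>2 / 2 = - x\<^sup>2 / 2 + (- a * x - a\<^sup>2 / 2)"
      by (simp add: power2_eq_square field_simps)
    then have "std_normal_density (a + 1 * x) = std_normal_density x * exp (- a * x - a\<^sup>2 / 2)"
      by (simp only: std_normal_density_def exp_add mult.assoc)
    then show "ennreal (std_normal_density (a + 1 * x)) * f (a + 1 * x)
        = ennreal (std_normal_density x) * (ennreal (exp (- a * x - a\<^sup>2 / 2)) * f (x + a))"
      by (simp add: ennreal_mult' mult.assoc add.commute)
  qed
  also have "\<dots> = (\<integral>\<^sup>+x. ennreal (exp (- a * x - a\<^sup>2 / 2)) * f (x + a) \<partial>std_normal_distribution)"
    by (subst nn_integral_std_normal) auto
  finally show ?thesis .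
qed

text \<open>Completing the square. The result has the same shape in c with s replaced by s / (1 + s
  v^2), so coordinates can be integrated out one at a time.\<close>

lemma std_normal_exp_square:
  assumes s: "0 \<le> s"
  shows "(\<integral>\<^sup>+x. ennreal (exp (- s * (c + v * x)\<^sup>2 / 2)) \<partial>std_normal_distribution)
     = ennreal (exp (- (s / (1 + s * v\<^sup>2)) * c\<^sup>2 / 2) / sqrt (1 + s * v\<^sup>2))"
proof -
  define w where "w = 1 + s * v\<^sup>2"
  have w: "w > 0" using s by (simp add: w_def add_pos_nonneg)
  \<comment> \<open>After completing the square, \<tau> and \<mu> are the standard deviation and
    mean of the remaining Gaussian density.\<close>
  define \<tau> where "\<tau> = 1 / sqrt w"
  define \<mu> where "\<mu> = - (s * c * v) / w"
  have \<tau>: "\<tau> > 0" "\<tau>\<^sup>2 = 1 / w" using w by (auto simp: \<tau>_def power_divide)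
  let ?K = "exp (- (s / w) * c\<^sup>2 / 2) / sqrt w"
  have eq: "std_normal_density x * exp (- s * (c + v * x)\<^sup>2 / 2) = ?K * normal_density \<mu> \<tau> x" for x
  proof -
    have "- x\<^sup>2 / 2 + - s * (c + v * x)\<^sup>2 / 2 = - (s / w) * c\<^sup>2 / 2 + - (x - \<mu>)\<^sup>2 / (2 * \<tau>\<^sup>2)"
    proof -
      have "w * (x - \<mu>)\<^sup>2 = w * x\<^sup>2 + 2 * (s * c * v) * x + (s * c * v)\<^sup>2 / w"
        using w by (simp add: \<mu>_def power2_eq_square field_simps)
      moreover have "(s * c * v)\<^sup>2 / w = s * c\<^sup>2 - s * c\<^sup>2 / w"
        using w by (simp add: field_simps) (simp add: w_def power2_eq_square algebra_simps)
      ultimately have "w * (x - \<mu>)\<^sup>2 = x\<^sup>2 + s * (c + v * x)\<^sup>2 - s * c\<^sup>2 / w"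
        by (simp add: w_def power2_eq_square algebra_simps)
      then show ?thesis using w by (simp add: \<tau>(2) field_simps)
    qed
    then have "exp (- x\<^sup>2 / 2) * exp (- s * (c + v * x)\<^sup>2 / 2)
        = exp (- (s / w) * c\<^sup>2 / 2) * exp (- (x - \<mu>)\<^sup>2 / (2 * \<tau>\<^sup>2))"
      by (simp only: exp_add[symmetric])
    moreover have "1 / sqrt (2 * pi) = 1 / sqrt w * (1 / sqrt (2 * pi * \<tau>\<^sup>2))"
      using w by (simp add: \<tau>(2) real_sqrt_divide real_sqrt_mult)
    ultimately show ?thesis
      by (simp add: std_normal_density_def normal_density_def)
  qed
  have "(\<integral>\<^sup>+x. ennreal (exp (- s * (c + v * x)\<^sup>2 / 2)) \<partial>std_normal_distribution)
      = (\<integral>\<^sup>+x. ennreal (std_normal_density x * exp (- s * (c + v * x)\<^sup>2 / 2)) \<partial>lborel)"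
    by (subst nn_integral_std_normal) (auto simp: ennreal_mult')
  also have "\<dots> = (\<integral>\<^sup>+x. ennreal ?K * ennreal (normal_density \<mu> \<tau> x) \<partial>lborel)"
    unfolding eq using w by (intro nn_integral_cong ennreal_mult') (auto intro!: divide_nonneg_nonneg)
  also have "\<dots> = ennreal ?K * (\<integral>\<^sup>+x. ennreal (normal_density \<mu> \<tau> x) \<partial>lborel)"
    by (rule nn_integral_cmult) auto
  also have "(\<integral>\<^sup>+x. ennreal (normal_density \<mu> \<tau> x) \<partial>lborel) = 1"
    using \<tau>(1) by (subst nn_integral_eq_integral) auto
  finally show ?thesis by (simp add: w_def)
qed

lemma std_normal_moments:
  "(\<integral>x. x \<partial>std_normal_distribution) = 0" "(\<integral>x. x\<^sup>2 \<partial>std_normal_distribution) = 1"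
  "(\<integral>x. x ^ 3 \<partial>std_normal_distribution) = 0" "(\<integral>x. x ^ 4 \<partial>std_normal_distribution) = 3"
  using integral_std_normal_distribution_moment_odd[of 1] std_normal_distribution_even_moments[of 1]
    integral_std_normal_distribution_moment_odd[of 3] std_normal_distribution_even_moments[of 2]
  by (simp_all add: fact_numeral)

lemma std_normal_integrable:
  "integrable std_normal_distribution (\<lambda>x. x)" "integrable std_normal_distribution (\<lambda>x. x\<^sup>2)"
  "integrable std_normal_distribution (\<lambda>x. x ^ 3)" "integrable std_normal_distribution (\<lambda>x. x ^ 4)"
  using integrable_std_normal_distribution_moment[of 1] integrable_std_normal_distribution_moment by simp_all

lemma std_normal_affine_sq: "(\<integral>x. (\<alpha> + \<beta> * x)\<^sup>2 \<partial>std_normal_distribution) = \<alpha>\<^sup>2 + \<beta>\<^sup>2"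
proof -
  have "(\<lambda>x. (\<alpha> + \<beta> * x)\<^sup>2) = (\<lambda>x. \<alpha>\<^sup>2 + (2 * \<alpha> * \<beta>) * x + \<beta>\<^sup>2 * x\<^sup>2)"
    by (auto simp: power2_eq_square algebra_simps)
  then show ?thesis using std_normal_integrable by (simp add: std_normal_moments SN.prob_space)
qed

lemma std_normal_affine_sq_integrable: "integrable std_normal_distribution (\<lambda>x. (\<alpha> + \<beta> * x)\<^sup>2)"
proof -
  have "(\<lambda>x. (\<alpha> + \<beta> * x)\<^sup>2) = (\<lambda>x. \<alpha>\<^sup>2 + (2 * \<alpha> * \<beta>) * x + \<beta>\<^sup>2 * x\<^sup>2)"
    by (auto simp: power2_eq_square algebra_simps)
  then show ?thesis using std_normal_integrable by simp
qed

lemma std_normal_quadratic_sq: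
  "(\<integral>x. (\<alpha> + \<beta> * x + \<gamma> * x\<^sup>2)\<^sup>2 \<partial>std_normal_distribution) = \<alpha>\<^sup>2 + \<beta>\<^sup>2 + 3 * \<gamma>\<^sup>2 + 2 * \<alpha> * \<gamma>"
proof -
  have "(\<lambda>x. (\<alpha> + \<beta> * x + \<gamma> * x\<^sup>2)\<^sup>2) = (\<lambda>x. \<alpha>\<^sup>2 + (2 * \<alpha> * \<beta>) * x + (\<beta>\<^sup>2 + 2 * \<alpha> * \<gamma>) * x\<^sup>2
      + (2 * \<beta> * \<gamma>) * x ^ 3 + \<gamma>\<^sup>2 * x ^ 4)"
    by (auto simp: power2_eq_square power3_eq_cube power4_eq_xxxx algebra_simps)
  then show ?thesis using std_normal_integrable by (simp add: std_normal_moments SN.prob_space)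
qed

section \<open>Moments of linear and quadratic forms\<close>

lemma nn_integral_linear_sq:
  fixes k :: nat
  shows "(\<integral>\<^sup>+g. ennreal ((\<Sum>j<k. a j * g j)\<^sup>2) \<partial>gauss {..<k}) = ennreal (\<Sum>j<k. (a j)\<^sup>2)"
proof (induction k)
  case 0
  show ?case by simp
next
  case (Suc k)
  have "(\<integral>\<^sup>+g. ennreal ((\<Sum>j<Suc k. a j * g j)\<^sup>2) \<partial>gauss {..<Suc k})
     = (\<integral>\<^sup>+x. (\<integral>\<^sup>+y. ennreal ((\<Sum>j<Suc k. a j * (x(k := y)) j)\<^sup>2) \<partial>std_normal_distribution) \<partial>gauss {..<k})"
    unfolding lessThan_Suc by (subst PN.product_nn_integral_insert) auto
  also have "\<dots> = (\<integral>\<^sup>+x. ennreal ((\<Sum>j<k. a j * x j)\<^sup>2) + ennreal ((a k)\<^sup>2) \<partial>gauss {..<k})"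
  proof (rule nn_integral_cong)
    fix x :: "nat \<Rightarrow> real"
    have "(\<integral>\<^sup>+y. ennreal ((\<Sum>j<Suc k. a j * (x(k := y)) j)\<^sup>2) \<partial>std_normal_distribution)
       = (\<integral>\<^sup>+y. ennreal (((\<Sum>j<k. a j * x j) + a k * y)\<^sup>2) \<partial>std_normal_distribution)"
      by (intro nn_integral_cong) simp
    also have "\<dots> = ennreal ((\<Sum>j<k. a j * x j)\<^sup>2 + (a k)\<^sup>2)"
      by (subst nn_integral_eq_integral) (auto simp: std_normal_affine_sq std_normal_affine_sq_integrable)
    finally show "(\<integral>\<^sup>+y. ennreal ((\<Sum>j<Suc k. a j * (x(k := y)) j)\<^sup>2) \<partial>std_normal_distribution)
      = ennreal ((\<Sum>j<k. a j * x j)\<^sup>2) + ennreal ((a k)\<^sup>2)" by simp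
  qed
  also have "\<dots> = ennreal (\<Sum>j<k. (a j)\<^sup>2) + ennreal ((a k)\<^sup>2)"
    by (subst nn_integral_add) (auto simp: Suc)
  also have "\<dots> = ennreal (\<Sum>j<Suc k. (a j)\<^sup>2)" by (simp add: sum_nonneg)
  finally show ?case .
qed

lemma measurable_mvec_gauss: "(\<lambda>g. mvec k A g i) \<in> borel_measurable (gauss {..<k})"
  unfolding mvec_def
  by (intro borel_measurable_sum borel_measurable_times borel_measurable_const gauss_coord_measurable)

lemma measurable_inner_k:
  assumes "\<And>i. i < k \<Longrightarrow> (\<lambda>g. u g i) \<in> borel_measurable M" "\<And>i. i < k \<Longrightarrow> (\<lambda>g. v g i) \<in> borel_measurable M"
  shows "(\<lambda>g. inner_k k (u g) (v g)) \<in> borel_measurable M"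
  unfolding inner_k_def by (rule borel_measurable_sum, rule borel_measurable_times; rule assms; simp)

lemma measurable_qform_gauss: "(\<lambda>g. inner_k k g (mvec k A g)) \<in> borel_measurable (gauss {..<k})"
  by (rule measurable_inner_k; (rule measurable_mvec_gauss | rule gauss_coord_measurable; simp))

lemma nn_integral_sqnorm_mvec:
  "(\<integral>\<^sup>+g. ennreal (sqnorm m (mvec k A g)) \<partial>gauss {..<k}) = ennreal (fro m k A)"
proof -
  have "(\<integral>\<^sup>+g. ennreal (sqnorm m (mvec k A g)) \<partial>gauss {..<k})
      = (\<integral>\<^sup>+g. (\<Sum>i<m. ennreal ((\<Sum>j<k. A i j * g j)\<^sup>2)) \<partial>gauss {..<k})"
    by (simp add: sqnorm_def mvec_def)
  also have "\<dots> = (\<Sum>i<m. ennreal (\<Sum>j<k. (A i j)\<^sup>2))"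
    by (subst nn_integral_sum) (auto simp: nn_integral_linear_sq)
  also have "\<dots> = ennreal (fro m k A)" by (simp add: fro_def sum_nonneg)
  finally show ?thesis .
qed

lemma gauss_integrable_coord:
  assumes "i \<in> I" shows "integrable (gauss I) (\<lambda>g. (g i) ^ m)"
proof -
  have "integrable (distr (gauss I) std_normal_distribution (\<lambda>g. g i)) (\<lambda>x. x ^ m)"
    using integrable_std_normal_distribution_moment[of m] assms
    by (subst distr_PiM_component) (auto intro: prob_space_std_normal)
  then show ?thesis using assms
    by (subst (asm) integrable_distr_eq) (auto intro!: measurable_component_singleton)
qed

lemma gauss_integrable_qform_sq:
  "integrable (gauss {..<k}) (\<lambda>g. (inner_k k g (mvec k A g))\<^sup>2)"
proof (rule Bochner_Integration.integrable_bound)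
  show "integrable (gauss {..<k}) (\<lambda>g. fro k k A * (real k * (\<Sum>i<k. (g i) ^ 4)))"
    by (intro integrable_mult_right Bochner_Integration.integrable_sum gauss_integrable_coord) auto
  show "(\<lambda>g. (inner_k k g (mvec k A g))\<^sup>2) \<in> borel_measurable (gauss {..<k})"
    by (intro borel_measurable_power measurable_qform_gauss)
  \<comment> \<open>The squared form is at most |A|^2 |g|^4, and Cauchy-Schwarz against the constant
    vector reduces |g|^4 to fourth powers of coordinates.\<close>
  have "(inner_k k g (mvec k A g))\<^sup>2 \<le> fro k k A * (real k * (\<Sum>i<k. (g i) ^ 4))" for g
  proof -
    have "(inner_k k g (mvec k A g))\<^sup>2 \<le> sqnorm k g * sqnorm k (mvec k A g)" by (rule Cauchy_Schwarz_inner_k)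
    also have "\<dots> \<le> sqnorm k g * (fro k k A * sqnorm k g)" by (intro mult_left_mono sqnorm_mvec_le_fro) auto
    also have "\<dots> = fro k k A * (\<Sum>i<k. 1 * (g i)\<^sup>2)\<^sup>2" by (simp add: sqnorm_def power2_eq_square)
    also have "\<dots> \<le> fro k k A * ((\<Sum>i<k. 1\<^sup>2) * (\<Sum>i<k. ((g i)\<^sup>2)\<^sup>2))"
      by (intro mult_left_mono Cauchy_Schwarz_ineq_sum) auto
    finally show ?thesis by simp
  qed
  then show "AE g in gauss {..<k}. norm ((inner_k k g (mvec k A g))\<^sup>2) \<le> norm (fro k k A * (real k * (\<Sum>i<k. (g i) ^ 4)))"
    by (intro AE_I2) (simp add: abs_of_nonneg order.trans[OF _ abs_ge_self])
qed

lemma gauss_integrable_qform: "integrable (gauss {..<k}) (\<lambda>g. inner_k k g (mvec k A g))"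
proof (rule finite_measure.square_integrable_imp_integrable)
  show "finite_measure (gauss {..<k})" using prob_space_gauss prob_space.finite_measure by blast
  show "(\<lambda>g. inner_k k g (mvec k A g)) \<in> borel_measurable (gauss {..<k})"
    by (rule measurable_qform_gauss)
qed (rule gauss_integrable_qform_sq)

text \<open>Isolates the last coordinate as the variable of a quadratic polynomial, ready to be
  integrated first.\<close>

lemma qform_Suc:
  assumes "sym_mat (Suc k) A"
  shows "inner_k (Suc k) (x(k := y)) (mvec (Suc k) A (x(k := y)))
    = inner_k k x (mvec k A x) + (2 * (\<Sum>j<k. A k j * x j)) * y + A k k * y\<^sup>2"
proof -
  have "(\<Sum>i<k. x i * (A i k * y)) = (\<Sum>j<k. A k j * x j) * y"
    unfolding sum_distrib_right using assms by (intro sum.cong refl) (simp add: sym_mat_def)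
  then show ?thesis
    by (simp add: inner_k_def mvec_def ring_distribs sum.distrib power2_eq_square mult_ac)
qed

lemma sym_mat_Suc: "sym_mat (Suc k) A \<Longrightarrow> sym_mat k A"
  by (simp add: sym_mat_def)

lemma gauss_linear_sq:
  fixes k :: nat
  shows "integrable (gauss {..<k}) (\<lambda>g. (\<Sum>j<k. a j * g j)\<^sup>2)"
    and "(\<integral>g. (\<Sum>j<k. a j * g j)\<^sup>2 \<partial>gauss {..<k}) = (\<Sum>j<k. (a j)\<^sup>2)"
proof -
  have m: "(\<lambda>g. (\<Sum>j<k. a j * g j)\<^sup>2) \<in> borel_measurable (gauss {..<k})"
    by (intro borel_measurable_power borel_measurable_sum borel_measurable_times borel_measurable_const gauss_coord_measurable)
  show "integrable (gauss {..<k}) (\<lambda>g. (\<Sum>j<k. a j * g j)\<^sup>2)"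
    by (rule integrableI_nonneg[OF m]) (auto simp: nn_integral_linear_sq)
  show "(\<integral>g. (\<Sum>j<k. a j * g j)\<^sup>2 \<partial>gauss {..<k}) = (\<Sum>j<k. (a j)\<^sup>2)"
    by (subst integral_eq_nn_integral[OF m]) (auto simp: nn_integral_linear_sq sum_nonneg)
qed

lemma gauss_qform_mean:
  "sym_mat k A \<Longrightarrow> (\<integral>g. inner_k k g (mvec k A g) \<partial>gauss {..<k}) = trace k A"
proof (induction k)
  case 0
  then show ?case by (simp add: inner_k_def trace_def)
next
  case (Suc k)
  have "(\<integral>g. inner_k (Suc k) g (mvec (Suc k) A g) \<partial>gauss {..<Suc k})
      = (\<integral>x. \<integral>y. inner_k (Suc k) (x(k := y)) (mvec (Suc k) A (x(k := y))) \<partial>std_normal_distribution \<partial>gauss {..<k})"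
    using gauss_integrable_qform[of "Suc k" A] unfolding lessThan_Suc
    by (subst PN.product_integral_insert) auto
  also have "\<dots> = (\<integral>x. inner_k k x (mvec k A x) + A k k \<partial>gauss {..<k})"
    unfolding qform_Suc[OF Suc.prems]
    using std_normal_integrable by (simp add: std_normal_moments SN.prob_space)
  also have "\<dots> = trace (Suc k) A"
    using gauss_integrable_qform[of k A] Suc.IH[OF sym_mat_Suc[OF Suc.prems]] prob_space.prob_space[OF prob_space_gauss[of "{..<k}"]]
    by (simp add: trace_def)
  finally show ?case .
qed

lemma gauss_qform_second_moment:
  "sym_mat k A \<Longrightarrow> (\<integral>g. (inner_k k g (mvec k A g))\<^sup>2 \<partial>gauss {..<k}) = (trace k A)\<^sup>2 + 2 * fro k k A"
proof (induction k)
  case 0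
  then show ?case by (simp add: inner_k_def trace_def fro_def)
next
  case (Suc k)
  note sym = sym_mat_Suc[OF Suc.prems]
  let ?l = "\<lambda>x. \<Sum>j<k. A k j * x j"
  have "(\<integral>g. (inner_k (Suc k) g (mvec (Suc k) A g))\<^sup>2 \<partial>gauss {..<Suc k})
      = (\<integral>x. \<integral>y. (inner_k (Suc k) (x(k := y)) (mvec (Suc k) A (x(k := y))))\<^sup>2 \<partial>std_normal_distribution \<partial>gauss {..<k})"
    using gauss_integrable_qform_sq[of "Suc k" A] unfolding lessThan_Suc
    by (subst PN.product_integral_insert) auto
  also have "\<dots> = (\<integral>x. (inner_k k x (mvec k A x))\<^sup>2 + 4 * (?l x)\<^sup>2 + 3 * (A k k)\<^sup>2
        + 2 * A k k * inner_k k x (mvec k A x) \<partial>gauss {..<k})"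
    unfolding qform_Suc[OF Suc.prems] std_normal_quadratic_sq by (simp add: power_mult_distrib mult_ac)
  also have "\<dots> = (\<integral>x. (inner_k k x (mvec k A x))\<^sup>2 \<partial>gauss {..<k}) + 4 * (\<integral>x. (?l x)\<^sup>2 \<partial>gauss {..<k})
        + 3 * (A k k)\<^sup>2 + 2 * A k k * (\<integral>x. inner_k k x (mvec k A x) \<partial>gauss {..<k})"
    using gauss_integrable_qform[of k A] gauss_integrable_qform_sq[of k A] gauss_linear_sq(1)[of k "A k"]
      prob_space.prob_space[OF prob_space_gauss[of "{..<k}"]]
    by simp
  also have "\<dots> = (trace k A)\<^sup>2 + 2 * fro k k A + 4 * (\<Sum>j<k. (A k j)\<^sup>2) + 3 * (A k k)\<^sup>2 + 2 * A k k * trace k A"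
    by (simp only: Suc.IH[OF sym] gauss_linear_sq(2) gauss_qform_mean[OF sym])
  also have "\<dots> = (trace (Suc k) A)\<^sup>2 + 2 * fro (Suc k) (Suc k) A"
  proof -
    \<comment> \<open>The new row and the new column contribute equally, which accounts for the
      coefficient 4 of the linear part.\<close>
    have "(\<Sum>i<k. (A i k)\<^sup>2) = (\<Sum>j<k. (A k j)\<^sup>2)" using Suc.prems by (simp add: sym_mat_def)
    then show ?thesis by (simp add: trace_def fro_def sum.distrib power2_sum)
  qed
  finally show ?case .
qed

lemma gauss_qform_lower_tail:
  assumes sym: "sym_mat k A" and t: "t > 0"
  shows "measure (gauss {..<k}) {g \<in> space (gauss {..<k}). inner_k k g (mvec k A g) < trace k A - t} \<le> 2 * fro k k A / t\<^sup>2"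
proof -
  let ?q = "\<lambda>g. inner_k k g (mvec k A g)"
  have m [measurable]: "?q \<in> borel_measurable (gauss {..<k})" using gauss_integrable_qform[of k A] by simp
  let ?\<gamma> = "gauss {..<k}"
  have "(\<integral>g. (?q g - trace k A)\<^sup>2 \<partial>?\<gamma>) = 2 * fro k k A"
    using prob_space.variance_eq[OF prob_space_gauss gauss_integrable_qform gauss_integrable_qform_sq, of k A]
    by (simp add: gauss_qform_mean[OF sym] gauss_qform_second_moment[OF sym])
  then have "measure ?\<gamma> {g \<in> space ?\<gamma>. t \<le> \<bar>?q g - trace k A\<bar>} \<le> 2 * fro k k A / t\<^sup>2"
    using prob_space.Chebyshev_inequality[OF prob_space_gauss m gauss_integrable_qform_sq t] by (simp add: gauss_qform_mean[OF sym])
  moreover have "measure ?\<gamma> {g \<in> space ?\<gamma>. ?q g < trace k A - t}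
      \<le> measure ?\<gamma> {g \<in> space ?\<gamma>. t \<le> \<bar>?q g - trace k A\<bar>}"
  proof (rule finite_measure.finite_measure_mono[OF prob_space.finite_measure[OF prob_space_gauss]])
    show "{g \<in> space ?\<gamma>. t \<le> \<bar>?q g - trace k A\<bar>} \<in> sets ?\<gamma>" using m by measurable
  qed auto
  ultimately show ?thesis by linarith
qed

section \<open>Change of measure, exponential moments and independence of rows\<close>

lemma gauss_shift:
  "f \<in> borel_measurable (gauss {..<k}) \<Longrightarrow> (\<integral>\<^sup>+g. f g \<partial>gauss {..<k})
    = (\<integral>\<^sup>+g. ennreal (exp (- inner_k k a g - sqnorm k a / 2)) * f (\<lambda>i\<in>{..<k}. g i + a i) \<partial>gauss {..<k})"
proof (induction k arbitrary: f)
  case 0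
  have "(\<lambda>i\<in>{..<0}. g i + a i) = g" if "g \<in> space (gauss {..<0})" for g :: "nat \<Rightarrow> real"
    using that by (auto simp: space_PiM restrict_def)
  then show ?case by (intro nn_integral_cong) (simp add: inner_k_def sqnorm_def)
next
  case (Suc k)
  let ?sh = "\<lambda>k (g::nat \<Rightarrow> real). \<lambda>i\<in>{..<k}. g i + a i"
  let ?E = "\<lambda>k (g::nat \<Rightarrow> real). ennreal (exp (- inner_k k a g - sqnorm k a / 2))"
  have f [measurable]: "f \<in> borel_measurable (gauss (insert k {..<k}))"
    using Suc.prems by (simp add: lessThan_Suc)
  have sh [measurable]: "?sh k \<in> measurable (gauss {..<k}) (gauss {..<k})" for k
    by (intro measurable_restrict) auto
  have E [measurable]: "?E k \<in> borel_measurable (gauss {..<k})" for k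
    by (intro measurable_compose[OF _ measurable_ennreal] measurable_compose[OF _ borel_measurable_exp]
        borel_measurable_diff borel_measurable_uminus borel_measurable_const) (rule measurable_inner_k; (simp | rule gauss_coord_measurable; simp))
  have upd [measurable]: "(\<lambda>(y, x). f (x(k := y))) \<in> borel_measurable (std_normal_distribution \<Otimes>\<^sub>M gauss {..<k})"
    using f by measurable
  have "(\<integral>\<^sup>+g. f g \<partial>gauss {..<Suc k}) = (\<integral>\<^sup>+y. (\<integral>\<^sup>+x. f (x(k := y)) \<partial>gauss {..<k}) \<partial>std_normal_distribution)"
    unfolding lessThan_Suc by (subst PN.product_nn_integral_insert_rev) auto
  \<comment> \<open>The first k coordinates are shifted by the induction hypothesis on each slice;
    the last one follows by \<open>std_normal_shift\<close>.\<close>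
  also have "\<dots> = (\<integral>\<^sup>+y. (\<integral>\<^sup>+x. ?E k x * f ((?sh k x)(k := y)) \<partial>gauss {..<k}) \<partial>std_normal_distribution)"
  proof (rule nn_integral_cong)
    fix y
    have "(\<lambda>x. f (x(k := y))) \<in> borel_measurable (gauss {..<k})"
      using measurable_Pair2[OF upd, of y] by simp
    then show "(\<integral>\<^sup>+x. f (x(k := y)) \<partial>gauss {..<k}) = (\<integral>\<^sup>+x. ?E k x * f ((?sh k x)(k := y)) \<partial>gauss {..<k})"
      by (rule Suc.IH)
  qed
  also have "\<dots> = (\<integral>\<^sup>+y. ennreal (exp (- a k * y - (a k)\<^sup>2 / 2)) *
      (\<integral>\<^sup>+x. ?E k x * f ((?sh k x)(k := y + a k)) \<partial>gauss {..<k}) \<partial>std_normal_distribution)"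
  proof (rule std_normal_shift)
    have "(\<lambda>y. \<integral>\<^sup>+x. ?E k x * f ((?sh k x)(k := y)) \<partial>gauss {..<k}) \<in> borel_measurable std_normal_distribution"
      by measurable
    then show "(\<lambda>y. \<integral>\<^sup>+x. ?E k x * f ((?sh k x)(k := y)) \<partial>gauss {..<k}) \<in> borel_measurable borel"
      by (simp add: measurable_def)
  qed
  also have "\<dots> = (\<integral>\<^sup>+y. (\<integral>\<^sup>+x. ?E (Suc k) (x(k := y)) * f (?sh (Suc k) (x(k := y))) \<partial>gauss {..<k}) \<partial>std_normal_distribution)"
  proof (rule nn_integral_cong)
    fix y
    have [measurable]: "(\<lambda>x. f ((?sh k x)(k := y + a k))) \<in> borel_measurable (gauss {..<k})"
      using measurable_compose[OF sh measurable_Pair2[OF upd, of "y + a k"]] by simp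
    have meas: "(\<lambda>x. ?E k x * f ((?sh k x)(k := y + a k))) \<in> borel_measurable (gauss {..<k})"
      by measurable
    have eq: "ennreal (exp (- a k * y - (a k)\<^sup>2 / 2)) * (?E k x * f ((?sh k x)(k := y + a k)))
        = ?E (Suc k) (x(k := y)) * f (?sh (Suc k) (x(k := y)))" for x
    proof -
      have "exp (- a k * y - (a k)\<^sup>2 / 2) * exp (- inner_k k a x - sqnorm k a / 2)
          = exp (- inner_k (Suc k) a (x(k := y)) - sqnorm (Suc k) a / 2)"
        by (simp add: inner_k_def sqnorm_def algebra_simps add_divide_distrib flip: exp_add)
      then have e1: "ennreal (exp (- a k * y - (a k)\<^sup>2 / 2)) * ?E k x = ?E (Suc k) (x(k := y))"
        by (simp flip: ennreal_mult')
      have e2: "(?sh k x)(k := y + a k) = ?sh (Suc k) (x(k := y))" by (auto simp: restrict_def)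
      show ?thesis by (simp only: mult.assoc[symmetric] e1 e2)
    qed
    show "ennreal (exp (- a k * y - (a k)\<^sup>2 / 2)) * (\<integral>\<^sup>+x. ?E k x * f ((?sh k x)(k := y + a k)) \<partial>gauss {..<k})
      = (\<integral>\<^sup>+x. ?E (Suc k) (x(k := y)) * f (?sh (Suc k) (x(k := y))) \<partial>gauss {..<k})"
      unfolding nn_integral_cmult[OF meas, symmetric] by (simp only: eq)
  qed
  also have "\<dots> = (\<integral>\<^sup>+g. ?E (Suc k) g * f (?sh (Suc k) g) \<partial>gauss {..<Suc k})"
  proof -
    have "(\<lambda>g. ?E (Suc k) g * f (?sh (Suc k) g)) \<in> borel_measurable (gauss {..<Suc k})"
      using measurable_compose[OF sh[of "Suc k"] Suc.prems] E[of "Suc k"] by measurable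
    then show ?thesis unfolding lessThan_Suc
      by (subst PN.product_nn_integral_insert_rev) (auto simp: lessThan_Suc)
  qed
  finally show ?case .
qed

text \<open>The induction needs every s, because integrating out the last coordinate turns s into
  s'. The normalising factors telescope: (1 + s' |v|^2) (1 + s (v k)^2) is 1 + s times the full
  squared norm.\<close>

lemma nn_integral_exp_linear_sq:
  fixes k :: nat
  shows "0 \<le> s \<Longrightarrow> (\<integral>\<^sup>+g. ennreal (exp (- s * (\<Sum>j<k. v j * g j)\<^sup>2 / 2)) \<partial>gauss {..<k})
    = ennreal (1 / sqrt (1 + s * sqnorm k v))"
proof (induction k arbitrary: s)
  case 0
  show ?case by (simp add: sqnorm_def)
next
  case (Suc k)
  define s' where "s' = s / (1 + s * (v k)\<^sup>2)"
  have w: "1 + s * (v k)\<^sup>2 > 0" using Suc.prems by (simp add: add_pos_nonneg)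
  have s': "0 \<le> s'" using Suc.prems w by (simp add: s'_def)
  have "(\<integral>\<^sup>+g. ennreal (exp (- s * (\<Sum>j<Suc k. v j * g j)\<^sup>2 / 2)) \<partial>gauss {..<Suc k})
     = (\<integral>\<^sup>+x. (\<integral>\<^sup>+y. ennreal (exp (- s * (\<Sum>j<Suc k. v j * (x(k := y)) j)\<^sup>2 / 2)) \<partial>std_normal_distribution) \<partial>gauss {..<k})"
    unfolding lessThan_Suc by (subst PN.product_nn_integral_insert) auto
  also have "\<dots> = (\<integral>\<^sup>+x. ennreal (exp (- s' * (\<Sum>j<k. v j * x j)\<^sup>2 / 2)) * ennreal (1 / sqrt (1 + s * (v k)\<^sup>2)) \<partial>gauss {..<k})"
  proof (rule nn_integral_cong)
    fix x :: "nat \<Rightarrow> real"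
    have "(\<integral>\<^sup>+y. ennreal (exp (- s * (\<Sum>j<Suc k. v j * (x(k := y)) j)\<^sup>2 / 2)) \<partial>std_normal_distribution)
       = (\<integral>\<^sup>+y. ennreal (exp (- s * ((\<Sum>j<k. v j * x j) + v k * y)\<^sup>2 / 2)) \<partial>std_normal_distribution)"
      by (intro nn_integral_cong) simp
    also have "\<dots> = ennreal (exp (- s' * (\<Sum>j<k. v j * x j)\<^sup>2 / 2) / sqrt (1 + s * (v k)\<^sup>2))"
      unfolding s'_def by (rule std_normal_exp_square[OF Suc.prems])
    also have "\<dots> = ennreal (exp (- s' * (\<Sum>j<k. v j * x j)\<^sup>2 / 2)) * ennreal (1 / sqrt (1 + s * (v k)\<^sup>2))"
      by (simp flip: ennreal_mult')
    finally show "(\<integral>\<^sup>+y. ennreal (exp (- s * (\<Sum>j<Suc k. v j * (x(k := y)) j)\<^sup>2 / 2)) \<partial>std_normal_distribution)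
      = ennreal (exp (- s' * (\<Sum>j<k. v j * x j)\<^sup>2 / 2)) * ennreal (1 / sqrt (1 + s * (v k)\<^sup>2))" .
  qed
  also have "\<dots> = ennreal (1 / sqrt (1 + s' * sqnorm k v)) * ennreal (1 / sqrt (1 + s * (v k)\<^sup>2))"
    by (subst nn_integral_multc) (auto simp: Suc.IH[OF s', simplified])
  also have "\<dots> = ennreal (1 / sqrt (1 + s' * sqnorm k v) * (1 / sqrt (1 + s * (v k)\<^sup>2)))"
    by (rule ennreal_mult'[symmetric]) (use w s' in auto)
  also have "1 / sqrt (1 + s' * sqnorm k v) * (1 / sqrt (1 + s * (v k)\<^sup>2)) = 1 / sqrt (1 + s * sqnorm (Suc k) v)"
  proof -
    have "(1 + s' * sqnorm k v) * (1 + s * (v k)\<^sup>2) = 1 + s * sqnorm (Suc k) v"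
      using w by (simp add: s'_def sqnorm_def field_simps)
    then show ?thesis by (simp flip: real_sqrt_mult)
  qed
  finally show ?case .
qed

text \<open>Independence of row i from the others in Fubini form: a functional that sees G only
  through the other rows may be fed a fresh Gaussian row instead of row i. All conditional estimates
  below are instances.\<close>

lemma resample_row:
  fixes F :: "(nat \<times> nat \<Rightarrow> real) \<Rightarrow> (nat \<Rightarrow> real) \<Rightarrow> ennreal"
  assumes i: "i < n"
    and F [measurable]: "(\<lambda>(G, h). F G h) \<in> borel_measurable (gauss ({..<n} \<times> {..<d}) \<Otimes>\<^sub>M gauss {..<d})"
    and indep: "\<And>G G' h. (\<And>l k. l \<noteq> i \<Longrightarrow> G (l, k) = G' (l, k)) \<Longrightarrow> F G h = F G' h"
  shows "(\<integral>\<^sup>+G. F G (\<lambda>k\<in>{..<d}. G (i, k)) \<partial>gauss ({..<n} \<times> {..<d}))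
    = (\<integral>\<^sup>+G. \<integral>\<^sup>+h. F G h \<partial>gauss {..<d} \<partial>gauss ({..<n} \<times> {..<d}))"
proof -
  define I where "I = ({..<n} - {i}) \<times> {..<d}"
  define J where "J = {i} \<times> {..<d}"
  have IJ: "I \<inter> J = {}" "finite I" "finite J" "I \<union> J = {..<n} \<times> {..<d}"
    using i by (auto simp: I_def J_def)
  \<comment> \<open>Merging alters only row i, which F ignores. At indices outside the grid both
    functions are \<open>undefined\<close>, by extensionality of x.\<close>
  have m: "F (merge I J (x, y)) = F x" if "x \<in> space (gauss I)" for x y
  proof
    fix h
    show "F (merge I J (x, y)) h = F x h"
    proof (rule indep)
      fix l k assume "l \<noteq> i"
      then show "merge I J (x, y) (l, k) = x (l, k)"
        using that by (auto simp: merge_def I_def J_def space_PiM PiE_def extensional_def)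
    qed
  qed
  have row: "(\<lambda>G. \<lambda>k\<in>{..<d}. G (i, k)) \<in> measurable (gauss ({..<n} \<times> {..<d})) (gauss {..<d})"
    using i by (intro measurable_restrict) auto
  have meas1: "(\<lambda>G. F G (\<lambda>k\<in>{..<d}. G (i, k))) \<in> borel_measurable (gauss (I \<union> J))"
    unfolding IJ(4) using measurable_compose[OF measurable_Pair[OF measurable_ident row] F] by simp
  have meas2: "(\<lambda>G. \<integral>\<^sup>+h. F G h \<partial>gauss {..<d}) \<in> borel_measurable (gauss (I \<union> J))"
    unfolding IJ(4) by measurable
  have Fx: "F x \<in> borel_measurable (gauss {..<d})" if x: "x \<in> space (gauss I)" for x
  proof -
    \<comment> \<open>Any completion of x to a point of the full product space transfers
      measurability in h to F x.\<close>
    obtain y where "y \<in> space (gauss J)" using prob_space.not_empty[OF prob_space_gauss[of J]] by blast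
    then have "merge I J (x, y) \<in> space (gauss ({..<n} \<times> {..<d}))"
      using x IJ measurable_space[OF measurable_merge[of I J "\<lambda>_. std_normal_distribution"], of "(x, y)"]
      by (simp add: space_pair_measure)
    then have "(\<lambda>h. F (merge I J (x, y)) h) \<in> borel_measurable (gauss {..<d})"
      using measurable_Pair2[OF F] by simp
    then show ?thesis using m[OF x] by simp
  qed
  have re: "distr (gauss J) (gauss {..<d}) (\<lambda>\<omega>. \<lambda>k\<in>{..<d}. \<omega> (i, k)) = gauss {..<d}"
    using distr_PiM_reindex[of J "\<lambda>_. std_normal_distribution" "\<lambda>k. (i, k)" "{..<d}"]
    by (auto simp: J_def inj_on_def prob_space_std_normal)
  have "(\<integral>\<^sup>+G. F G (\<lambda>k\<in>{..<d}. G (i, k)) \<partial>gauss ({..<n} \<times> {..<d}))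
      = (\<integral>\<^sup>+x. \<integral>\<^sup>+y. F (merge I J (x, y)) (\<lambda>k\<in>{..<d}. merge I J (x, y) (i, k)) \<partial>gauss J \<partial>gauss I)"
    using PN.product_nn_integral_fold[OF IJ(1-3) meas1] IJ(4) by simp
  also have "\<dots> = (\<integral>\<^sup>+x. \<integral>\<^sup>+h. F x h \<partial>gauss {..<d} \<partial>gauss I)"
  proof (rule nn_integral_cong)
    fix x assume x: "x \<in> space (gauss I)"
    have "(\<integral>\<^sup>+y. F (merge I J (x, y)) (\<lambda>k\<in>{..<d}. merge I J (x, y) (i, k)) \<partial>gauss J)
        = (\<integral>\<^sup>+y. F x (\<lambda>k\<in>{..<d}. y (i, k)) \<partial>gauss J)"
      unfolding m[OF x] by (intro nn_integral_cong arg_cong[of _ _ "F x"]) (auto simp: merge_def I_def J_def)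
    also have "\<dots> = (\<integral>\<^sup>+h. F x h \<partial>distr (gauss J) (gauss {..<d}) (\<lambda>\<omega>. \<lambda>k\<in>{..<d}. \<omega> (i, k)))"
      by (subst nn_integral_distr) (auto intro!: Fx x measurable_restrict simp: J_def)
    finally show "(\<integral>\<^sup>+y. F (merge I J (x, y)) (\<lambda>k\<in>{..<d}. merge I J (x, y) (i, k)) \<partial>gauss J)
      = (\<integral>\<^sup>+h. F x h \<partial>gauss {..<d})" unfolding re .
  qed
  also have "\<dots> = (\<integral>\<^sup>+x. \<integral>\<^sup>+y. \<integral>\<^sup>+h. F (merge I J (x, y)) h \<partial>gauss {..<d} \<partial>gauss J \<partial>gauss I)"
    by (intro nn_integral_cong) (simp add: m)
  also have "\<dots> = (\<integral>\<^sup>+G. \<integral>\<^sup>+h. F G h \<partial>gauss {..<d} \<partial>gauss ({..<n} \<times> {..<d}))"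
    using PN.product_nn_integral_fold[OF IJ(1-3) meas2] IJ(4) by simp
  finally show ?thesis .
qed

section \<open>Null vectors of a Gaussian matrix\<close>

lemma markov_measure:
  assumes "finite_measure M" and [measurable]: "f \<in> borel_measurable M"
    and le: "(\<integral>\<^sup>+x. ennreal (f x) \<partial>M) \<le> ennreal m" and "0 \<le> m" "0 < c"
  shows "measure M {x \<in> space M. c \<le> f x} \<le> m / c"
proof -
  interpret finite_measure M by fact
  have "{x \<in> space M. c \<le> f x} = {x \<in> space M. 1 \<le> ennreal (1 / c) * ennreal (f x)}"
  proof (intro Collect_cong conj_cong refl)
    fix x
    have "1 \<le> ennreal (1 / c) * ennreal (f x) \<longleftrightarrow> ennreal 1 \<le> ennreal (f x / c)"
      using \<open>0 < c\<close> by (simp flip: ennreal_mult')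
    \<comment> \<open>Negative values of f are truncated to 0 by \<open>ennreal\<close>, which is
      harmless because c > 0.\<close>
    also have "\<dots> \<longleftrightarrow> c \<le> f x"
      using \<open>0 < c\<close> by (cases "0 \<le> f x") (auto simp: ennreal_le_iff2 field_simps)
    finally show "c \<le> f x \<longleftrightarrow> 1 \<le> ennreal (1 / c) * ennreal (f x)" by simp
  qed
  then have "emeasure M {x \<in> space M. c \<le> f x} \<le> ennreal (1 / c) * (\<integral>\<^sup>+x. ennreal (f x) * indicator (space M) x \<partial>M)"
    using nn_integral_Markov_inequality[where u = "\<lambda>x. ennreal (f x)" and M = M and A = "space M" and c = "ennreal (1 / c)"] by simp
  also have "\<dots> = ennreal (1 / c) * (\<integral>\<^sup>+x. ennreal (f x) \<partial>M)"
    by (intro arg_cong2[where f = "(*)"] refl nn_integral_cong) auto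
  also have "\<dots> \<le> ennreal (1 / c) * ennreal m" by (intro mult_left_mono le) auto
  also have "\<dots> = ennreal (m / c)" using \<open>0 < c\<close> \<open>0 \<le> m\<close> by (simp flip: ennreal_mult')
  finally show ?thesis
    using \<open>0 < c\<close> \<open>0 \<le> m\<close> by (simp add: emeasure_eq_measure ennreal_le_iff)
qed

definition rowv :: "nat \<Rightarrow> (nat \<times> nat \<Rightarrow> real) \<Rightarrow> nat \<Rightarrow> nat \<Rightarrow> real" where
  "rowv d G i = (\<lambda>k\<in>{..<d}. G (i, k))"

lemma rowv_cong: "(\<And>k. G (i, k) = G' (i, k)) \<Longrightarrow> rowv d G i = rowv d G' i"
  by (simp add: rowv_def)

lemma measurable_row_entry:
  "i < n \<Longrightarrow> k < d \<Longrightarrow> (\<lambda>G. rowv d G i k) \<in> borel_measurable (gauss ({..<n} \<times> {..<d}))"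
  by (simp add: rowv_def gauss_coord_measurable)

lemma measurable_row: "i < n \<Longrightarrow> (\<lambda>G. rowv d G i) \<in> measurable (gauss ({..<n} \<times> {..<d})) (gauss {..<d})"
  unfolding rowv_def by (intro measurable_restrict) (auto intro!: measurable_component_singleton)

lemma measurable_mvec:
  assumes "\<And>j. j < k \<Longrightarrow> (\<lambda>x. A x i j) \<in> borel_measurable M" "\<And>j. j < k \<Longrightarrow> (\<lambda>x. v x j) \<in> borel_measurable M"
  shows "(\<lambda>x. mvec k (A x) (v x) i) \<in> borel_measurable M"
  unfolding mvec_def by (rule borel_measurable_sum, rule borel_measurable_times; rule assms; simp)

lemma measurable_sqnorm:
  assumes "\<And>j. j < k \<Longrightarrow> (\<lambda>x. v x j) \<in> borel_measurable M"
  shows "(\<lambda>x. sqnorm k (v x)) \<in> borel_measurable M"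
  unfolding sqnorm_def by (rule borel_measurable_sum, rule borel_measurable_power, rule assms, simp)

lemma measurable_fro:
  assumes "\<And>i j. i < m \<Longrightarrow> j < k \<Longrightarrow> (\<lambda>x. A x i j) \<in> borel_measurable M"
  shows "(\<lambda>x. fro m k (A x)) \<in> borel_measurable M"
  unfolding fro_def by (rule borel_measurable_sum, rule borel_measurable_sum, rule borel_measurable_power, rule assms) auto

lemma measurable_snd_coord:
  "j \<in> I \<Longrightarrow> (\<lambda>x. snd x j) \<in> borel_measurable (N \<Otimes>\<^sub>M gauss I)"
  by (intro measurable_compose[OF measurable_snd gauss_coord_measurable])

text \<open>The rows are independent and identically distributed; the product is factored by
  resampling one row at a time.\<close>

lemma nn_integral_prod_rows:
  assumes \<psi>: "\<psi> \<in> borel_measurable (gauss {..<d})" and "R \<subseteq> {..<n}"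
  shows "(\<integral>\<^sup>+G. (\<Prod>i\<in>R. \<psi> (rowv d G i)) \<partial>gauss ({..<n} \<times> {..<d})) = (\<integral>\<^sup>+h. \<psi> h \<partial>gauss {..<d}) ^ card R"
proof -
  have "finite R" using assms(2) finite_subset by blast
  then show ?thesis using assms(2)
  proof (induction R rule: finite_induct)
    case empty
    show ?case by simp
  next
    case (insert i R)
    let ?F = "\<lambda>G h. (\<Prod>l\<in>R. \<psi> (rowv d G l)) * \<psi> h"
    have prod: "(\<lambda>G. \<Prod>l\<in>R. \<psi> (rowv d G l)) \<in> borel_measurable (gauss ({..<n} \<times> {..<d}))"
      using insert.prems
      by (intro borel_measurable_prod_ennreal measurable_compose[OF measurable_row \<psi>]) auto
    have "(\<lambda>x. (\<Prod>l\<in>R. \<psi> (rowv d (fst x) l)) * \<psi> (snd x))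
        \<in> borel_measurable (gauss ({..<n} \<times> {..<d}) \<Otimes>\<^sub>M gauss {..<d})"
      by (intro borel_measurable_times_ennreal measurable_compose[OF measurable_fst prod]
          measurable_compose[OF measurable_snd \<psi>])
    then have F: "(\<lambda>(G, h). ?F G h) \<in> borel_measurable (gauss ({..<n} \<times> {..<d}) \<Otimes>\<^sub>M gauss {..<d})"
      by (simp add: case_prod_unfold)
    have "(\<integral>\<^sup>+G. (\<Prod>l\<in>insert i R. \<psi> (rowv d G l)) \<partial>gauss ({..<n} \<times> {..<d}))
        = (\<integral>\<^sup>+G. ?F G (\<lambda>k\<in>{..<d}. G (i, k)) \<partial>gauss ({..<n} \<times> {..<d}))"
      using insert.hyps by (simp add: rowv_def mult.commute)
    also have "\<dots> = (\<integral>\<^sup>+G. \<integral>\<^sup>+h. ?F G h \<partial>gauss {..<d} \<partial>gauss ({..<n} \<times> {..<d}))"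
    proof (rule resample_row[OF _ F])
      fix G G' :: "nat \<times> nat \<Rightarrow> real" and h
      assume *: "\<And>l k. l \<noteq> i \<Longrightarrow> G (l, k) = G' (l, k)"
      have "rowv d G l = rowv d G' l" if "l \<in> R" for l
        using that insert.hyps by (intro rowv_cong *) auto
      then show "?F G h = ?F G' h" by simp
    qed (use insert.prems in simp)
    also have "\<dots> = (\<integral>\<^sup>+h. \<psi> h \<partial>gauss {..<d}) * (\<integral>\<^sup>+G. (\<Prod>l\<in>R. \<psi> (rowv d G l)) \<partial>gauss ({..<n} \<times> {..<d}))"
      by (simp only: nn_integral_cmult[OF \<psi>] nn_integral_multc[OF prod]) (rule mult.commute)
    also have "\<dots> = (\<integral>\<^sup>+h. \<psi> h \<partial>gauss {..<d}) ^ card (insert i R)"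
      using insert by simp
    finally show ?case .
  qed
qed

text \<open>Exponential weight averaged over \<open>v = L h\<close>, \<open>h\<close> standard normal. Since \<open>E exp (- (g \<bullet> v)\<^sup>2 / 2) = (1 + |v|\<^sup>2) powr (-1/2)\<close>
  for a standard normal \<open>g\<close>, its mean over the matrix is 1; a null vector \<open>v = L a\<close> of the matrix
  would make it exponentially large, as is seen by shifting \<open>h\<close> by \<open>a\<close>.\<close>
definition expweight :: "nat \<Rightarrow> nat set \<Rightarrow> (nat \<Rightarrow> nat \<Rightarrow> real) \<Rightarrow> (nat \<times> nat \<Rightarrow> real) \<Rightarrow> (nat \<Rightarrow> real) \<Rightarrow> real" where
  "expweight d R L G h =
     (\<Prod>i\<in>R. exp (- (inner_k d (rowv d G i) (mvec d L h))\<^sup>2 / 2) * sqrt (1 + sqnorm d (mvec d L h)))"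

definition avgweight :: "nat \<Rightarrow> nat set \<Rightarrow> (nat \<Rightarrow> nat \<Rightarrow> real) \<Rightarrow> (nat \<times> nat \<Rightarrow> real) \<Rightarrow> ennreal" where
  "avgweight d R L G = (\<integral>\<^sup>+h. ennreal (expweight d R L G h) \<partial>gauss {..<d})"

lemma measurable_expweight:
  assumes "R \<subseteq> {..<n}"
  shows "(\<lambda>x. ennreal (expweight d R L (fst x) (snd x))) \<in> borel_measurable (gauss ({..<n} \<times> {..<d}) \<Otimes>\<^sub>M gauss {..<d})"
proof -
  let ?M = "gauss ({..<n} \<times> {..<d}) \<Otimes>\<^sub>M gauss {..<d}"
  have v: "(\<lambda>x. mvec d L (snd x) i) \<in> borel_measurable ?M" for i
    by (rule measurable_compose[OF measurable_snd measurable_mvec_gauss])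
  have r: "(\<lambda>x. rowv d (fst x) i k) \<in> borel_measurable ?M" if "i \<in> R" "k < d" for i k
    using that assms by (intro measurable_compose[OF measurable_fst measurable_row_entry]) auto
  have [measurable]: "(\<lambda>x. inner_k d (rowv d (fst x) i) (mvec d L (snd x))) \<in> borel_measurable ?M" if "i \<in> R" for i
    using that by (intro measurable_inner_k v r)
  have [measurable]: "(\<lambda>x. sqnorm d (mvec d L (snd x))) \<in> borel_measurable ?M"
    by (intro measurable_sqnorm v)
  show ?thesis unfolding expweight_def by measurable
qed

lemma measurable_avgweight:
  assumes "R \<subseteq> {..<n}"
  shows "avgweight d R L \<in> borel_measurable (gauss ({..<n} \<times> {..<d}))"
proof -
  have "(\<lambda>(G, h). ennreal (expweight d R L G h)) \<in> borel_measurable (gauss ({..<n} \<times> {..<d}) \<Otimes>\<^sub>M gauss {..<d})"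
    using measurable_expweight[OF assms, of d L] by (simp add: case_prod_unfold)
  then show ?thesis
    unfolding avgweight_def
    by (intro sigma_finite_measure.borel_measurable_nn_integral
        finite_measure.axioms(1) prob_space.finite_measure prob_space_gauss)
qed

lemma nn_integral_avgweight:
  assumes "R \<subseteq> {..<n}"
  shows "(\<integral>\<^sup>+G. avgweight d R L G \<partial>gauss ({..<n} \<times> {..<d})) = 1"
proof -
  interpret P: pair_sigma_finite "gauss ({..<n} \<times> {..<d})" "gauss {..<d}"
    by (intro pair_sigma_finite.intro finite_measure.axioms(1) prob_space.finite_measure prob_space_gauss)
  have "(\<integral>\<^sup>+G. avgweight d R L G \<partial>gauss ({..<n} \<times> {..<d}))
      = (\<integral>\<^sup>+h. \<integral>\<^sup>+G. ennreal (expweight d R L G h) \<partial>gauss ({..<n} \<times> {..<d}) \<partial>gauss {..<d})"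
    unfolding avgweight_def
    using P.Fubini'[of "\<lambda>G h. ennreal (expweight d R L G h)"] measurable_expweight[OF assms, of d L]
    by (simp add: case_prod_unfold)
  also have "\<dots> = (\<integral>\<^sup>+h. 1 \<partial>gauss {..<d})"
  proof (rule nn_integral_cong)
    fix h :: "nat \<Rightarrow> real"
    let ?v = "mvec d L h"
    let ?c = "sqrt (1 + sqnorm d ?v)"
    have c: "?c > 0" by (simp add: add_pos_nonneg)
    let ?\<psi> = "\<lambda>g. ennreal (exp (- 1 * (\<Sum>j<d. ?v j * g j)\<^sup>2 / 2))"
    have lin: "(\<lambda>g. \<Sum>j<d. ?v j * g j) \<in> borel_measurable (gauss {..<d})"
      by (intro borel_measurable_sum borel_measurable_times borel_measurable_const gauss_coord_measurable)
    have \<psi>: "?\<psi> \<in> borel_measurable (gauss {..<d})" using lin by measurable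
    have \<psi>i: "(\<integral>\<^sup>+g. ?\<psi> g \<partial>gauss {..<d}) = ennreal (1 / ?c)"
      using nn_integral_exp_linear_sq[of 1 d ?v] by simp
    have "ennreal (expweight d R L G h) = (\<Prod>i\<in>R. ?\<psi> (rowv d G i) * ennreal ?c)" for G
    proof -
      have "(\<Prod>i\<in>R. ?\<psi> (rowv d G i) * ennreal ?c)
          = (\<Prod>i\<in>R. ennreal (exp (- (inner_k d (rowv d G i) ?v)\<^sup>2 / 2) * ?c))"
        using c by (intro prod.cong refl) (simp add: inner_k_def mult.commute flip: ennreal_mult')
      also have "\<dots> = ennreal (expweight d R L G h)"
        unfolding expweight_def using c by (intro prod_ennreal mult_nonneg_nonneg) auto
      finally show ?thesis by simp
    qed
    then have "(\<integral>\<^sup>+G. ennreal (expweight d R L G h) \<partial>gauss ({..<n} \<times> {..<d}))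
        = (\<integral>\<^sup>+g. ?\<psi> g * ennreal ?c \<partial>gauss {..<d}) ^ card R"
      using nn_integral_prod_rows[OF borel_measurable_times_ennreal[OF \<psi> borel_measurable_const[of "ennreal ?c"]] assms]
      by simp
    also have "(\<integral>\<^sup>+g. ?\<psi> g * ennreal ?c \<partial>gauss {..<d}) = ennreal (1 / ?c) * ennreal ?c"
      unfolding nn_integral_multc[OF \<psi>] \<psi>i ..
    also have "\<dots> = 1" using c by (simp flip: ennreal_mult')
    finally show "(\<integral>\<^sup>+G. ennreal (expweight d R L G h) \<partial>gauss ({..<n} \<times> {..<d})) = 1" by simp
  qed
  also have "\<dots> = 1" by simp
  finally show ?thesis .
qed

text \<open>The product G L. Its squared Frobenius norm is the mean of |G L h|^2 over a standard
  normal h.\<close>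

definition rowmat :: "nat \<Rightarrow> (nat \<times> nat \<Rightarrow> real) \<Rightarrow> (nat \<Rightarrow> nat \<Rightarrow> real) \<Rightarrow> nat \<Rightarrow> nat \<Rightarrow> real" where
  "rowmat d G L = (\<lambda>i j. inner_k d (rowv d G i) (\<lambda>k. L k j))"

lemma mvec_rowmat: "mvec d (rowmat d G L) h i = inner_k d (rowv d G i) (mvec d L h)"
  unfolding mvec_def rowmat_def inner_k_def sum_distrib_left sum_distrib_right
  by (subst sum.swap) (simp add: mult.assoc)

text \<open>Three Markov bounds: the means are at most N, r^2 and 1/32, the thresholds are 8 N, 9
  r^2 and 1/4. The failure probability is at most 1/8 + 1/9 + 1/8 < 1/2.\<close>

lemma gauss_good_directions:
  assumes N: "fro n d (rowmat d G L) \<le> N" "0 < N" and r: "sqnorm d a \<le> r\<^sup>2" "0 < r" and L: "fro d d L \<le> 1 / 32"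
  shows "1 / 2 \<le> measure (gauss {..<d}) {h \<in> space (gauss {..<d}).
      sqnorm n (mvec d (rowmat d G L) h) < 8 * N \<and> \<bar>inner_k d a h\<bar> < 3 * r \<and> sqnorm d (mvec d L h) < 1 / 4}"
proof -
  let ?\<gamma> = "gauss {..<d}"
  have fm: "finite_measure ?\<gamma>" by (rule prob_space.finite_measure[OF prob_space_gauss])
  have m1: "(\<lambda>h. sqnorm n (mvec d (rowmat d G L) h)) \<in> borel_measurable ?\<gamma>"
    by (intro measurable_sqnorm measurable_mvec_gauss)
  have m2: "(\<lambda>h. inner_k d a h) \<in> borel_measurable ?\<gamma>"
    by (rule measurable_inner_k) (auto intro: gauss_coord_measurable)
  have m3: "(\<lambda>h. sqnorm d (mvec d L h)) \<in> borel_measurable ?\<gamma>"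
    by (intro measurable_sqnorm measurable_mvec_gauss)
  let ?A = "{h \<in> space ?\<gamma>. 8 * N \<le> sqnorm n (mvec d (rowmat d G L) h)}"
  let ?B = "{h \<in> space ?\<gamma>. 9 * r\<^sup>2 \<le> (inner_k d a h)\<^sup>2}"
  let ?C = "{h \<in> space ?\<gamma>. 1 / 4 \<le> sqnorm d (mvec d L h)}"
  let ?D = "{h \<in> space ?\<gamma>. sqnorm n (mvec d (rowmat d G L) h) < 8 * N \<and> \<bar>inner_k d a h\<bar> < 3 * r \<and> sqnorm d (mvec d L h) < 1 / 4}"
  have sets: "?A \<in> sets ?\<gamma>" "?B \<in> sets ?\<gamma>" "?C \<in> sets ?\<gamma>" "?D \<in> sets ?\<gamma>"
    using m1 m2 m3 by measurable
  have "measure ?\<gamma> ?A \<le> fro n d (rowmat d G L) / (8 * N)"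
    using m1 N by (intro markov_measure fm) (auto simp: nn_integral_sqnorm_mvec)
  also have "\<dots> \<le> 1 / 8" using N by (simp add: field_simps)
  finally have A: "measure ?\<gamma> ?A \<le> 1 / 8" .
  have "measure ?\<gamma> ?B \<le> sqnorm d a / (9 * r\<^sup>2)"
  proof (intro markov_measure fm)
    show "(\<integral>\<^sup>+h. ennreal ((inner_k d a h)\<^sup>2) \<partial>?\<gamma>) \<le> ennreal (sqnorm d a)"
      using nn_integral_linear_sq[of d a] by (simp add: inner_k_def sqnorm_def)
  qed (use m2 r in auto)
  also have "\<dots> \<le> 1 / 9" using r by (simp add: field_simps)
  finally have B: "measure ?\<gamma> ?B \<le> 1 / 9" .
  have "measure ?\<gamma> ?C \<le> fro d d L / (1 / 4)"
    using m3 by (intro markov_measure fm) (auto simp: nn_integral_sqnorm_mvec)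
  also have "\<dots> \<le> 1 / 8" using L by simp
  finally have C: "measure ?\<gamma> ?C \<le> 1 / 8" .
  have "space ?\<gamma> \<subseteq> ?D \<union> (?A \<union> (?B \<union> ?C))"
  proof
    fix h assume h: "h \<in> space ?\<gamma>"
    have "9 * r\<^sup>2 \<le> (inner_k d a h)\<^sup>2" if "\<not> \<bar>inner_k d a h\<bar> < 3 * r"
    proof -
      have "(3 * r)\<^sup>2 \<le> \<bar>inner_k d a h\<bar>\<^sup>2" using that r by (intro power_mono) auto
      then show ?thesis by (simp add: power_mult_distrib)
    qed
    then show "h \<in> ?D \<union> (?A \<union> (?B \<union> ?C))" using h by auto
  qed
  then have "measure ?\<gamma> (space ?\<gamma>) \<le> measure ?\<gamma> (?D \<union> (?A \<union> (?B \<union> ?C)))"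
    using sets by (intro finite_measure.finite_measure_mono[OF fm]) auto
  also have "\<dots> \<le> measure ?\<gamma> ?D + (measure ?\<gamma> ?A + (measure ?\<gamma> ?B + measure ?\<gamma> ?C))"
    using sets by (intro order.trans[OF measure_Un_le] add_left_mono order.refl) auto
  finally show ?thesis using A B C prob_space.prob_space[OF prob_space_gauss[of "{..<d}"]] by linarith
qed

text \<open>After shifting h by a, the rows in R still see only L h, as they annihilate L a, so the
  exponent stays above - 4 N on the good directions. Meanwhile |L (h + a)| \<ge> 1 - 1/2, so every
  row gains a factor sqrt (5/4). The shift itself costs exp (- 3 r - r^2 / 2), and the good
  directions have mass at least 1/2.\<close>

lemma avgweight_lower:
  assumes R: "R \<subseteq> {..<n}" and N: "fro n d (rowmat d G L) \<le> N" "0 < N" and r: "sqnorm d a \<le> r\<^sup>2" "0 < r"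
    and L: "fro d d L \<le> 1 / 32"
    and null: "\<And>i. i \<in> R \<Longrightarrow> inner_k d (rowv d G i) (mvec d L a) = 0" and unit: "sqnorm d (mvec d L a) = 1"
  shows "ennreal (exp (- 4 * N - 3 * r - r\<^sup>2 / 2) * sqrt (5 / 4) ^ card R / 2) \<le> avgweight d R L G"
proof -
  let ?\<gamma> = "gauss {..<d}"
  let ?sh = "\<lambda>h. \<lambda>i\<in>{..<d}. h i + a i"
  have finR: "finite R" using R finite_subset by blast
  let ?D = "{h \<in> space ?\<gamma>. sqnorm n (mvec d (rowmat d G L) h) < 8 * N \<and> \<bar>inner_k d a h\<bar> < 3 * r \<and> sqnorm d (mvec d L h) < 1 / 4}"
  let ?c = "exp (- 4 * N - 3 * r - r\<^sup>2 / 2) * sqrt (5 / 4) ^ card R"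
  have pw: "?c \<le> exp (- inner_k d a h - sqnorm d a / 2) * expweight d R L G (?sh h)" if h: "h \<in> ?D" for h
  proof -
    let ?v = "mvec d L h"
    have Lsh: "mvec d L (?sh h) = (\<lambda>i. ?v i + mvec d L a i)"
      unfolding mvec_add[symmetric] by (rule mvec_cong) simp
    let ?s = "sqnorm d (mvec d L (?sh h))"
    \<comment> \<open>The reverse triangle inequality: L a has norm 1 and L h has norm t \<le>
      1/2.\<close>
    have "(1 / 4) \<le> ?s"
    proof -
      define t where "t = sqrt (sqnorm d ?v)"
      have t: "t\<^sup>2 = sqnorm d ?v" "0 \<le> t" by (auto simp: t_def)
      have "t\<^sup>2 \<le> (1 / 2)\<^sup>2" using h t by (simp add: power2_eq_square)
      then have "t \<le> 1 / 2" by (rule power2_le_imp_le) simp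
      have "\<bar>inner_k d ?v (mvec d L a)\<bar> \<le> t"
        unfolding t_def by (rule real_le_rsqrt) (use Cauchy_Schwarz_inner_k[of d ?v "mvec d L a"] unit in simp)
      then have "?s \<ge> t\<^sup>2 - 2 * t + 1" unfolding Lsh sqnorm_add t(1) unit by linarith
      moreover have "t\<^sup>2 - 2 * t + 1 = (1 - t)\<^sup>2" by (simp add: power2_eq_square algebra_simps)
      moreover have "(1 / 2)\<^sup>2 \<le> (1 - t)\<^sup>2" using \<open>t \<le> 1 / 2\<close> by (intro power_mono) auto
      ultimately show ?thesis by (simp add: power2_eq_square)
    qed
    then have "sqrt (5 / 4) ^ card R \<le> (\<Prod>i\<in>R. sqrt (1 + ?s))" by (simp add: power_mono)
    moreover have "exp (- 4 * N) \<le> (\<Prod>i\<in>R. exp (- (inner_k d (rowv d G i) (mvec d L (?sh h)))\<^sup>2 / 2))"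
    proof -
      have "inner_k d (rowv d G i) (mvec d L (?sh h)) = mvec d (rowmat d G L) h i" if "i \<in> R" for i
        unfolding Lsh inner_k_linear mvec_rowmat using null[OF that] by simp
      then have "(\<Prod>i\<in>R. exp (- (inner_k d (rowv d G i) (mvec d L (?sh h)))\<^sup>2 / 2))
          = (\<Prod>i\<in>R. exp (- (mvec d (rowmat d G L) h i)\<^sup>2 / 2))" by simp
      also have "\<dots> = exp (\<Sum>i\<in>R. - (mvec d (rowmat d G L) h i)\<^sup>2 / 2)" by (simp add: exp_sum finR)
      also have "\<dots> \<ge> exp (- 4 * N)"
      proof -
        have "(\<Sum>i\<in>R. (mvec d (rowmat d G L) h i)\<^sup>2) \<le> sqnorm n (mvec d (rowmat d G L) h)"
          unfolding sqnorm_def using R by (intro sum_mono2) auto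
        also have "\<dots> \<le> 8 * N" using h by simp
        finally show ?thesis by (simp add: sum_negf flip: sum_divide_distrib)
      qed
      finally show ?thesis .
    qed
    ultimately have "exp (- 4 * N) * sqrt (5 / 4) ^ card R \<le> expweight d R L G (?sh h)"
      unfolding expweight_def prod.distrib by (intro mult_mono) (auto intro!: prod_nonneg)
    moreover have "exp (- 3 * r - r\<^sup>2 / 2) \<le> exp (- inner_k d a h - sqnorm d a / 2)"
      using h r by auto
    ultimately have "exp (- 3 * r - r\<^sup>2 / 2) * (exp (- 4 * N) * sqrt (5 / 4) ^ card R)
        \<le> exp (- inner_k d a h - sqnorm d a / 2) * expweight d R L G (?sh h)"
      by (intro mult_mono) auto
    moreover have "?c = exp (- 3 * r - r\<^sup>2 / 2) * (exp (- 4 * N) * sqrt (5 / 4) ^ card R)"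
      by (simp add: mult.assoc[symmetric] exp_add[symmetric])
    ultimately show ?thesis by simp
  qed
  have mexp: "(\<lambda>h. ennreal (expweight d R L G h)) \<in> borel_measurable ?\<gamma>"
  proof -
    have v: "(\<lambda>x. mvec d L x i) \<in> borel_measurable ?\<gamma>" for i by (rule measurable_mvec_gauss)
    have [measurable]: "(\<lambda>x. inner_k d (rowv d G i) (mvec d L x)) \<in> borel_measurable ?\<gamma>" for i
      by (intro measurable_inner_k v) auto
    have [measurable]: "(\<lambda>x. sqnorm d (mvec d L x)) \<in> borel_measurable ?\<gamma>" by (intro measurable_sqnorm v)
    show ?thesis unfolding expweight_def by measurable
  qed
  have setD: "?D \<in> sets ?\<gamma>"
  proof -
    have [measurable]: "(\<lambda>h. sqnorm n (mvec d (rowmat d G L) h)) \<in> borel_measurable ?\<gamma>"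
      by (intro measurable_sqnorm measurable_mvec_gauss)
    have [measurable]: "(\<lambda>h. inner_k d a h) \<in> borel_measurable ?\<gamma>"
      by (rule measurable_inner_k) (auto intro: gauss_coord_measurable)
    have [measurable]: "(\<lambda>h. sqnorm d (mvec d L h)) \<in> borel_measurable ?\<gamma>"
      by (intro measurable_sqnorm measurable_mvec_gauss)
    show ?thesis by measurable
  qed
  have "ennreal (?c / 2) \<le> ennreal (?c * measure ?\<gamma> ?D)"
    using gauss_good_directions[OF N r L] by (intro ennreal_leI) (simp add: mult_left_mono)
  also have "\<dots> = ennreal ?c * emeasure ?\<gamma> ?D"
    by (simp add: ennreal_mult' finite_measure.emeasure_eq_measure[OF prob_space.finite_measure[OF prob_space_gauss]])
  also have "\<dots> = (\<integral>\<^sup>+h. ennreal ?c * indicator ?D h \<partial>?\<gamma>)"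
    using setD by (simp add: nn_integral_cmult_indicator)
  also have "\<dots> \<le> (\<integral>\<^sup>+h. ennreal (exp (- inner_k d a h - sqnorm d a / 2)) * ennreal (expweight d R L G (?sh h)) \<partial>?\<gamma>)"
  proof (rule nn_integral_mono)
    fix h
    show "ennreal ?c * indicator ?D h \<le> ennreal (exp (- inner_k d a h - sqnorm d a / 2)) * ennreal (expweight d R L G (?sh h))"
      using pw[of h] by (cases "h \<in> ?D") (auto simp flip: ennreal_mult' intro: ennreal_leI)
  qed
  also have "\<dots> = avgweight d R L G" unfolding avgweight_def by (rule gauss_shift[OF mexp, symmetric])
  finally show ?thesis by simp
qed

text \<open>The numerical budget for N = r^2 = n / 100. The gain is at least (n - 1) / 10 in the
  exponent, the costs are n / 25, 3 sqrt n / 10, n / 200 and 1 for the factor 1/2. For n \<ge> 100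
  the surplus exceeds n / 100; there 3 sqrt n / 10 is at most 3 n / 100.\<close>

lemma exp_growth_contradiction:
  fixes n :: nat
  assumes n: "n \<ge> 100" and m: "m = n - 1"
  shows "exp (real n / 100) < exp (- 4 * (real n / 100) - 3 * (sqrt (real n) / 10) - (sqrt (real n) / 10)\<^sup>2 / 2) * sqrt (5 / 4) ^ m / 2"
proof -
  \<comment> \<open>From ln (4/5) \<le> 4/5 - 1; this yields exp (1/10) \<le> sqrt (5/4).\<close>
  have ln: "1 / 5 \<le> ln (5 / 4 :: real)" 
    using ln_le_minus_one[of "4/5 :: real"] by (simp add: ln_div)
  have s54: "exp (real m * (1 / 10)) \<le> sqrt (5 / 4) ^ m"
  proof -
    have "exp (1 / 10) \<le> sqrt (5 / 4 :: real)"
    proof (rule real_le_rsqrt)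
      have "(exp (1 / 10 :: real))\<^sup>2 = exp (1 / 5)" by (simp flip: exp_double)
      also have "\<dots> \<le> 5 / 4" using ln by (metis exp_le_cancel_iff exp_ln zero_less_divide_iff zero_less_numeral)
      finally show "(exp (1 / 10 :: real))\<^sup>2 \<le> 5 / 4" .
    qed
    then have "exp (1 / 10) ^ m \<le> sqrt (5 / 4 :: real) ^ m" by (intro power_mono) auto
    then show ?thesis unfolding exp_of_nat_mult .
  qed
  have half: "exp (- 1) \<le> (1 / 2 :: real)"
    using exp_ge_add_one_self[of "1::real"] by (simp add: exp_minus field_simps)
  define s where "s = sqrt (real n)"
  have s: "s \<ge> 10" "s * s = real n" using n real_sqrt_le_mono[of 100 "real n"] by (auto simp: s_def)
  have "10 * s \<le> s * s" using s by (intro mult_right_mono) auto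
  then have "real n / 100 < - 4 * (real n / 100) - 3 * (s / 10) - (s / 10)\<^sup>2 / 2 + real m * (1 / 10) - 1"
  proof -
    have "real n \<ge> 100" "real m = real n - 1" using n m by (simp_all add: of_nat_diff)
    moreover have "(s / 10)\<^sup>2 / 2 = real n / 200" using s by (simp add: power2_eq_square)
    ultimately show ?thesis using \<open>10 * s \<le> s * s\<close> s by linarith
  qed
  then have "exp (real n / 100) < exp (- 4 * (real n / 100) - 3 * (s / 10) - (s / 10)\<^sup>2 / 2 + real m * (1 / 10) + - 1)"
    by simp
  also have "\<dots> = exp (- 4 * (real n / 100) - 3 * (s / 10) - (s / 10)\<^sup>2 / 2) * exp (real m * (1 / 10)) * exp (- 1)"
    by (simp only: exp_add)
  also have "\<dots> \<le> exp (- 4 * (real n / 100) - 3 * (s / 10) - (s / 10)\<^sup>2 / 2) * sqrt (5 / 4) ^ m * (1 / 2)"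
    using s54 half by (intro mult_mono) auto
  finally show ?thesis by (simp add: s_def)
qed

section \<open>Leave-one-out analysis\<close>

text \<open>The recursion uses only sums, products and quotients of the input entries, so it is
  measurable at degenerate configurations as well.\<close>

lemma measurable_offp:
  assumes "\<And>x j. x \<in> set xs \<Longrightarrow> j < d \<Longrightarrow> (\<lambda>\<omega>. f \<omega> x j) \<in> borel_measurable M"
  shows "(\<lambda>\<omega>. offp d (map (f \<omega>) xs) a b) \<in> borel_measurable M"
  using assms
proof (induction xs arbitrary: a b)
  case Nil
  show ?case by simp
next
  case (Cons x xs)
  have IH: "(\<lambda>\<omega>. offp d (map (f \<omega>) xs) a b) \<in> borel_measurable M" for a b
    by (rule Cons.IH) (use Cons.prems in auto)
  have x: "(\<lambda>\<omega>. f \<omega> x j) \<in> borel_measurable M" if "j < d" for j using Cons.prems that by simp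
  have q: "(\<lambda>\<omega>. mvec d (offp d (map (f \<omega>) xs)) (f \<omega> x) i) \<in> borel_measurable M" for i
    by (rule measurable_mvec) (rule IH x; assumption?)+
  have D: "(\<lambda>\<omega>. inner_k d (f \<omega> x) (mvec d (offp d (map (f \<omega>) xs)) (f \<omega> x))) \<in> borel_measurable M"
    by (rule measurable_inner_k) (rule q x; assumption?)+
  show ?case
    unfolding list.map offp.simps
    by (intro borel_measurable_diff borel_measurable_divide borel_measurable_times IH q D)
qed

text \<open>\<eta> scales the prior variance. The bound 1/128 gives \<open>fro d d L\<close> \<le>
  1/32, as \<open>avgweight_lower\<close> requires; \<open>rank_small\<close> spends half of the
  shift budget n / 100; \<open>fro_small\<close> says that removing up to n directions costs at most
  half of the trace of \<Sigma>2.\<close>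

locale cov_sample = cov_roots +
  fixes n :: nat and \<eta> :: real
  assumes n_large: "100 \<le> n" and eta: "0 < \<eta>" "\<eta> \<le> 1 / 128"
    and trace_pos: "0 < trace d \<Sigma>2"
    and rank_small: "2 * (real (mrank d \<Sigma>1) + 1) / \<eta> \<le> real n / 200"
    and fro_small: "real n * fro d d \<Sigma>2 \<le> (trace d \<Sigma>2 / 2)\<^sup>2"
begin

section \<open>The adapted prior and the shift that reaches a given direction\<close>

definition T where "T = trace d \<Sigma>2"
definition k where "k = real (mrank d \<Sigma>1)"
text \<open>The constant solves 2 T / (\<eta> \<kappa>) = n / 200, the other half of the shift
  budget.\<close>

definition \<kappa> where "\<kappa> = 400 * T / (\<eta> * real n)"
definition Fmax where "Fmax = 4 * k * \<kappa>\<^sup>2 + 2 * fro d d \<Sigma>2"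

lemma T_pos: "0 < T" and k_nonneg: "0 \<le> k" and n_pos: "0 < real n" and kappa_pos: "0 < \<kappa>" and Fmax_nonneg: "0 \<le> Fmax"
  using trace_pos n_large eta by (auto simp: T_def k_def \<kappa>_def Fmax_def intro!: add_nonneg_nonneg divide_pos_pos mult_pos_pos)

definition P where "P = (SOME P. is_proj d P \<and> trace d P \<le> k \<and>
    (\<forall>v. mvec d P (mvec d S1 v) = mvec d S1 v) \<and> (\<forall>v. mvec d S2 (mvec d P v) = (\<lambda>_. 0)))"

lemma P: "is_proj d P" "trace d P \<le> k" "mvec d P (mvec d S1 v) = mvec d S1 v" "mvec d S2 (mvec d P v) = (\<lambda>_. 0)"
proof -
  have "\<exists>P. is_proj d P \<and> trace d P \<le> k \<and>
    (\<forall>v. mvec d P (mvec d S1 v) = mvec d S1 v) \<and> (\<forall>v. mvec d S2 (mvec d P v) = (\<lambda>_. 0))"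
    using rank_projection unfolding k_def by metis
  from someI_ex[OF this, folded P_def]
  show "is_proj d P" "trace d P \<le> k" "mvec d P (mvec d S1 v) = mvec d S1 v" "mvec d S2 (mvec d P v) = (\<lambda>_. 0)"
    by auto
qed

text \<open>A root of the prior covariance. The first part is flat on the column space of \<Sigma>1,
  independently of the eigenvalues there; the second is proportional to the root of \<Sigma>2. Each
  has squared Frobenius norm at most \<eta>, and k + 1 avoids division by zero when the rank is
  0.\<close>

definition L where "L = (\<lambda>i j. sqrt (\<eta> / (k + 1)) * P i j + sqrt (\<eta> / T) * S2 i j)"

lemma mvec_L: "mvec d L v = (\<lambda>i. sqrt (\<eta> / (k + 1)) * mvec d P v i + sqrt (\<eta> / T) * mvec d S2 v i)"
  by (rule ext) (simp add: L_def mvec_def ring_distribs sum.distrib sum_distrib_left mult.assoc)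

lemma fro_L: "fro d d L \<le> 4 * \<eta>"
proof -
  have "fro d d L \<le> (\<Sum>a<d. 2 * sqnorm d (\<lambda>i. sqrt (\<eta> / (k + 1)) * mvec d P (unitv a) i)
      + 2 * sqnorm d (\<lambda>i. sqrt (\<eta> / T) * mvec d S2 (unitv a) i))"
    unfolding fro_columns[of d d L] mvec_L by (intro sum_mono sqnorm_add_le)
  also have "\<dots> = 2 * (\<eta> / (k + 1)) * fro d d P + 2 * (\<eta> / T) * fro d d S2"
    using eta T_pos k_nonneg by (simp add: sqnorm_scale fro_columns sum.distrib sum_distrib_left mult.assoc)
  also have "\<dots> \<le> 2 * (\<eta> / (k + 1)) * (k + 1) + 2 * (\<eta> / T) * T"
    using eta T_pos k_nonneg P(1,2) fro_psd_root[OF root2]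
    by (intro add_mono mult_left_mono) (auto simp: fro_proj T_def)
  also have "\<dots> = 4 * \<eta>" using T_pos k_nonneg by simp
  finally show ?thesis .
qed

text \<open>A preimage of S u under L. Its second part is u with the \<Sigma>1 directions removed,
  which S2 maps to S2 u; its length is thus charged to |u| rather than to |S u|.\<close>

definition shift :: "(nat \<Rightarrow> real) \<Rightarrow> nat \<Rightarrow> real" where
  "shift u = (\<lambda>i. sqrt ((k + 1) / \<eta>) * mvec d S1 u i + sqrt (T / \<eta>) * (u i - mvec d P u i))"

lemma mvec_L_shift: "mvec d L (shift u) = mvec d S u"
proof -
  have "mvec d P (\<lambda>i. u i - mvec d P u i) = (\<lambda>_. 0)" using P(1) by (simp add: mvec_linear is_proj_def)
  then have 1: "mvec d P (shift u) = (\<lambda>i. sqrt ((k + 1) / \<eta>) * mvec d S1 u i)"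
    unfolding shift_def mvec_add mvec_scale by (simp add: P)
  have "mvec d S2 (\<lambda>i. u i - mvec d P u i) = mvec d S2 u" by (simp add: mvec_linear P)
  then have 2: "mvec d S2 (shift u) = (\<lambda>i. sqrt (T / \<eta>) * mvec d S2 u i)"
    unfolding shift_def mvec_add mvec_scale by (simp add: S2_S1)
  have "sqrt (\<eta> / (k + 1)) * sqrt ((k + 1) / \<eta>) = 1" "sqrt (\<eta> / T) * sqrt (T / \<eta>) = 1"
    using eta T_pos k_nonneg by (simp_all flip: real_sqrt_mult)
  then show ?thesis unfolding mvec_L 1 2 mvec_S by (simp flip: mult.assoc)
qed

lemma sqnorm_shift: "sqnorm d (shift u) \<le> 2 * (k + 1) / \<eta> * sqnorm d (mvec d S u) + 2 * T / \<eta> * sqnorm d u"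
proof -
  have "sqnorm d (\<lambda>i. u i - mvec d P u i) \<le> sqnorm d u"
    unfolding sqnorm_diff using sqnorm_nonneg[of d "mvec d P u"] by (simp add: is_proj_sqnorm[OF P(1)])
  then have "2 * T / \<eta> * sqnorm d (\<lambda>i. u i - mvec d P u i) \<le> 2 * T / \<eta> * sqnorm d u"
    using T_pos eta by (intro mult_left_mono) auto
  moreover have "2 * (k + 1) / \<eta> * sqnorm d (mvec d S1 u) \<le> 2 * (k + 1) / \<eta> * sqnorm d (mvec d S u)"
    using k_nonneg eta by (intro mult_left_mono) (auto simp: sqnorm_S)
  moreover have "sqnorm d (shift u) \<le> 2 * (k + 1) / \<eta> * sqnorm d (mvec d S1 u) + 2 * T / \<eta> * sqnorm d (\<lambda>i. u i - mvec d P u i)"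
  proof -
    have "(sqrt ((k + 1) / \<eta>))\<^sup>2 = (k + 1) / \<eta>" "(sqrt (T / \<eta>))\<^sup>2 = T / \<eta>"
      using T_pos eta k_nonneg by simp_all
    moreover have "2 * ((k + 1) / \<eta> * x) + 2 * (T / \<eta> * y) = 2 * (k + 1) / \<eta> * x + 2 * T / \<eta> * y" for x y
      by (simp add: mult.assoc)
    ultimately show ?thesis
      unfolding shift_def by (intro order.trans[OF sqnorm_add_le]) (simp only: sqnorm_scale order.refl)
  qed
  ultimately show ?thesis by linarith
qed

section \<open>Leave-one-out quantities and the deterministic consequences of typicality\<close>

definition X where "X G i = mvec d S (rowv d G i)"
definition Qi where "Qi G i = offp d (map (X G) (others n i))"
definition D where "D G i = inner_k d (X G i) (mvec d (Qi G i) (X G i))"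
text \<open>Involves the rows other than i only, so row i is still Gaussian after restriction to
  this event.\<close>

definition good where "good G i \<longleftrightarrow> fro d d (mmul d S (mmul d (Qi G i) S)) \<le> Fmax"

text \<open>The second condition takes all n rows and is the same for every i, so its failure
  probability is paid once and not n times.\<close>

definition typical where
  "typical G i \<longleftrightarrow> avgweight d ({..<n} - {i}) L G \<le> ennreal (exp (real n / 100)) \<and> fro n d (rowmat d G L) < real n / 100"

lemma is_proj_Qi: "is_proj d (Qi G i)"
  unfolding Qi_def by (rule offp_proj)

text \<open>A violating u, scaled so that |S u| = 1, has |u|^2 \<le> 1 / \<kappa>. Its shift then
  fits into the budget n / 100, and \<open>avgweight_lower\<close> forces the average weight beyond
  exp (n / 100).\<close>

lemma null_vector_bound:
  assumes i: "i < n" and ty: "typical G i"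
    and null: "\<And>l. l < n \<Longrightarrow> l \<noteq> i \<Longrightarrow> inner_k d (X G l) u = 0"
  shows "sqnorm d (mvec d S u) \<le> \<kappa> * sqnorm d u"
proof (rule ccontr)
  assume neg: "\<not> sqnorm d (mvec d S u) \<le> \<kappa> * sqnorm d u"
  define q where "q = sqnorm d (mvec d S u)"
  have "0 \<le> \<kappa> * sqnorm d u" using kappa_pos by simp
  then have q: "q > 0" using neg by (simp add: q_def)
  define v where "v = (\<lambda>i. (1 / sqrt q) * u i)"
  have Sv: "mvec d S v = (\<lambda>i. (1 / sqrt q) * mvec d S u i)" by (simp only: v_def mvec_scale)
  have unit: "sqnorm d (mvec d S v) = 1"
    unfolding Sv sqnorm_scale using q by (simp add: q_def[symmetric] power_divide)
  have "sqnorm d v = sqnorm d u / q"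
    unfolding v_def sqnorm_scale using q by (simp add: power_divide)
  also have "\<dots> \<le> 1 / \<kappa>" using neg q kappa_pos by (simp add: field_simps flip: q_def)
  finally have v: "sqnorm d v \<le> 1 / \<kappa>" .
  \<comment> \<open>r^2 = n / 100 is the budget; each of the two terms of
    \<open>sqnorm_shift\<close> takes at most half of it.\<close>
  define r where "r = sqrt (real n) / 10"
  have "sqnorm d (shift v) \<le> 2 * (k + 1) / \<eta> * 1 + 2 * T / \<eta> * (1 / \<kappa>)"
    using sqnorm_shift[of v] unit v T_pos eta mult_left_mono[OF v, of "2 * T / \<eta>"] by simp
  also have "2 * T / \<eta> * (1 / \<kappa>) = real n / 200" using T_pos eta n_pos by (simp add: \<kappa>_def field_simps)
  also have "2 * (k + 1) / \<eta> * 1 + real n / 200 \<le> r\<^sup>2"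
  proof -
    have "r\<^sup>2 = real n / 100" by (simp add: r_def power_divide)
    then show ?thesis using rank_small unfolding k_def by linarith
  qed
  finally have r: "sqnorm d (shift v) \<le> r\<^sup>2" .
  have "inner_k d (rowv d G l) (mvec d L (shift v)) = 0" if l: "l \<in> {..<n} - {i}" for l
  proof -
    have "inner_k d (rowv d G l) (mvec d S u) = inner_k d (X G l) u" unfolding X_def by (rule inner_k_mvec_sym[OF symS])
    then show ?thesis using null[of l] l unfolding mvec_L_shift Sv inner_k_linear by simp
  qed
  then have "ennreal (exp (- 4 * (real n / 100) - 3 * r - r\<^sup>2 / 2) * sqrt (5 / 4) ^ card ({..<n} - {i}) / 2)
      \<le> avgweight d ({..<n} - {i}) L G"
    using ty r n_pos fro_L eta unit
    by (intro avgweight_lower[where n = n and a = "shift v"]) (auto simp: typical_def r_def mvec_L_shift)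
  also have "\<dots> \<le> ennreal (exp (real n / 100))" using ty by (simp add: typical_def)
  finally have "exp (- 4 * (real n / 100) - 3 * r - r\<^sup>2 / 2) * sqrt (5 / 4) ^ (n - 1) / 2 \<le> exp (real n / 100)"
    using i by (simp add: ennreal_le_iff)
  then show False using exp_growth_contradiction[OF n_large refl] by (simp add: r_def)
qed

lemma typical_imp_good: "i < n \<Longrightarrow> typical G i \<Longrightarrow> good G i"
  unfolding good_def Fmax_def k_def
proof (rule fro_compressed_le[OF is_proj_Qi])
  fix u assume i: "i < n" "typical G i"
  show "sqnorm d (mvec d S (mvec d (Qi G i) u)) \<le> \<kappa> * sqnorm d (mvec d (Qi G i) u)"
  proof (rule null_vector_bound[OF i])
    fix l assume "l < n" "l \<noteq> i"
    then have "mvec d (Qi G i) (X G l) = (\<lambda>_. 0)" unfolding Qi_def by (intro offp_kills) (auto simp: set_others)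
    then show "inner_k d (X G l) (mvec d (Qi G i) u) = 0" by (simp add: is_proj_inner(2)[OF is_proj_Qi])
  qed
qed (use kappa_pos in simp)

text \<open>A vector orthogonal to all rows is in particular orthogonal to all rows but the one with
  index 0, so typicality at 0 suffices.\<close>

lemma typical_bias:
  assumes "typical G 0"
  shows "sqnorm d (mvec d S (mvec d (offp d (map (X G) [0..<n])) w)) \<le> \<kappa> * sqnorm d w"
proof -
  let ?Q = "offp d (map (X G) [0..<n])"
  have "sqnorm d (mvec d S (mvec d ?Q w)) \<le> \<kappa> * sqnorm d (mvec d ?Q w)"
  proof (rule null_vector_bound[OF _ assms])
    show "0 < n" using n_large by simp
    fix l assume "l < n"
    then have "mvec d ?Q (X G l) = (\<lambda>_. 0)" by (intro offp_kills) auto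
    then show "inner_k d (X G l) (mvec d ?Q w) = 0" by (simp add: is_proj_inner(2)[OF offp_proj])
  qed
  also have "\<dots> \<le> \<kappa> * sqnorm d w" using kappa_pos by (intro mult_left_mono is_proj_sqnorm_le offp_proj) auto
  finally show ?thesis .
qed

section \<open>Measurability and probabilities of the exceptional events\<close>

abbreviation "M \<equiv> gauss ({..<n} \<times> {..<d})"

lemma finite_measure_M: "finite_measure M"
  by (rule prob_space.finite_measure[OF prob_space_gauss])

lemma measurable_X: "i < n \<Longrightarrow> (\<lambda>G. X G i j) \<in> borel_measurable M"
  unfolding X_def by (rule measurable_mvec) (auto intro: measurable_row_entry)

lemma measurable_Qi: "(\<lambda>G. Qi G i a b) \<in> borel_measurable M"
  unfolding Qi_def by (rule measurable_offp) (auto simp: set_others intro: measurable_X)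

lemma measurable_QX: "i < n \<Longrightarrow> (\<lambda>G. mvec d (Qi G i) (X G i) j) \<in> borel_measurable M"
  by (intro measurable_mvec measurable_Qi measurable_X)

lemma measurable_D: "i < n \<Longrightarrow> (\<lambda>G. D G i) \<in> borel_measurable M"
  unfolding D_def by (intro measurable_inner_k measurable_X measurable_QX)

lemma measurable_SQS: "(\<lambda>G. mmul d S (mmul d (Qi G i) S) a b) \<in> borel_measurable M"
  unfolding mmul_def
  by (intro borel_measurable_sum borel_measurable_times borel_measurable_const measurable_Qi)

lemma measurable_good: "(\<lambda>G. good G i) \<in> measurable M (count_space UNIV)"
proof -
  have "(\<lambda>G. fro d d (mmul d S (mmul d (Qi G i) S))) \<in> borel_measurable M"
    by (intro measurable_fro measurable_SQS)
  then show ?thesis unfolding good_def by measurable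
qed

lemma Qi_cong: "(\<And>l k. l \<noteq> i \<Longrightarrow> G (l, k) = G' (l, k)) \<Longrightarrow> Qi G i = Qi G' i"
proof -
  assume *: "\<And>l k. l \<noteq> i \<Longrightarrow> G (l, k) = G' (l, k)"
  have "X G l = X G' l" if "l \<noteq> i" for l
    unfolding X_def using *[OF that] by (simp cong: rowv_cong)
  then have "map (X G) (others n i) = map (X G') (others n i)" by (auto simp: others_def)
  then show ?thesis unfolding Qi_def by (rule arg_cong)
qed

text \<open>Markov's inequality for a nonnegative variable of mean 1; the exponential rate survives
  the union over i.\<close>

lemma prob_avgweight:
  "measure M {G \<in> space M. \<not> avgweight d ({..<n} - {i}) L G \<le> ennreal (exp (real n / 100))} \<le> exp (- real n / 100)"
proof -
  let ?R = "{..<n} - {i}" let ?c = "ennreal (exp (- real n / 100))"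
  have m: "avgweight d ?R L \<in> borel_measurable M" by (rule measurable_avgweight) auto
  have c: "?c * ennreal (exp (real n / 100)) = 1" by (simp flip: ennreal_mult' exp_add)
  have "emeasure M {G \<in> space M. \<not> avgweight d ?R L G \<le> ennreal (exp (real n / 100))}
      \<le> emeasure M {G \<in> space M. 1 \<le> ?c * avgweight d ?R L G}"
  proof (rule emeasure_mono)
    show "{G \<in> space M. \<not> avgweight d ?R L G \<le> ennreal (exp (real n / 100))} \<subseteq> {G \<in> space M. 1 \<le> ?c * avgweight d ?R L G}"
    proof safe
      fix G assume "\<not> avgweight d ?R L G \<le> ennreal (exp (real n / 100))"
      then have "?c * ennreal (exp (real n / 100)) \<le> ?c * avgweight d ?R L G" by (intro mult_left_mono) auto
      then show "1 \<le> ?c * avgweight d ?R L G" unfolding c .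
    qed
    show "{G \<in> space M. 1 \<le> ?c * avgweight d ?R L G} \<in> sets M" using m by measurable
  qed
  also have "\<dots> \<le> ?c * (\<integral>\<^sup>+G. avgweight d ?R L G * indicator (space M) G \<partial>M)"
    by (intro nn_integral_Markov_inequality borel_measurable_times_ennreal m borel_measurable_indicator sets.top)
  also have "(\<integral>\<^sup>+G. avgweight d ?R L G * indicator (space M) G \<partial>M) = (\<integral>\<^sup>+G. avgweight d ?R L G \<partial>M)"
    by (rule nn_integral_cong) simp
  also have "\<dots> = 1" by (rule nn_integral_avgweight) auto
  finally show ?thesis by (simp add: finite_measure.emeasure_eq_measure[OF finite_measure_M] ennreal_le_iff)
qed

lemma measurable_rowmat: "(\<lambda>G. fro n d (rowmat d G L)) \<in> borel_measurable M"
  unfolding rowmat_def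
  by (intro measurable_fro measurable_inner_k) (auto intro: measurable_row_entry)

text \<open>The mean is n times \<open>fro d d L\<close>, at most 4 \<eta> n, against the threshold
  n / 100.\<close>

lemma prob_rowmat:
  "measure M {G \<in> space M. real n / 100 \<le> fro n d (rowmat d G L)} \<le> 400 * \<eta>"
proof -
  have row: "(\<integral>\<^sup>+G. ennreal (\<Sum>j<d. (rowmat d G L l j)\<^sup>2) \<partial>M) = ennreal (fro d d L)" if l: "l < n" for l
  proof -
    let ?F = "\<lambda>G h. ennreal (sqnorm d (mvec d (\<lambda>j k. L k j) h))"
    have "(\<lambda>h. ennreal (sqnorm d (mvec d (\<lambda>j k. L k j) h))) \<in> borel_measurable (gauss {..<d})"
      using measurable_sqnorm[OF measurable_mvec_gauss] by measurable
    then have F: "(\<lambda>(G, h). ?F G h) \<in> borel_measurable (M \<Otimes>\<^sub>M gauss {..<d})"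
      unfolding case_prod_unfold by (rule measurable_compose[OF measurable_snd])
    have "(\<integral>\<^sup>+G. ennreal (\<Sum>j<d. (rowmat d G L l j)\<^sup>2) \<partial>M) = (\<integral>\<^sup>+G. ?F G (\<lambda>k\<in>{..<d}. G (l, k)) \<partial>M)"
      by (simp add: rowmat_def sqnorm_def mvec_def inner_k_def rowv_def mult.commute)
    also have "\<dots> = (\<integral>\<^sup>+G. \<integral>\<^sup>+h. ?F G h \<partial>gauss {..<d} \<partial>M)" by (rule resample_row[OF l F]) simp
    also have "\<dots> = ennreal (fro d d L)" unfolding nn_integral_sqnorm_mvec by (simp add: fro_transpose[of d d L])
    finally show ?thesis .
  qed
  have "(\<integral>\<^sup>+G. ennreal (fro n d (rowmat d G L)) \<partial>M) = (\<integral>\<^sup>+G. (\<Sum>l<n. ennreal (\<Sum>j<d. (rowmat d G L l j)\<^sup>2)) \<partial>M)"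
    by (simp add: fro_def sum_nonneg)
  also have "\<dots> = (\<Sum>l<n. (\<integral>\<^sup>+G. ennreal (\<Sum>j<d. (rowmat d G L l j)\<^sup>2) \<partial>M))"
  proof (rule nn_integral_sum)
    fix l assume "l \<in> {..<n}"
    then have "(\<lambda>G. rowmat d G L l j) \<in> borel_measurable M" for j
      unfolding rowmat_def by (intro measurable_inner_k) (auto intro: measurable_row_entry)
    then show "(\<lambda>G. ennreal (\<Sum>j<d. (rowmat d G L l j)\<^sup>2)) \<in> borel_measurable M" by measurable
  qed
  also have "\<dots> = (\<Sum>l<n. ennreal (fro d d L))" by (intro sum.cong refl row) auto
  also have "\<dots> = ennreal (real n * fro d d L)" by (simp add: ennreal_mult' flip: ennreal_of_nat_eq_real_of_nat)
  finally have "measure M {G \<in> space M. real n / 100 \<le> fro n d (rowmat d G L)} \<le> real n * fro d d L / (real n / 100)"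
    using n_pos by (intro markov_measure finite_measure_M measurable_rowmat) auto
  also have "\<dots> \<le> 400 * \<eta>" using fro_L n_pos by simp
  finally show ?thesis .
qed

lemma D_row: "inner_k d (mvec d S h) (mvec d Q (mvec d S h)) = inner_k d h (mvec d (mmul d S (mmul d Q S)) h)"
  by (simp add: mvec_mmul inner_k_mvec_sym[OF symS])

lemma SQS_props:
  assumes Q: "is_proj d Q"
  shows "sym_mat d (mmul d S (mmul d Q S))" "trace d (mmul d S (mmul d Q S)) = fro d d (mmul d Q S)"
proof -
  have symQ: "sym_mat d Q" using Q by (simp add: is_proj_def)
  show "sym_mat d (mmul d S (mmul d Q S))"
    unfolding sym_mat_iff_inner by (simp add: mvec_mmul inner_k_mvec_sym[OF symS] inner_k_mvec_sym[OF symQ])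
  have "trace d (mmul d S (mmul d Q S)) = (\<Sum>a<d. inner_k d (unitv a) (mvec d (mmul d S (mmul d Q S)) (unitv a)))"
    by (simp add: trace_def inner_k_unitv mvec_unitv)
  also have "\<dots> = fro d d (mmul d Q S)"
    by (simp add: fro_mmul is_proj_sqnorm[OF Q] flip: D_row)
  finally show "trace d (mmul d S (mmul d Q S)) = fro d d (mmul d Q S)" .
qed

text \<open>The squared norm is the trace of Q \<Sigma> with Q = \<open>Qi G i\<close>. The
  \<Sigma>1 part is nonnegative, and deleting the other rows costs the \<Sigma>2 part at most sqrt
  (n |\<Sigma>2|^2) \<le> T / 2.\<close>

lemma fro_QiS_ge: "T / 2 \<le> fro d d (mmul d (Qi G i) S)"
proof -
  have "real (length (map (X G) (others n i))) * fro d d \<Sigma>2 \<le> (T / 2)\<^sup>2"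
    using fro_small length_others_le[of n i] mult_right_mono[of "real (length (others n i))" "real n" "fro d d \<Sigma>2"]
    by (simp add: T_def)
  then have "sqrt (real (length (map (X G) (others n i))) * fro d d \<Sigma>2) \<le> T / 2"
    using T_pos by (intro real_le_lsqrt) auto
  then have "T / 2 \<le> fro d d (mmul d (Qi G i) S2)"
    using fro_offp_root_ge[OF root2, of "map (X G) (others n i)"] by (simp add: T_def Qi_def)
  also have "\<dots> \<le> fro d d (mmul d (Qi G i) S)"
  proof -
    have "fro d d (mmul d (Qi G i) S) = fro d d (mmul d (Qi G i) S1) + fro d d (mmul d (Qi G i) S2)"
      using split unfolding fro_proj_root[OF is_proj_Qi rootS] fro_proj_root[OF is_proj_Qi root1] fro_proj_root[OF is_proj_Qi root2]
      by (simp add: cov_split_def ring_distribs sum.distrib)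
    then show ?thesis by simp
  qed
  finally show ?thesis .
qed

text \<open>With a fresh row the mean is at least T / 2, so a deviation of T / 4 is needed;
  Chebyshev gives 2 \<open>Fmax\<close> / (T / 4)^2.\<close>

lemma prob_D_small:
  assumes i: "i < n"
  shows "measure M {G \<in> space M. good G i \<and> D G i < T / 4} \<le> 32 * Fmax / T\<^sup>2"
proof -
  let ?A = "\<lambda>G. mmul d S (mmul d (Qi G i) S)"
  \<comment> \<open>Row i is replaced by a free variable h; G enters only through the other
    rows.\<close>
  let ?E = "{(G, h). good G i \<and> inner_k d h (mvec d (?A G) h) < T / 4}"
  let ?F = "\<lambda>G h. indicator ?E (G, h) :: ennreal"
  have mq: "(\<lambda>x. inner_k d (snd x) (mvec d (?A (fst x)) (snd x))) \<in> borel_measurable (M \<Otimes>\<^sub>M gauss {..<d})"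
    by (intro measurable_inner_k measurable_mvec measurable_compose[OF measurable_fst measurable_SQS] measurable_snd_coord; simp)
  have mg: "(\<lambda>x. good (fst x) i) \<in> measurable (M \<Otimes>\<^sub>M gauss {..<d}) (count_space UNIV)"
    by (rule measurable_compose[OF measurable_fst measurable_good])
  have "(\<lambda>x. if good (fst x) i \<and> inner_k d (snd x) (mvec d (?A (fst x)) (snd x)) < T / 4 then 1 else 0 :: ennreal)
      \<in> borel_measurable (M \<Otimes>\<^sub>M gauss {..<d})"
    using mq mg by measurable
  then have F: "(\<lambda>(G, h). ?F G h) \<in> borel_measurable (M \<Otimes>\<^sub>M gauss {..<d})"
    by (simp add: case_prod_unfold indicator_def of_bool_def)
  have inner: "(\<integral>\<^sup>+h. ?F G h \<partial>gauss {..<d}) \<le> ennreal (32 * Fmax / T\<^sup>2)" for G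
  proof (cases "good G i")
    case True
    let ?B = "{h \<in> space (gauss {..<d}). inner_k d h (mvec d (?A G) h) < trace d (?A G) - T / 4}"
    have setB: "?B \<in> sets (gauss {..<d})" using measurable_qform_gauss[of d "?A G"] by measurable
    have tr: "T / 2 \<le> trace d (?A G)" using fro_QiS_ge SQS_props(2)[OF is_proj_Qi] by simp
    have "(\<integral>\<^sup>+h. ?F G h \<partial>gauss {..<d}) \<le> (\<integral>\<^sup>+h. indicator ?B h \<partial>gauss {..<d})"
      by (rule nn_integral_mono) (use tr in \<open>auto simp: indicator_def\<close>)
    also have "\<dots> = emeasure (gauss {..<d}) ?B" by (rule nn_integral_indicator[OF setB])
    also have "\<dots> = ennreal (measure (gauss {..<d}) ?B)"
      by (rule finite_measure.emeasure_eq_measure[OF prob_space.finite_measure[OF prob_space_gauss]])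
    also have "\<dots> \<le> ennreal (2 * fro d d (?A G) / (T / 4)\<^sup>2)"
      using T_pos by (intro ennreal_leI gauss_qform_lower_tail SQS_props is_proj_Qi) auto
    also have "\<dots> \<le> ennreal (32 * Fmax / T\<^sup>2)"
      using True T_pos by (intro ennreal_leI) (simp add: good_def power_divide divide_right_mono)
    finally show ?thesis .
  next
    case False
    then show ?thesis by (simp add: indicator_def)
  qed
  let ?S = "{G \<in> space M. good G i \<and> D G i < T / 4}"
  have S: "?S \<in> sets M" using measurable_good[of i] measurable_D[OF i] by measurable
  have "emeasure M ?S = (\<integral>\<^sup>+G. indicator ?S G \<partial>M)" using S by simp
  also have "\<dots> = (\<integral>\<^sup>+G. ?F G (\<lambda>k\<in>{..<d}. G (i, k)) \<partial>M)"
    by (rule nn_integral_cong) (auto simp: indicator_def D_def X_def D_row rowv_def)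
  also have "\<dots> = (\<integral>\<^sup>+G. \<integral>\<^sup>+h. ?F G h \<partial>gauss {..<d} \<partial>M)"
  proof (rule resample_row[OF i F])
    fix G G' :: "nat \<times> nat \<Rightarrow> real" and h
    assume *: "\<And>l k. l \<noteq> i \<Longrightarrow> G (l, k) = G' (l, k)"
    have "Qi G i = Qi G' i" by (rule Qi_cong) (rule *)
    then show "?F G h = ?F G' h" by (simp add: indicator_def good_def)
  qed
  also have "\<dots> \<le> (\<integral>\<^sup>+G. ennreal (32 * Fmax / T\<^sup>2) \<partial>M)" by (intro nn_integral_mono inner)
  also have "\<dots> = ennreal (32 * Fmax / T\<^sup>2)" by simp
  finally show ?thesis
    using Fmax_nonneg by (simp add: finite_measure.emeasure_eq_measure[OF finite_measure_M] ennreal_le_iff)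
qed

text \<open>For a fresh row S h the vector is S Q S h with Q = \<open>Qi G i\<close>, whose mean
  squared norm is the squared Frobenius norm of S Q S, bounded by the definition of
  \<open>good\<close>.\<close>

lemma nn_integral_good_signal:
  assumes i: "i < n"
  shows "(\<integral>\<^sup>+G. (if good G i then ennreal (sqnorm d (mvec d S (mvec d (Qi G i) (X G i)))) else 0) \<partial>M) \<le> ennreal Fmax"
proof -
  let ?A = "\<lambda>G. mmul d S (mmul d (Qi G i) S)"
  let ?F = "\<lambda>G h. if good G i then ennreal (sqnorm d (mvec d (?A G) h)) else 0"
  have ms: "(\<lambda>x. sqnorm d (mvec d (?A (fst x)) (snd x))) \<in> borel_measurable (M \<Otimes>\<^sub>M gauss {..<d})"
    by (intro measurable_sqnorm measurable_mvec measurable_compose[OF measurable_fst measurable_SQS] measurable_snd_coord; simp)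
  have mg: "(\<lambda>x. good (fst x) i) \<in> measurable (M \<Otimes>\<^sub>M gauss {..<d}) (count_space UNIV)"
    by (rule measurable_compose[OF measurable_fst measurable_good])
  have F: "(\<lambda>(G, h). ?F G h) \<in> borel_measurable (M \<Otimes>\<^sub>M gauss {..<d})"
    unfolding case_prod_unfold using ms mg by measurable
  have "(\<integral>\<^sup>+G. (if good G i then ennreal (sqnorm d (mvec d S (mvec d (Qi G i) (X G i)))) else 0) \<partial>M)
      = (\<integral>\<^sup>+G. ?F G (\<lambda>k\<in>{..<d}. G (i, k)) \<partial>M)"
    by (intro nn_integral_cong) (simp add: X_def mvec_mmul rowv_def cong: if_cong)
  also have "\<dots> = (\<integral>\<^sup>+G. \<integral>\<^sup>+h. ?F G h \<partial>gauss {..<d} \<partial>M)"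
  proof (rule resample_row[OF i F])
    fix G G' :: "nat \<times> nat \<Rightarrow> real" and h
    assume *: "\<And>l k. l \<noteq> i \<Longrightarrow> G (l, k) = G' (l, k)"
    have "Qi G i = Qi G' i" by (rule Qi_cong) (rule *)
    then show "?F G h = ?F G' h" by (simp add: good_def)
  qed
  also have "\<dots> \<le> (\<integral>\<^sup>+G. ennreal Fmax \<partial>M)"
  proof (rule nn_integral_mono)
    fix G
    show "(\<integral>\<^sup>+h. ?F G h \<partial>gauss {..<d}) \<le> ennreal Fmax"
      by (cases "good G i") (auto simp: nn_integral_sqnorm_mvec good_def intro: ennreal_leI)
  qed
  also have "\<dots> = ennreal Fmax" by simp
  finally show ?thesis .
qed

text \<open>Column i is the image under S of the dual vector of row i, set to 0 when the null space
  or \<open>D G i\<close> misbehaves. The truncation keeps the second moment finite over the whole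
  sample space.\<close>

definition noise_mat :: "(nat \<times> nat \<Rightarrow> real) \<Rightarrow> nat \<Rightarrow> nat \<Rightarrow> real" where
  "noise_mat G = (\<lambda>j i. if good G i \<and> T / 4 \<le> D G i then mvec d S (mvec d (Qi G i) (X G i)) j / D G i else 0)"

lemma measurable_noise_mat: "i < n \<Longrightarrow> (\<lambda>G. noise_mat G j i) \<in> borel_measurable M"
proof -
  assume i: "i < n"
  have "(\<lambda>G. mvec d S (mvec d (Qi G i) (X G i)) j) \<in> borel_measurable M"
    by (intro measurable_mvec measurable_QX i) auto
  then show ?thesis unfolding noise_mat_def using measurable_good[of i] measurable_D[OF i] by measurable
qed

lemma measurable_noise:
  "(\<lambda>\<omega>. sqnorm d (mvec n (noise_mat (fst \<omega>)) (snd \<omega>))) \<in> borel_measurable (M \<Otimes>\<^sub>M gauss {..<n})"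
  by (intro measurable_sqnorm measurable_mvec measurable_compose[OF measurable_fst measurable_noise_mat] measurable_snd_coord; simp)

text \<open>Integrating the noise first leaves the Frobenius norm of the matrix. Each column then
  contributes at most 16 / T^2 times the good signal, as \<open>D G i\<close> \<ge> T / 4 wherever
  the column is nonzero.\<close>

lemma nn_integral_noise:
  "(\<integral>\<^sup>+\<omega>. ennreal (sqnorm d (mvec n (noise_mat (fst \<omega>)) (snd \<omega>))) \<partial>(M \<Otimes>\<^sub>M gauss {..<n})) \<le> ennreal (16 * real n * Fmax / T\<^sup>2)"
proof -
  have fro_le: "ennreal (fro d n (noise_mat G)) \<le> (\<Sum>i<n. ennreal (16 / T\<^sup>2) *
      (if good G i then ennreal (sqnorm d (mvec d S (mvec d (Qi G i) (X G i)))) else 0))" for G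
  proof -
    have "fro d n (noise_mat G) = (\<Sum>i<n. \<Sum>j<d. (noise_mat G j i)\<^sup>2)" unfolding fro_def by (rule sum.swap)
    then have "ennreal (fro d n (noise_mat G)) = (\<Sum>i<n. ennreal (\<Sum>j<d. (noise_mat G j i)\<^sup>2))"
      by (simp add: sum_nonneg)
    also have "\<dots> \<le> (\<Sum>i<n. ennreal (16 / T\<^sup>2) *
      (if good G i then ennreal (sqnorm d (mvec d S (mvec d (Qi G i) (X G i)))) else 0))"
    proof (rule sum_mono)
      fix i
      let ?s = "sqnorm d (mvec d S (mvec d (Qi G i) (X G i)))"
      show "ennreal (\<Sum>j<d. (noise_mat G j i)\<^sup>2) \<le> ennreal (16 / T\<^sup>2) * (if good G i then ennreal ?s else 0)"
      proof (cases "good G i \<and> T / 4 \<le> D G i")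
        case True
        have "(\<Sum>j<d. (noise_mat G j i)\<^sup>2) = ?s / (D G i)\<^sup>2"
          using True by (simp add: noise_mat_def power_divide sqnorm_def sum_divide_distrib)
        also have "\<dots> \<le> ?s / (T / 4)\<^sup>2"
          using True T_pos by (intro divide_left_mono power_mono mult_pos_pos) auto
        also have "\<dots> = 16 / T\<^sup>2 * ?s" by (simp add: power_divide)
        finally show ?thesis using True by (simp add: ennreal_leI flip: ennreal_mult')
      next
        case False
        then show ?thesis by (simp add: noise_mat_def)
      qed
    qed
    finally show ?thesis .
  qed
  have sf: "sigma_finite_measure (gauss {..<n})"
    by (intro finite_measure.axioms(1) prob_space.finite_measure prob_space_gauss)
  have ms: "(\<lambda>G. if good G i then ennreal (sqnorm d (mvec d S (mvec d (Qi G i) (X G i)))) else 0) \<in> borel_measurable M"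
    if i: "i < n" for i
  proof -
    have "(\<lambda>G. sqnorm d (mvec d S (mvec d (Qi G i) (X G i)))) \<in> borel_measurable M"
      by (intro measurable_sqnorm measurable_mvec measurable_QX i) auto
    then show ?thesis using measurable_good[of i] by measurable
  qed
  have "(\<integral>\<^sup>+\<omega>. ennreal (sqnorm d (mvec n (noise_mat (fst \<omega>)) (snd \<omega>))) \<partial>(M \<Otimes>\<^sub>M gauss {..<n}))
      = (\<integral>\<^sup>+G. \<integral>\<^sup>+z. ennreal (sqnorm d (mvec n (noise_mat G) z)) \<partial>gauss {..<n} \<partial>M)"
    using measurable_noise by (subst sigma_finite_measure.nn_integral_fst[OF sf, symmetric]) auto
  also have "\<dots> = (\<integral>\<^sup>+G. ennreal (fro d n (noise_mat G)) \<partial>M)" by (simp add: nn_integral_sqnorm_mvec)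
  also have "\<dots> \<le> (\<integral>\<^sup>+G. (\<Sum>i<n. ennreal (16 / T\<^sup>2) *
      (if good G i then ennreal (sqnorm d (mvec d S (mvec d (Qi G i) (X G i)))) else 0)) \<partial>M)"
    by (intro nn_integral_mono fro_le)
  also have "\<dots> = (\<Sum>i<n. (\<integral>\<^sup>+G. ennreal (16 / T\<^sup>2) *
      (if good G i then ennreal (sqnorm d (mvec d S (mvec d (Qi G i) (X G i)))) else 0) \<partial>M))"
    using ms by (intro nn_integral_sum borel_measurable_times_ennreal borel_measurable_const) auto
  also have "\<dots> = (\<Sum>i<n. ennreal (16 / T\<^sup>2) * (\<integral>\<^sup>+G.
      (if good G i then ennreal (sqnorm d (mvec d S (mvec d (Qi G i) (X G i)))) else 0) \<partial>M))"
    using ms by (intro sum.cong refl nn_integral_cmult) auto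
  also have "\<dots> \<le> (\<Sum>i<n. ennreal (16 / T\<^sup>2) * ennreal Fmax)"
    by (intro sum_mono mult_left_mono nn_integral_good_signal) auto
  also have "\<dots> = (\<Sum>i<n. ennreal (16 / T\<^sup>2 * Fmax))"
    by (intro sum.cong refl ennreal_mult'[symmetric]) auto
  also have "\<dots> = ennreal (\<Sum>i<n. 16 / T\<^sup>2 * Fmax)"
    using Fmax_nonneg by (intro sum_ennreal) auto
  also have "(\<Sum>i<n. 16 / T\<^sup>2 * Fmax) = 16 * real n * Fmax / T\<^sup>2" by simp
  finally show ?thesis .
qed

end

section \<open>Consistency\<close>

context cov_sample
begin

text \<open>The error of the interpolator is the noise part minus Q w. On this event every
  \<open>D G i\<close> is nonzero, so the leave-one-out formula applies, and no column of
  \<open>noise_mat\<close> is truncated.\<close>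

lemma mni_loss_bounds:
  assumes ty: "\<And>i. i < n \<Longrightarrow> typical G i" and D: "\<And>i. i < n \<Longrightarrow> T / 4 \<le> D G i"
  shows "0 \<le> mni_loss n d \<sigma> \<Sigma> w (G, z) - \<sigma>\<^sup>2"
    and "mni_loss n d \<sigma> \<Sigma> w (G, z) - \<sigma>\<^sup>2 \<le> 2 * (\<kappa> * sqnorm d w) + 2 * \<sigma>\<^sup>2 * sqnorm d (mvec n (noise_mat G) z)"
proof -
  have "design d \<Sigma> G i = X G i" for i
    unfolding design_def psd_sqrt_eqI[OF rootS] X_def mvec_def by (rule ext) (simp add: rowv_def)
  then have design: "design d \<Sigma> G = X G" by blast
  let ?Q = "offp d (map (X G) [0..<n])"
  let ?w = "min_norm_interp n d (X G) (response d \<sigma> \<Sigma> w (G, z))"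
  have D0: "D G i \<noteq> 0" if "i < n" for i using D[OF that] T_pos by linarith
  have wj: "?w j = w j - mvec d ?Q w j + (\<Sum>i<n. \<sigma> * z i * (mvec d (Qi G i) (X G i) j / D G i))" if "j < d" for j
    unfolding Qi_def D_def
    by (rule min_norm_interp_leave_one_out[OF _ _ that])
      (use D0 in \<open>auto simp: D_def Qi_def response_def design\<close>)
  define e where "e = (\<lambda>j. \<sigma> * mvec n (noise_mat G) z j)"
  have noise: "noise_mat G j i = mvec d S (mvec d (Qi G i) (X G i)) j / D G i" if "i < n" for i j
    using that D typical_imp_good[OF _ ty] by (simp add: noise_mat_def)
  have "mvec d S (\<lambda>j. ?w j - w j) = mvec d S (\<lambda>j. (\<Sum>i<n. (\<sigma> * z i / D G i) * mvec d (Qi G i) (X G i) j) - mvec d ?Q w j)"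
    by (rule mvec_cong) (simp add: wj)
  also have "\<dots> = (\<lambda>j. e j - mvec d S (mvec d ?Q w) j)"
    unfolding mvec_diff mvec_sum[OF finite_lessThan] mvec_scale e_def mvec_def[of n]
    by (rule ext) (simp add: noise sum_distrib_left mult_ac)
  finally have "mni_loss n d \<sigma> \<Sigma> w (G, z) - \<sigma>\<^sup>2 = sqnorm d (\<lambda>j. e j - mvec d S (mvec d ?Q w) j)"
    unfolding mni_loss_def test_loss_def qform_def by (simp add: design flip: psd_root_sqnorm[OF rootS])
  moreover have "sqnorm d (\<lambda>j. e j - mvec d S (mvec d ?Q w) j) \<le> 2 * sqnorm d e + 2 * sqnorm d (mvec d S (mvec d ?Q w))"
    using sqnorm_nonneg[of d "\<lambda>j. e j + mvec d S (mvec d ?Q w) j"] unfolding sqnorm_add sqnorm_diff by linarith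
  moreover have "sqnorm d (mvec d S (mvec d ?Q w)) \<le> \<kappa> * sqnorm d w"
    using ty[of 0] n_large by (intro typical_bias) simp
  moreover have "sqnorm d e = \<sigma>\<^sup>2 * sqnorm d (mvec n (noise_mat G) z)" unfolding e_def by (rule sqnorm_scale)
  ultimately show "0 \<le> mni_loss n d \<sigma> \<Sigma> w (G, z) - \<sigma>\<^sup>2"
    and "mni_loss n d \<sigma> \<Sigma> w (G, z) - \<sigma>\<^sup>2 \<le> 2 * (\<kappa> * sqnorm d w) + 2 * \<sigma>\<^sup>2 * sqnorm d (mvec n (noise_mat G) z)"
    by simp_all
qed

theorem mni_loss_tail:
  assumes \<epsilon>: "0 < \<epsilon>" and w: "2 * (\<kappa> * sqnorm d w) \<le> \<epsilon> / 2"
  shows "measure (sample_space n d) {\<omega> \<in> space (sample_space n d). \<bar>mni_loss n d \<sigma> \<Sigma> w \<omega> - \<sigma>\<^sup>2\<bar> > \<epsilon>}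
    \<le> real n * exp (- real n / 100) + 400 * \<eta> + real n * (32 * Fmax / T\<^sup>2) + 4 * \<sigma>\<^sup>2 * (16 * real n * Fmax / T\<^sup>2) / \<epsilon>"
proof -
  let ?W = "sample_space n d"
  have W: "?W = M \<Otimes>\<^sub>M gauss {..<n}" by (simp add: sample_space_def)
  have fin: "finite_measure ?W"
    unfolding W by (intro prob_space.finite_measure prob_space_pair prob_space_gauss)
  let ?lift = "\<lambda>E. fst -` E \<inter> space ?W"
  have lift: "?lift E \<in> sets ?W" "measure ?W (?lift E) = measure M E" if "E \<in> sets M" for E
  proof -
    show "?lift E \<in> sets ?W" unfolding W by (rule measurable_sets[OF measurable_fst that])
    have "distr ?W M fst = M" unfolding W by (rule prob_space.distr_pair_fst[OF prob_space_gauss])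
    then show "measure ?W (?lift E) = measure M E"
      using measure_distr[of fst ?W M E] that unfolding W by simp
  qed
  define E1 where "E1 i = {G \<in> space M. \<not> avgweight d ({..<n} - {i}) L G \<le> ennreal (exp (real n / 100))}" for i
  define E2 where "E2 = {G \<in> space M. real n / 100 \<le> fro n d (rowmat d G L)}"
  define E3 where "E3 i = {G \<in> space M. good G i \<and> D G i < T / 4}" for i
  \<comment> \<open>The noise part of the loss bound is 2 \<sigma>^2 times the squared norm, so this
    is the event that it reaches \<epsilon> / 2; the bias takes the other half.\<close>
  define E4 where "E4 = {\<omega> \<in> space ?W. \<epsilon> \<le> 4 * \<sigma>\<^sup>2 * sqnorm d (mvec n (noise_mat (fst \<omega>)) (snd \<omega>))}"
  have s1: "E1 i \<in> sets M" for i
  proof -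
    have "avgweight d ({..<n} - {i}) L \<in> borel_measurable M" by (rule measurable_avgweight) auto
    then show ?thesis unfolding E1_def by measurable
  qed
  have s2: "E2 \<in> sets M" unfolding E2_def using measurable_rowmat by measurable
  have s3: "E3 i \<in> sets M" if "i < n" for i
    unfolding E3_def using measurable_good[of i] measurable_D[OF that] by measurable
  have mnoise: "(\<lambda>\<omega>. 4 * \<sigma>\<^sup>2 * sqnorm d (mvec n (noise_mat (fst \<omega>)) (snd \<omega>))) \<in> borel_measurable ?W"
    unfolding W by (intro borel_measurable_times borel_measurable_const measurable_noise)
  have s4: "E4 \<in> sets ?W" unfolding E4_def using mnoise by measurable
  let ?U1 = "\<Union>i\<in>{..<n}. ?lift (E1 i)" and ?U3 = "\<Union>i\<in>{..<n}. ?lift (E3 i)"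
  \<comment> \<open>The loss involves a definite description, so the failure set is compared with a
    union of events whose measurability has been established.\<close>
  have "{\<omega> \<in> space ?W. \<bar>mni_loss n d \<sigma> \<Sigma> w \<omega> - \<sigma>\<^sup>2\<bar> > \<epsilon>} \<subseteq> ?U1 \<union> (?lift E2 \<union> (?U3 \<union> E4))"
  proof
    fix \<omega> assume \<omega>: "\<omega> \<in> {\<omega> \<in> space ?W. \<bar>mni_loss n d \<sigma> \<Sigma> w \<omega> - \<sigma>\<^sup>2\<bar> > \<epsilon>}"
    obtain G z where Gz: "\<omega> = (G, z)" by (cases \<omega>)
    have G: "G \<in> space M" using \<omega> Gz by (simp add: W space_pair_measure)
    show "\<omega> \<in> ?U1 \<union> (?lift E2 \<union> (?U3 \<union> E4))"
    proof (rule ccontr)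
      assume neg: "\<omega> \<notin> ?U1 \<union> (?lift E2 \<union> (?U3 \<union> E4))"
      have sp: "\<omega> \<in> space ?W" using \<omega> by simp
      have ty: "typical G i" if "i < n" for i
      proof -
        have "G \<notin> E1 i" "G \<notin> E2" using neg that sp Gz by auto
        then show ?thesis using G by (simp add: E1_def E2_def typical_def)
      qed
      have D: "T / 4 \<le> D G i" if "i < n" for i
      proof -
        have "G \<notin> E3 i" using neg that sp Gz by auto
        then show ?thesis using G typical_imp_good[OF that ty[OF that]] by (simp add: E3_def)
      qed
      have "\<omega> \<notin> E4" using neg by blast
      then have "4 * \<sigma>\<^sup>2 * sqnorm d (mvec n (noise_mat G) z) < \<epsilon>" using sp by (simp add: E4_def Gz)
      then have "mni_loss n d \<sigma> \<Sigma> w \<omega> - \<sigma>\<^sup>2 \<le> \<epsilon>"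
        using mni_loss_bounds(2)[OF ty D, where \<sigma> = \<sigma> and w = w and z = z] w unfolding Gz by linarith
      then show False using \<omega> mni_loss_bounds(1)[OF ty D, where \<sigma> = \<sigma> and w = w and z = z] by (simp add: Gz)
    qed
  qed
  moreover have U: "?U1 \<in> sets ?W" "?lift E2 \<in> sets ?W" "?U3 \<in> sets ?W"
    by (intro sets.finite_UN lift(1) s1 s2 s3; simp)+
  ultimately have "measure ?W {\<omega> \<in> space ?W. \<bar>mni_loss n d \<sigma> \<Sigma> w \<omega> - \<sigma>\<^sup>2\<bar> > \<epsilon>}
      \<le> measure ?W (?U1 \<union> (?lift E2 \<union> (?U3 \<union> E4)))"
    using s4 by (intro finite_measure.finite_measure_mono[OF fin] sets.Un)
  also have "\<dots> \<le> measure ?W ?U1 + (measure ?W (?lift E2) + (measure ?W ?U3 + measure ?W E4))"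
    using U s4 by (intro order.trans[OF measure_Un_le] add_left_mono order.refl sets.Un)
  also have "\<dots> \<le> real n * exp (- real n / 100) + (400 * \<eta> + (real n * (32 * Fmax / T\<^sup>2) + 4 * \<sigma>\<^sup>2 * (16 * real n * Fmax / T\<^sup>2) / \<epsilon>))"
  proof (intro add_mono)
    have "measure ?W ?U1 \<le> (\<Sum>i\<in>{..<n}. measure ?W (?lift (E1 i)))"
      using lift(1) s1 by (intro measure_UNION_le) auto
    also have "\<dots> \<le> (\<Sum>i\<in>{..<n}. exp (- real n / 100))"
      unfolding lift(2)[OF s1] using prob_avgweight by (intro sum_mono) (simp add: E1_def)
    finally show "measure ?W ?U1 \<le> real n * exp (- real n / 100)" by simp
    show "measure ?W (?lift E2) \<le> 400 * \<eta>" unfolding lift(2)[OF s2] using prob_rowmat by (simp add: E2_def)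
    have "measure ?W ?U3 \<le> (\<Sum>i\<in>{..<n}. measure ?W (?lift (E3 i)))"
      using lift(1) s3 by (intro measure_UNION_le) auto
    also have "\<dots> \<le> (\<Sum>i\<in>{..<n}. 32 * Fmax / T\<^sup>2)"
      using prob_D_small lift(2)[OF s3] by (intro sum_mono) (simp add: E3_def)
    finally show "measure ?W ?U3 \<le> real n * (32 * Fmax / T\<^sup>2)" by simp
    show "measure ?W E4 \<le> 4 * \<sigma>\<^sup>2 * (16 * real n * Fmax / T\<^sup>2) / \<epsilon>"
      unfolding E4_def
    proof (rule markov_measure[OF fin mnoise _ _ \<epsilon>])
      have "(\<integral>\<^sup>+\<omega>. ennreal (4 * \<sigma>\<^sup>2 * sqnorm d (mvec n (noise_mat (fst \<omega>)) (snd \<omega>))) \<partial>?W)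
          = ennreal (4 * \<sigma>\<^sup>2) * (\<integral>\<^sup>+\<omega>. ennreal (sqnorm d (mvec n (noise_mat (fst \<omega>)) (snd \<omega>))) \<partial>?W)"
        using measurable_compose[OF measurable_noise measurable_ennreal]
        unfolding W by (subst nn_integral_cmult[symmetric]) (auto simp: ennreal_mult')
      also have "\<dots> \<le> ennreal (4 * \<sigma>\<^sup>2) * ennreal (16 * real n * Fmax / T\<^sup>2)"
        unfolding W by (intro mult_left_mono nn_integral_noise) auto
      also have "\<dots> = ennreal (4 * \<sigma>\<^sup>2 * (16 * real n * Fmax / T\<^sup>2))" by (rule ennreal_mult'[symmetric]) auto
      finally show "(\<integral>\<^sup>+\<omega>. ennreal (4 * \<sigma>\<^sup>2 * sqnorm d (mvec n (noise_mat (fst \<omega>)) (snd \<omega>))) \<partial>?W)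
          \<le> ennreal (4 * \<sigma>\<^sup>2 * (16 * real n * Fmax / T\<^sup>2))" .
      show "0 \<le> 4 * \<sigma>\<^sup>2 * (16 * real n * Fmax / T\<^sup>2)" using Fmax_nonneg by simp
    qed
  qed
  finally show ?thesis by simp
qed

end

section \<open>Trace inequalities and the expected norm in condition (3)\<close>

text \<open>A nonzero entry forces a nonzero diagonal entry, since every 2 by 2 principal minor is
  nonnegative.\<close>

lemma psd_trace_pos:
  assumes A: "psd d A" and "\<exists>i<d. \<exists>j<d. A i j \<noteq> 0"
  shows "0 < trace d A"
proof -
  obtain i j where ij: "i < d" "j < d" "A i j \<noteq> 0" using assms(2) by blast
  have "0 < (A i j)\<^sup>2" using ij by simp
  also have "\<dots> \<le> A i i * A j j" by (rule psd_entry[OF A ij(1,2)])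
  finally have "A i i \<noteq> 0" by auto
  then have "0 < A i i" using psd_diag[OF A ij(1)] by simp
  also have "\<dots> \<le> trace d A"
    unfolding trace_def using ij(1) psd_diag[OF A] by (intro member_le_sum) auto
  finally show ?thesis .
qed

lemma psd_fro_le_trace_sq: "psd d A \<Longrightarrow> fro d d A \<le> (trace d A)\<^sup>2"
  unfolding fro_def trace_def power2_eq_square[of "sum _ _"] sum_product
  by (intro sum_mono) (use psd_entry in auto)

text \<open>Uses \<open>t \<ge> 3 t\<^sup>2 / (2 s) - t\<^sup>4 / (2 s\<^sup>3)\<close>, i.e. \<open>x (x - 1)\<^sup>2 (x + 2) \<ge> 0\<close> for \<open>x = t / s\<close>, with \<open>s\<^sup>2 = 3 tr A\<close>.\<close>
lemma exp_norm_sqrtH_ge: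
  assumes A: "psd d A" and pos: "0 < trace d A"
  shows "sqrt (trace d A / 3) \<le> exp_norm_sqrtH d A"
proof -
  obtain R where R: "psd_root d A R" using psd_root_exists[OF A] by blast
  let ?\<gamma> = "gauss {..<d}" let ?q = "\<lambda>h. inner_k d h (mvec d A h)"
  define T where "T = trace d A"
  \<comment> \<open>With mean T and second moment at most 3 T^2, the lower bound is 3 T / (2 s) - 3
    T^2 / (2 s^3), which is largest at s^2 = 3 T and there equals s / 3.\<close>
  define s where "s = sqrt (3 * T)"
  have s: "0 < s" "s\<^sup>2 = 3 * T" using pos by (auto simp: s_def T_def)
  have q0: "0 \<le> ?q h" for h using psd_nonneg[OF A] .
  have iq: "integrable ?\<gamma> ?q" and iq2: "integrable ?\<gamma> (\<lambda>h. (?q h)\<^sup>2)"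
    by (rule gauss_integrable_qform gauss_integrable_qform_sq)+
  have isq: "integrable ?\<gamma> (\<lambda>h. sqrt (?q h))"
  proof (rule Bochner_Integration.integrable_bound)
    have "integrable ?\<gamma> (\<lambda>_. 1 :: real)"
      by (rule finite_measure.integrable_const[OF prob_space.finite_measure[OF prob_space_gauss]])
    then show "integrable ?\<gamma> (\<lambda>h. 1 + ?q h)" using iq by (rule Bochner_Integration.integrable_add)
    show "(\<lambda>h. sqrt (?q h)) \<in> borel_measurable ?\<gamma>"
      using iq by (intro measurable_compose[OF borel_measurable_integrable borel_measurable_sqrt])
    show "AE h in ?\<gamma>. norm (sqrt (?q h)) \<le> norm (1 + ?q h)"
    proof (rule AE_I2)
      fix h
      have "sqrt (?q h) \<le> 1 + ?q h"
        using q0[of h] by (intro real_le_lsqrt) (auto simp: power2_eq_square algebra_simps)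
      then show "norm (sqrt (?q h)) \<le> norm (1 + ?q h)" using q0[of h] by simp
    qed
  qed
  have pw: "3 / (2 * s) * ?q h - 1 / (2 * s ^ 3) * (?q h)\<^sup>2 \<le> sqrt (?q h)" for h
  proof -
    define x where "x = sqrt (?q h) / s"
    have x: "0 \<le> x" "sqrt (?q h) = s * x" "?q h = s\<^sup>2 * x\<^sup>2"
      using s q0[of h] by (auto simp: x_def power_divide)
    have "3 / (2 * s) * ?q h - 1 / (2 * s ^ 3) * (?q h)\<^sup>2 = s * (3 / 2 * x\<^sup>2 - 1 / 2 * x ^ 4)"
      unfolding x(3) using s(1) by (simp add: power2_eq_square power3_eq_cube power4_eq_xxxx field_simps)
    also have "\<dots> \<le> s * x"
    proof -
      have "x - (3 / 2 * x\<^sup>2 - 1 / 2 * x ^ 4) = 1 / 2 * x * (x - 1)\<^sup>2 * (x + 2)"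
        by (simp add: power2_eq_square power4_eq_xxxx algebra_simps)
      also have "\<dots> \<ge> 0" using x(1) by simp
      finally show ?thesis using s(1) by (intro mult_left_mono) auto
    qed
    finally show ?thesis using x(2) by simp
  qed
  have "3 / (2 * s) * T - 1 / (2 * s ^ 3) * (T\<^sup>2 + 2 * fro d d A)
      = (\<integral>h. 3 / (2 * s) * ?q h - 1 / (2 * s ^ 3) * (?q h)\<^sup>2 \<partial>?\<gamma>)"
    using iq iq2 gauss_qform_mean[OF psd_sym[OF A]] gauss_qform_second_moment[OF psd_sym[OF A]]
    by (simp add: T_def)
  also have "\<dots> \<le> (\<integral>h. sqrt (?q h) \<partial>?\<gamma>)"
    using iq iq2 by (intro integral_mono isq pw) auto
  also have "\<dots> = exp_norm_sqrtH d A"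
    unfolding exp_norm_sqrtH_def psd_sqrt_eqI[OF R] psd_root_sqnorm[OF R] ..
  finally have "3 / (2 * s) * T - 1 / (2 * s ^ 3) * (T\<^sup>2 + 2 * fro d d A) \<le> exp_norm_sqrtH d A" .
  moreover have "1 / (2 * s ^ 3) * (T\<^sup>2 + 2 * fro d d A) \<le> 1 / (2 * s ^ 3) * (3 * T\<^sup>2)"
    using psd_fro_le_trace_sq[OF A] s(1) by (intro mult_left_mono) (auto simp: T_def)
  moreover have "3 / (2 * s) * T - 1 / (2 * s ^ 3) * (3 * T\<^sup>2) = sqrt (T / 3)"
  proof -
    have T: "T = s\<^sup>2 / 3" using s by simp
    have "3 / (2 * s) * T - 1 / (2 * s ^ 3) * (3 * T\<^sup>2) = s / 3"
      unfolding T using s(1) by (simp add: power2_eq_square power3_eq_cube field_simps)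
    moreover have "sqrt (T / 3) = s / 3"
      using s(1) unfolding T by (intro real_sqrt_unique) (simp_all add: power_divide)
    ultimately show ?thesis by simp
  qed
  ultimately show ?thesis by (simp add: T_def)
qed

theorem theorem7:
  fixes d :: "nat \<Rightarrow> nat"
    and \<Sigma> \<Sigma>1 \<Sigma>2 :: "nat \<Rightarrow> nat \<Rightarrow> nat \<Rightarrow> real"
    and wstar :: "nat \<Rightarrow> nat \<Rightarrow> real"
    and \<sigma> :: real
  assumes d_ge: "\<And>n. d n \<ge> n"
    and psd: "\<And>n. psd (d n) (\<Sigma> n)"
    and sigma_nonneg: "\<sigma> \<ge> 0"
    and split: "\<And>n. cov_split (d n) (\<Sigma> n) (\<Sigma>1 n) (\<Sigma>2 n)"
    and nonzero: "\<And>n. \<exists>i<d n. \<exists>j<d n. \<Sigma>2 n i j \<noteq> 0"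
    and c1: "(\<lambda>n. real (mrank (d n) (\<Sigma>1 n)) / real n) \<longlonglongrightarrow> 0"
    and c2: "(\<lambda>n. real n / eff_rank (d n) (\<Sigma>2 n)) \<longlonglongrightarrow> 0"
    and c3: "(\<lambda>n. sqrt (sqnorm (d n) (wstar n)) * exp_norm_sqrtH (d n) (\<Sigma>2 n) / sqrt (real n))
               \<longlonglongrightarrow> 0"
  shows "\<forall>\<epsilon>>0. (\<lambda>n. measure (sample_space n (d n))
            {\<omega> \<in> space (sample_space n (d n)).
               \<bar>mni_loss n (d n) \<sigma> (\<Sigma> n) (wstar n) \<omega> - \<sigma>\<^sup>2\<bar> > \<epsilon>}) \<longlonglongrightarrow> 0"
proof (intro allI impI)
  fix \<epsilon> :: real assume \<epsilon>: "0 < \<epsilon>"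
  define T where "T n = trace (d n) (\<Sigma>2 n)" for n
  define k where "k n = real (mrank (d n) (\<Sigma>1 n))" for n
  define f where "f n = fro (d n) (d n) (\<Sigma>2 n)" for n
  define b where "b n = sqnorm (d n) (wstar n)" for n
  have psd1: "psd (d n) (\<Sigma>1 n)" and psd2: "psd (d n) (\<Sigma>2 n)" for n using split[of n] by (auto simp: cov_split_def)
  have T: "0 < T n" for n unfolding T_def by (rule psd_trace_pos[OF psd2 nonzero])
  have k: "(\<lambda>n. k n / real n) \<longlonglongrightarrow> 0" using c1 by (simp add: k_def)
  have f: "(\<lambda>n. real n * f n / (T n)\<^sup>2) \<longlonglongrightarrow> 0"
    using c2 by (simp add: eff_rank_def trace_mmul_sym[OF psd_sym[OF psd2]] T_def f_def)
  \<comment> \<open>Squaring condition (3) and replacing the expected norm by its lower bound sqrt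
    (T / 3) gives the quantity that controls the bias.\<close>
  have bT: "(\<lambda>n. b n * T n / real n) \<longlonglongrightarrow> 0"
  proof -
    let ?u = "\<lambda>n. sqrt (sqnorm (d n) (wstar n)) * exp_norm_sqrtH (d n) (\<Sigma>2 n) / sqrt (real n)"
    have lim: "(\<lambda>n. 3 * (?u n)\<^sup>2) \<longlonglongrightarrow> 0" using tendsto_mult_left[OF tendsto_power[OF c3, of 2], of 3] by simp
    have lower: "\<forall>\<^sub>F n in sequentially. 0 \<le> b n * T n / real n" using T by (simp add: b_def less_imp_le)
    have upper: "\<forall>\<^sub>F n in sequentially. b n * T n / real n \<le> 3 * (?u n)\<^sup>2"
    proof (rule always_eventually, rule allI)
      fix n
      have "sqrt (T n / 3) \<le> exp_norm_sqrtH (d n) (\<Sigma>2 n)"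
        unfolding T_def by (rule exp_norm_sqrtH_ge[OF psd2 T[unfolded T_def]])
      then have "(sqrt (T n / 3))\<^sup>2 \<le> (exp_norm_sqrtH (d n) (\<Sigma>2 n))\<^sup>2"
        using T[of n] by (intro power_mono) auto
      then have "T n / 3 \<le> (exp_norm_sqrtH (d n) (\<Sigma>2 n))\<^sup>2" using T[of n] by simp
      then have "b n * T n \<le> 3 * (b n * (exp_norm_sqrtH (d n) (\<Sigma>2 n))\<^sup>2)"
        using mult_left_mono[of "T n / 3" "(exp_norm_sqrtH (d n) (\<Sigma>2 n))\<^sup>2" "b n"] by (simp add: b_def)
      then have "b n * T n / real n \<le> 3 * (b n * (exp_norm_sqrtH (d n) (\<Sigma>2 n))\<^sup>2) / real n"
        by (rule divide_right_mono) simp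
      then show "b n * T n / real n \<le> 3 * (?u n)\<^sup>2"
        by (simp add: power_divide power_mult_distrib b_def)
    qed
    show ?thesis by (rule tendsto_sandwich[OF lower upper tendsto_const lim])
  qed
  let ?p = "\<lambda>n. measure (sample_space n (d n)) {\<omega> \<in> space (sample_space n (d n)).
               \<bar>mni_loss n (d n) \<sigma> (\<Sigma> n) (wstar n) \<omega> - \<sigma>\<^sup>2\<bar> > \<epsilon>}"
  have "\<forall>\<^sub>F n in sequentially. ?p n < \<delta>" if \<delta>: "0 < \<delta>" for \<delta>
  proof -
    \<comment> \<open>Chosen before n: the term 400 \<eta> takes half of \<delta>, and all remaining
      terms vanish as n grows with \<eta> fixed.\<close>
    define \<eta> where "\<eta> = min (1 / 128) (\<delta> / 800)"
    have \<eta>: "0 < \<eta>" "\<eta> \<le> 1 / 128" "400 * \<eta> \<le> \<delta> / 2" using \<delta> by (auto simp: \<eta>_def)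
    \<comment> \<open>This is n \<open>Fmax\<close> / T^2 with \<open>\<kappa>\<close> inserted: 4 k
      n (400 / (\<eta> n))^2 = 640000 k / (\<eta>^2 n). The first term vanishes by condition (1),
      the second by condition (2).\<close>
    define g where "g n = 640000 / \<eta>\<^sup>2 * (k n / real n) + 2 * (real n * f n / (T n)\<^sup>2)" for n
    have g: "g \<longlonglongrightarrow> 0"
      unfolding g_def using tendsto_add[OF tendsto_mult_left[OF k, of "640000 / \<eta>\<^sup>2"] tendsto_mult_left[OF f, of 2]] by simp
    have "(\<lambda>n. real n * exp (- 1 / 100) ^ n) \<longlonglongrightarrow> 0" by (rule powser_times_n_limit_0) simp
    then have "(\<lambda>n. real n * exp (- real n / 100)) \<longlonglongrightarrow> 0" by (simp flip: exp_of_nat_mult)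
    from tendsto_add[OF this tendsto_mult_left[OF g, of "32 + 64 * \<sigma>\<^sup>2 / \<epsilon>"]]
    have "(\<lambda>n. real n * exp (- real n / 100) + (32 + 64 * \<sigma>\<^sup>2 / \<epsilon>) * g n) \<longlonglongrightarrow> 0" by simp
    then have e1: "\<forall>\<^sub>F n in sequentially. real n * exp (- real n / 100) + (32 + 64 * \<sigma>\<^sup>2 / \<epsilon>) * g n < \<delta> / 2"
      using \<delta> by (intro order_tendstoD) auto
    have "(\<lambda>n. k n / real n + 1 / real n) \<longlonglongrightarrow> 0" using tendsto_add[OF k lim_1_over_n] by simp
    \<comment> \<open>Equivalent to \<open>rank_small\<close>, up to strictness.\<close>
    then have e2: "\<forall>\<^sub>F n in sequentially. k n / real n + 1 / real n < \<eta> / 400"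
      using \<eta> by (intro order_tendstoD) auto
    have e3: "\<forall>\<^sub>F n in sequentially. real n * f n / (T n)\<^sup>2 < 1 / 4"
      using f by (intro order_tendstoD) auto
    \<comment> \<open>The bias 2 \<open>\<kappa>\<close> |w|^2 equals 800 / \<eta> times this
      quantity, so the threshold makes it at most \<epsilon> / 2.\<close>
    have e4: "\<forall>\<^sub>F n in sequentially. b n * T n / real n < \<epsilon> * \<eta> / 1600"
      using bT \<epsilon> \<eta> by (intro order_tendstoD) auto
    show ?thesis
      using e1 e2 e3 e4 eventually_ge_at_top[of 100]
    proof eventually_elim
      case (elim n)
      have n: "0 < real n" using elim(5) by simp
      obtain S1 S2 where roots: "psd_root (d n) (\<Sigma>1 n) S1" "psd_root (d n) (\<Sigma>2 n) S2"
        using psd_root_exists[OF psd1] psd_root_exists[OF psd2] by metis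
      interpret C: cov_sample "d n" "\<Sigma> n" "\<Sigma>1 n" "\<Sigma>2 n" S1 S2 n \<eta>
      proof
        show "2 * (real (mrank (d n) (\<Sigma>1 n)) + 1) / \<eta> \<le> real n / 200"
        proof -
          have "(k n + 1) / real n \<le> \<eta> / 400" using elim(2) by (simp add: add_divide_distrib)
          then show ?thesis using n \<eta>(1) by (simp add: k_def field_simps)
        qed
        show "real n * fro (d n) (d n) (\<Sigma>2 n) \<le> (trace (d n) (\<Sigma>2 n) / 2)\<^sup>2"
        proof -
          have "real n * f n \<le> 1 / 4 * (T n)\<^sup>2" using elim(3) T[of n] by (simp add: field_simps)
          then show ?thesis by (simp add: f_def T_def power_divide)
        qed
      qed (use split roots elim \<eta> T[unfolded T_def] in auto)
      have CT: "C.T = T n" and Ck: "C.k = k n" by (simp_all add: C.T_def T_def C.k_def k_def)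
      have \<kappa>: "C.\<kappa> = 400 * T n / (\<eta> * real n)" by (simp add: C.\<kappa>_def CT)
      have "2 * (C.\<kappa> * b n) = 800 / \<eta> * (b n * T n / real n)" by (simp add: \<kappa>)
      also have "\<dots> \<le> 800 / \<eta> * (\<epsilon> * \<eta> / 1600)" using elim(4) \<eta> by (intro mult_left_mono) auto
      also have "\<dots> = \<epsilon> / 2" using \<eta> by simp
      finally have bias: "2 * (C.\<kappa> * sqnorm (d n) (wstar n)) \<le> \<epsilon> / 2" by (simp add: b_def)
      have gF: "real n * C.Fmax / (C.T)\<^sup>2 = g n"
        using T[of n] n \<eta>(1) unfolding C.Fmax_def \<kappa> CT Ck f_def[symmetric] g_def
        by (simp add: power2_eq_square field_simps)
      have "?p n \<le> real n * exp (- real n / 100) + 400 * \<eta> + 32 * g n + 64 * \<sigma>\<^sup>2 / \<epsilon> * g n"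
        using C.mni_loss_tail[OF \<epsilon> bias, of \<sigma>] unfolding gF[symmetric] by (simp add: mult_ac)
      also have "\<dots> = (real n * exp (- real n / 100) + (32 + 64 * \<sigma>\<^sup>2 / \<epsilon>) * g n) + 400 * \<eta>"
        by (simp add: algebra_simps)
      also have "\<dots> < \<delta>" using elim(1) \<eta>(3) by linarith
      finally show ?case .
    qed
  qed
  then have small: "\<And>\<delta>. 0 < \<delta> \<Longrightarrow> \<forall>\<^sub>F n in sequentially. ?p n < \<delta>" .
  show "?p \<longlonglongrightarrow> 0"
  proof (rule order_tendstoI)
    fix a :: real assume "a < 0"
    then show "\<forall>\<^sub>F n in sequentially. a < ?p n"
      by (intro always_eventually allI) (rule order.strict_trans2[OF _ measure_nonneg])
  qed (rule small)
qed

end
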